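(* Let $k$ be a field and let $c\ge1$, $d\ge2$ be integers, $n=c+d$. Suppose that there exists a $(d-1)$-dimensional Buchsbaum simplicial complex $\Delta^{\min}$ on $V=\{x_1,\dots,x_n\}$ (over $k$) such that $k[\Delta^{\min}]$ has $d$-linear resolution and $$\dim_kH^{d-1}_{\mathfrak m}(k[\Delta^{\min}])=\left\lfloor\frac{(c+d-2)\cdots(c+1)c}{d!}\right\rfloor.$$ Then there exists a Cohen--Macaulay cover $\widetilde\Delta$ of $\Delta^{\min}$ over $k$.
   Context: A simplicial complex $\Delta$ on $V=\{x_1,\dots,x_n\}$ is a collection of subsets of $V$ closed under taking subsets and containing every singleton $\{x_i\}$. $S=k[x_1,\dots,x_n]$ (standard grading), $I_\Delta$ is generated by the square-free monomials $x_{i_1}\cdots x_{i_r}$ with $\{x_{i_1},\dots,x_{i_r}\}\notin\Delta$, $k[\Delta]=S/I_\Delta$ is the Stanley--Reisner ring and $\mathfrak m$ its homogeneous maximal ideal. $\Delta$ is Buchsbaum over $k$ if it is pure and $\widetilde H_i(\operatorname{link}_\Delta F;k)=0$ for every nonempty face $F$ and every $i<\dim\operatorname{link}_\Delta F$. For $A=S/I$, $\beta_{i,j}(A)=\dim_k\operatorname{Tor}_i^S(A,k)_j$, $\operatorname{reg}A=\max\{j-i:\beta_{i,j}(A)\ne0\}$ and $\operatorname{indeg}A=\min\{j: I_j\neq0\}$. $A$ has $d$-linear resolution if $\operatorname{reg}A=\operatorname{indeg}A-1=d-1$. For a $(d-1)$-dimensional complex $\Delta$ on $V$ with $\operatorname{indeg}k[\Delta]=d$,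 a Cohen--Macaulay ($d$-linear) cover of $\Delta$ over $k$ is a $(d-1)$-dimensional simplicial complex $\widetilde\Delta$ on the same vertex set $V$ containing $\Delta$ as a subcomplex such that $k[\widetilde\Delta]$ is Cohen--Macaulay with $d$-linear resolution. *)

theory Defs
  imports "HOL-Library.Poly_Mapping" "HOL-Library.Extended_Nat" "HOL-Library.Cardinality"
    "HOL-Algebra.Algebraic_Closure_Type"
begin

text \<open>
  The variables \<open>x\<^sub>1, \<dots>, x\<^sub>n\<close> are the elements of a finite linearly ordered type \<open>'v\<close>, so that
  \<open>n = CARD('v)\<close> and \<open>V = UNIV\<close>; the order serves only to fix signs in the complexes below.
  The polynomial ring \<open>S\<close> is the type \<open>('v, 'k) mpoly\<close>.  A quotient \<open>A = S/I\<close> is represented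
  in the definitions by its ideal \<open>I\<close>.
\<close>

type_synonym ('v, 'k) mpoly = "('v \<Rightarrow>\<^sub>0 nat) \<Rightarrow>\<^sub>0 'k"
type_synonym ('v, 'k) laurent = "('v \<Rightarrow>\<^sub>0 int) \<Rightarrow>\<^sub>0 'k"


section \<open>Vector space dimension of a subquotient\<close>

text \<open>
  The dimension of \<open>Z/B\<close> over \<open>'k\<close> (\<open>\<infinity>\<close> if it is infinite) for subspaces \<open>B \<subseteq> Z\<close> of the space of
  functions \<open>'i \<Rightarrow> 'w\<close>: the supremum of the sizes of finite sets in \<open>Z\<close> that are linearly
  independent modulo \<open>B\<close>.  Here \<open>sc\<close> is the action of \<open>'k\<close> on \<open>'w\<close>.
\<close>

definition subquotient_dim ::
  "('k::field \<Rightarrow> 'w::ab_group_add \<Rightarrow> 'w) \<Rightarrow> ('i \<Rightarrow> 'w) set \<Rightarrow> ('i \<Rightarrow> 'w) set \<Rightarrow> enat" where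
  "subquotient_dim sc Z B =
     Sup {enat (card U) | U. finite U \<and> U \<subseteq> Z \<and>
       (\<forall>a. (\<lambda>t. \<Sum>u\<in>U. sc (a u) (u t)) \<in> B \<longrightarrow> (\<forall>u\<in>U. a u = 0))}"


section \<open>Simplicial complexes\<close>

definition simplicial_complex :: "'v set set \<Rightarrow> bool" where
  "simplicial_complex \<Delta> \<longleftrightarrow> (\<forall>F\<in>\<Delta>. \<forall>G\<subseteq>F. G \<in> \<Delta>) \<and> (\<forall>v. {v} \<in> \<Delta>)"

definition face_dim :: "'v set \<Rightarrow> int" where
  "face_dim F = int (card F) - 1"

definition complex_dim :: "'v::finite set set \<Rightarrow> int" where
  "complex_dim \<Delta> = Max (face_dim ` \<Delta>)"

definition facets :: "'v set set \<Rightarrow> 'v set set" where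
  "facets \<Delta> = {F \<in> \<Delta>. \<forall>G\<in>\<Delta>. F \<subseteq> G \<longrightarrow> F = G}"

definition pure :: "'v::finite set set \<Rightarrow> bool" where
  "pure \<Delta> \<longleftrightarrow> (\<forall>F\<in>facets \<Delta>. face_dim F = complex_dim \<Delta>)"

definition link :: "'v set set \<Rightarrow> 'v set \<Rightarrow> 'v set set" where
  "link \<Delta> F = {G. G \<inter> F = {} \<and> G \<union> F \<in> \<Delta>}"

text \<open>
  The sign of \<open>v\<close> in \<open>insert v G\<close>, where \<open>v \<notin> G\<close>.
\<close>

definition vsign :: "'v::{finite,linorder} \<Rightarrow> 'v set \<Rightarrow> 'a::ring_1" where
  "vsign v G = (- 1) ^ card {w \<in> G. w < v}"

text \<open>
  Reduced simplicial homology, computed from the augmented oriented chain complex (the empty face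
  spans the chains of degree \<open>-1\<close>).  A chain is the function giving its coefficients.
\<close>

definition simplicial_chains :: "'v::{finite,linorder} set set \<Rightarrow> int \<Rightarrow> ('v set \<Rightarrow> 'k::field) set" where
  "simplicial_chains \<Gamma> i = {z. \<forall>F. z F \<noteq> 0 \<longrightarrow> F \<in> \<Gamma> \<and> face_dim F = i}"

definition simplicial_boundary ::
  "('v::{finite,linorder} set \<Rightarrow> 'k::field) \<Rightarrow> 'v set \<Rightarrow> 'k" where
  "simplicial_boundary z G = (\<Sum>v\<in>UNIV - G. vsign v G * z (insert v G))"

definition reduced_homology_dim ::
  "'k::field itself \<Rightarrow> 'v::{finite,linorder} set set \<Rightarrow> int \<Rightarrow> enat" where
  "reduced_homology_dim _ \<Gamma> i =
     subquotient_dim ((*) :: 'k \<Rightarrow> 'k \<Rightarrow> 'k)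
       {z \<in> simplicial_chains \<Gamma> i. \<forall>G. simplicial_boundary z G = 0}
       (simplicial_boundary ` simplicial_chains \<Gamma> (i + 1))"

definition buchsbaum :: "'k::field itself \<Rightarrow> 'v::{finite,linorder} set set \<Rightarrow> bool" where
  "buchsbaum k \<Delta> \<longleftrightarrow> pure \<Delta> \<and>
     (\<forall>F\<in>\<Delta>. F \<noteq> {} \<longrightarrow>
       (\<forall>i < complex_dim (link \<Delta> F). reduced_homology_dim k (link \<Delta> F) i = 0))"


section \<open>Stanley--Reisner rings\<close>

abbreviation poly_ring :: "('v, 'k::field) mpoly ring" where
  "poly_ring \<equiv> ring_of_type_algebra"

definition pvar :: "'v \<Rightarrow> ('v, 'k::field) mpoly" where
  "pvar v = Poly_Mapping.single (Poly_Mapping.single v 1) 1"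

definition stanley_reisner_ideal :: "'k::field itself \<Rightarrow> 'v set set \<Rightarrow> ('v, 'k) mpoly set" where
  "stanley_reisner_ideal _ \<Delta> = genideal poly_ring {\<Prod>v\<in>F. pvar v | F. F \<notin> \<Delta>}"

definition homogeneous :: "int \<Rightarrow> ('v::finite, 'k::field) mpoly \<Rightarrow> bool" where
  "homogeneous t p \<longleftrightarrow> (\<forall>m\<in>Poly_Mapping.keys p. int (\<Sum>v\<in>UNIV. Poly_Mapping.lookup m v) = t)"

definition indeg :: "('v::finite, 'k::field) mpoly set \<Rightarrow> enat" where
  "indeg I = Inf {enat j | j. \<exists>p\<in>I. p \<noteq> 0 \<and> homogeneous (int j) p}"


section \<open>Graded Betti numbers\<close>

definition free_module :: "nat \<Rightarrow> (nat \<Rightarrow> 'a::zero) set" where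
  "free_module m = {v. \<forall>a\<ge>m. v a = 0}"

definition mat_apply :: "nat \<Rightarrow> nat \<Rightarrow> (nat \<Rightarrow> nat \<Rightarrow> 'a::comm_ring_1) \<Rightarrow> (nat \<Rightarrow> 'a) \<Rightarrow> nat \<Rightarrow> 'a" where
  "mat_apply m l M v = (\<lambda>a. if a < m then \<Sum>b<l. M a b * v b else 0)"

text \<open>
  A resolution \<open>\<dots> \<rightarrow> F\<^sub>1 \<rightarrow> F\<^sub>0 \<rightarrow> S/I \<rightarrow> 0\<close> by graded free \<open>S\<close>-modules of finite rank: \<open>F\<^sub>i\<close> has
  \<open>r i\<close> basis elements, the \<open>a\<close>-th of them of degree \<open>e i a\<close>; \<open>D i\<close> is the matrix of
  \<open>F\<^bsub>i+1\<^esub> \<rightarrow> F\<^sub>i\<close>, and \<open>\<epsilon> a\<close> is a homogeneous polynomial representing the image in \<open>S/I\<close> of the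
  \<open>a\<close>-th basis element of \<open>F\<^sub>0\<close>.  All maps preserve degrees.  The resolution need not be minimal.
\<close>

definition graded_free_resolution ::
  "('v::finite, 'k::field) mpoly set \<Rightarrow> (nat \<Rightarrow> nat) \<Rightarrow> (nat \<Rightarrow> nat \<Rightarrow> int) \<Rightarrow>
   (nat \<Rightarrow> ('v, 'k) mpoly) \<Rightarrow> (nat \<Rightarrow> nat \<Rightarrow> nat \<Rightarrow> ('v, 'k) mpoly) \<Rightarrow> bool" where
  "graded_free_resolution I r e \<epsilon> D \<longleftrightarrow>
     (\<forall>a < r 0. homogeneous (e 0 a) (\<epsilon> a)) \<and>
     (\<forall>i. \<forall>a < r i. \<forall>b < r (Suc i). homogeneous (e (Suc i) b - e i a) (D i a b)) \<and>
     (\<forall>p. \<exists>v\<in>free_module (r 0). p - (\<Sum>a<r 0. \<epsilon> a * v a) \<in> I) \<and>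
     mat_apply (r 0) (r 1) (D 0) ` free_module (r 1)
       = {v \<in> free_module (r 0). (\<Sum>a<r 0. \<epsilon> a * v a) \<in> I} \<and>
     (\<forall>i. mat_apply (r (i + 1)) (r (i + 2)) (D (i + 1)) ` free_module (r (i + 2))
       = {v \<in> free_module (r (i + 1)). mat_apply (r i) (r (i + 1)) (D i) v = (\<lambda>_. 0)})"

text \<open>
  Since \<open>k = S/(x\<^sub>1, \<dots>, x\<^sub>n)\<close>, the module \<open>F\<^sub>i \<otimes>\<^sub>S k\<close> is a \<open>k\<close>-vector space on the basis of \<open>F\<^sub>i\<close>, and
  the matrices of \<open>F \<otimes>\<^sub>S k\<close> consist of the constant terms of the entries of \<open>D\<close>.
\<close>

definition reduced_mat :: "(nat \<Rightarrow> nat \<Rightarrow> ('v, 'k::field) mpoly) \<Rightarrow> nat \<Rightarrow> nat \<Rightarrow> 'k" where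
  "reduced_mat M a b = Poly_Mapping.lookup (M a b) 0"

definition tensor_chains :: "(nat \<Rightarrow> nat) \<Rightarrow> (nat \<Rightarrow> nat \<Rightarrow> int) \<Rightarrow> nat \<Rightarrow> int \<Rightarrow> (nat \<Rightarrow> 'k::field) set" where
  "tensor_chains r e i j = {v. \<forall>a. v a \<noteq> 0 \<longrightarrow> a < r i \<and> e i a = j}"

definition tor_dim ::
  "(nat \<Rightarrow> nat) \<Rightarrow> (nat \<Rightarrow> nat \<Rightarrow> int) \<Rightarrow> (nat \<Rightarrow> nat \<Rightarrow> nat \<Rightarrow> ('v, 'k::field) mpoly) \<Rightarrow>
   nat \<Rightarrow> int \<Rightarrow> enat" where
  "tor_dim r e D i j =
     subquotient_dim ((*) :: 'k \<Rightarrow> 'k \<Rightarrow> 'k)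
       {v \<in> tensor_chains r e i j.
          i > 0 \<longrightarrow> mat_apply (r (i - 1)) (r i) (reduced_mat (D (i - 1))) v = (\<lambda>_. 0)}
       (mat_apply (r i) (r (i + 1)) (reduced_mat (D i)) ` tensor_chains r e (i + 1) j)"

text \<open>
  The number \<open>dim\<^sub>k Tor\<^sub>i(S/I, k)\<^sub>j\<close>, which does not depend on the resolution.
\<close>

definition betti :: "('v::finite, 'k::field) mpoly set \<Rightarrow> nat \<Rightarrow> int \<Rightarrow> enat" where
  "betti I i j = (THE b. \<exists>r e \<epsilon> D. graded_free_resolution I r e \<epsilon> D \<and> b = tor_dim r e D i j)"

definition reg :: "('v::finite, 'k::field) mpoly set \<Rightarrow> int" where
  "reg I = (GREATEST t. \<exists>i j. betti I i j \<noteq> 0 \<and> t = j - int i)"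

definition linear_resolution :: "nat \<Rightarrow> ('v::finite, 'k::field) mpoly set \<Rightarrow> bool" where
  "linear_resolution d I \<longleftrightarrow> indeg I = enat d \<and> reg I = int d - 1"


section \<open>Local cohomology\<close>

text \<open>
  \<open>H\<^sup>i\<^sub>\<mm>(S/I)\<close> is the cohomology of the Cech complex
  \<open>\<Oplus>\<^bsub>|F| = i\<^esub> (S/I)\<^bsub>x\<^sub>F\<^esub>\<close> on \<open>x\<^sub>1, \<dots>, x\<^sub>n\<close>, where \<open>x\<^sub>F\<close> is the product of the variables in \<open>F\<close>.
  The localization \<open>(S/I)\<^bsub>x\<^sub>F\<^esub>\<close> is \<open>S\<^bsub>x\<^sub>F\<^esub> / I\<^bsub>x\<^sub>F\<^esub>\<close>, where for an ideal \<open>J\<close> the localization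
  \<open>J\<^bsub>x\<^sub>F\<^esub> = {p / x\<^sub>F\<^sup>t | p \<in> J}\<close> is formed inside the Laurent polynomial ring.
\<close>

definition to_laurent :: "('v, 'k::field) mpoly \<Rightarrow> ('v, 'k) laurent" where
  "to_laurent p = (\<Sum>m\<in>Poly_Mapping.keys p.
     Poly_Mapping.single (Poly_Mapping.map int m) (Poly_Mapping.lookup p m))"

definition inverse_monomial :: "'v set \<Rightarrow> nat \<Rightarrow> ('v, 'k::field) laurent" where
  "inverse_monomial F t = Poly_Mapping.single (\<Sum>v\<in>F. Poly_Mapping.single v (- int t)) 1"

definition localization :: "('v, 'k::field) mpoly set \<Rightarrow> 'v set \<Rightarrow> ('v, 'k) laurent set" where
  "localization J F = {inverse_monomial F t * to_laurent p | t p. p \<in> J}"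

text \<open>
  Cochains are given by representatives in \<open>S\<^bsub>x\<^sub>F\<^esub>\<close>; cocycles and coboundaries are taken modulo
  \<open>I\<^bsub>x\<^sub>F\<^esub>\<close>, so that their quotient is the cohomology of the complex for \<open>S/I\<close>.
\<close>

definition cech_cochains :: "nat \<Rightarrow> ('v::{finite,linorder} set \<Rightarrow> ('v, 'k::field) laurent) set" where
  "cech_cochains i = {c. \<forall>F. c F \<in> localization UNIV F \<and> (card F \<noteq> i \<longrightarrow> c F = 0)}"

definition cech_differential ::
  "('v::{finite,linorder} set \<Rightarrow> ('v, 'k::field) laurent) \<Rightarrow> 'v set \<Rightarrow> ('v, 'k) laurent" where
  "cech_differential c G = (\<Sum>v\<in>G. vsign v (G - {v}) * c (G - {v}))"

definition cech_cocycles ::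
  "('v::{finite,linorder}, 'k::field) mpoly set \<Rightarrow> nat \<Rightarrow> ('v set \<Rightarrow> ('v, 'k) laurent) set" where
  "cech_cocycles I i = {c \<in> cech_cochains i. \<forall>G. cech_differential c G \<in> localization I G}"

definition cech_coboundaries ::
  "('v::{finite,linorder}, 'k::field) mpoly set \<Rightarrow> nat \<Rightarrow> ('v set \<Rightarrow> ('v, 'k) laurent) set" where
  "cech_coboundaries I i = {c \<in> cech_cochains i.
     if i = 0 then \<forall>F. c F \<in> localization I F
     else \<exists>b \<in> cech_cochains (i - 1). \<forall>F. c F - cech_differential b F \<in> localization I F}"

definition local_cohomology_dim :: "('v::{finite,linorder}, 'k::field) mpoly set \<Rightarrow> nat \<Rightarrow> enat" where
  "local_cohomology_dim I i =
     subquotient_dim (\<lambda>(a::'k) p. Poly_Mapping.single 0 a * p)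
       (cech_cocycles I i) (cech_coboundaries I i)"


section \<open>Cohen--Macaulay rings\<close>

definition krull_dim :: "('a, 'b) ring_scheme \<Rightarrow> enat" where
  "krull_dim R = Sup {enat l | l. \<exists>P :: nat \<Rightarrow> 'a set.
     (\<forall>i\<le>l. primeideal (P i) R) \<and> (\<forall>i<l. P i \<subset> P (Suc i))}"

text \<open>
  Each element of the list is a nonzerodivisor modulo the ideal generated by its predecessors, and
  the whole list generates a proper ideal.
\<close>

definition regular_sequence :: "('a, 'b) ring_scheme \<Rightarrow> 'a list \<Rightarrow> bool" where
  "regular_sequence R fs \<longleftrightarrow> set fs \<subseteq> carrier R \<and> genideal R (set fs) \<noteq> carrier R \<and>
     (\<forall>i < length fs. \<forall>a\<in>carrier R.
        (fs ! i) \<otimes>\<^bsub>R\<^esub> a \<in> genideal R (set (take i fs)) \<longrightarrow> a \<in> genideal R (set (take i fs)))"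

definition depth :: "('a, 'b) ring_scheme \<Rightarrow> 'a set \<Rightarrow> enat" where
  "depth R M = Sup {enat (length fs) | fs. regular_sequence R fs \<and> set fs \<subseteq> M}"

text \<open>
  For a homogeneous ideal \<open>I\<close>, the graded ring \<open>S/I\<close> with homogeneous maximal ideal
  \<open>\<mm> = (x\<^sub>1, \<dots>, x\<^sub>n)\<close> is Cohen--Macaulay if its depth with respect to \<open>\<mm>\<close> is its Krull dimension.
\<close>

definition quotient_max_ideal :: "('v, 'k::field) mpoly set \<Rightarrow> ('v, 'k) mpoly set set" where
  "quotient_max_ideal I = genideal (poly_ring Quot I) (range (\<lambda>v. I +>\<^bsub>poly_ring\<^esub> pvar v))"

definition cohen_macaulay :: "('v, 'k::field) mpoly set \<Rightarrow> bool" where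
  "cohen_macaulay I \<longleftrightarrow>
     depth (poly_ring Quot I) (quotient_max_ideal I) = krull_dim (poly_ring Quot I)"

definition cohen_macaulay_cover ::
  "'k::field itself \<Rightarrow> nat \<Rightarrow> 'v::finite set set \<Rightarrow> 'v set set \<Rightarrow> bool" where
  "cohen_macaulay_cover k d \<Delta> \<Delta>' \<longleftrightarrow>
     simplicial_complex \<Delta> \<and> complex_dim \<Delta> = int d - 1 \<and>
     indeg (stanley_reisner_ideal k \<Delta>) = enat d \<and>
     simplicial_complex \<Delta>' \<and> complex_dim \<Delta>' = int d - 1 \<and> \<Delta> \<subseteq> \<Delta>' \<and>
     cohen_macaulay (stanley_reisner_ideal k \<Delta>') \<and>
     linear_resolution d (stanley_reisner_ideal k \<Delta>')"

end

theory Submission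
  imports Defs
begin

text \<open>
  Since \<open>indeg = d\<close>, the complex contains all subsets of \<open>V\<close> with fewer than \<open>d\<close> elements, so it is
  determined by its faces with \<open>d\<close> elements.  By Hochster's formula the regularity is \<open>d - 1\<close> exactly
  if the top reduced homology vanishes, i.e. if these faces are independent in the matroid of the
  columns of the boundary matrix on all \<open>d\<close>-subsets (dually: the coboundaries restrict onto all
  functions on these faces).  Extend them to a basis of this matroid.  The resulting complex is acyclic,
  so the Koszul homology of its Stanley--Reisner ring on the variables is concentrated in the linear
  strand and vanishes in homological degrees above \<open>n - d\<close>.  The former gives the linear resolution; the
  latter makes the elementary symmetric polynomials of degrees \<open>1, \<dots>, d\<close> a regular sequence, over any
  field, so that the ring is Cohen--Macaulay.
\<close>

section \<open>Koszul complexes modulo an ideal\<close>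

text \<open>The definitions in the statement dictate most of the work. \<open>betti\<close> is a
  definite description over all graded free resolutions, so a Betti number can be used only once
  every resolution is known to give the same value and some resolution of finite rank is known to
  exist. The first comes from a double complex that compares a resolution with the Koszul complex of
  the variables, the second from the Taylor resolution. \<open>cohen_macaulay\<close> compares
  suprema over arbitrary prime chains and regular sequences, homogeneous or not; both are bounded by
  \<open>d\<close> by one and the same count of monomials. A linear system of parameters may fail to
  exist over a finite field, whereas every variable is integral over the elementary symmetric
  polynomials. The two halves of the basis property have separate jobs: independence kills the
  Koszul homology just above the linear strand, spanning kills the last class of the strand, in
  homological degree \<open>n - d + 1\<close> and multidegree \<open>(1, ..., 1)\<close>.\<close>

definition ksign :: "'l::linorder \<Rightarrow> 'l set \<Rightarrow> 'a::ring_1" where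
  "ksign l J = (- 1) ^ card {w \<in> J. w < l}"

lemma ksign_mult_self [simp]: "ksign l J * ksign l J = (1 :: 'a::comm_ring_1)"
  unfolding ksign_def by (metis power_mult_distrib power_one mult_minus1 minus_minus)

lemma ksign_mult_self_left [simp]: "ksign l J * (ksign l J * x) = (x :: 'a::comm_ring_1)"
  by (metis ksign_mult_self mult.assoc mult_1)

lemma ksign_empty [simp]: "ksign l {} = 1"
  by (simp add: ksign_def)

lemma ksign_insert_less:
  assumes "finite J" "w \<notin> J" "w < l"
  shows "ksign l (insert w J) = (- ksign l J :: 'a::comm_ring_1)"
proof -
  have "{u \<in> insert w J. u < l} = insert w {u \<in> J. u < l}" using assms by auto
  then show ?thesis using assms by (simp add: ksign_def)
qed

lemma ksign_insert_greater:
  assumes "l < w"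
  shows "ksign l (insert w J) = (ksign l J :: 'a::comm_ring_1)"
proof -
  have "{u \<in> insert w J. u < l} = {u \<in> J. u < l}" using assms by auto
  then show ?thesis by (simp add: ksign_def)
qed

text \<open>Of the two indices the smaller one changes the sign of the larger one and not
  conversely, so exactly one of the two factors flips. This is the sign identity behind
  \<open>d d = 0\<close>.\<close>

lemma ksign_swap:
  assumes "finite J" "w \<notin> J" "l \<notin> J" "w \<noteq> l"
  shows "ksign w (insert l J) * ksign l (insert w J) = (- (ksign l J * ksign w J) :: 'a::comm_ring_1)"
proof (cases "w < l")
  case True
  then show ?thesis using assms by (simp add: ksign_insert_less ksign_insert_greater mult.commute)
next
  case False
  then have "l < w" using assms by simp
  then show ?thesis using assms by (simp add: ksign_insert_less ksign_insert_greater mult.commute)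
qed

text \<open>A chain is the function of its coefficients, and the value at \<open>J\<close> collects
  what arrives from all \<open>insert l J\<close>. With \<open>y\<close> constantly 1 this is the
  augmented boundary of the full simplex on \<open>L\<close>.\<close>

definition kdiff :: "('l::linorder \<Rightarrow> 'a::comm_ring_1) \<Rightarrow> 'l set \<Rightarrow> ('l set \<Rightarrow> 'a) \<Rightarrow> 'l set \<Rightarrow> 'a" where
  "kdiff y L z J = (\<Sum>l\<in>L - J. ksign l J * y l * z (insert l J))"

text \<open>All degrees from \<open>m\<close> on are kept together: vanishing of homology from some
  degree on is the form of statement that passes between \<open>L\<close> and
  \<open>insert l L\<close>.\<close>

definition kchains :: "'l set \<Rightarrow> nat \<Rightarrow> ('l set \<Rightarrow> 'a::zero) set" where
  "kchains L m = {z. \<forall>J. z J \<noteq> 0 \<longrightarrow> J \<subseteq> L \<and> m \<le> card J}"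

lemma kchainsI: "(\<And>J. z J \<noteq> 0 \<Longrightarrow> J \<subseteq> L \<and> m \<le> card J) \<Longrightarrow> z \<in> kchains L m"
  by (auto simp: kchains_def)

lemma kchains_outside: "z \<in> kchains L m \<Longrightarrow> \<not> (J \<subseteq> L \<and> m \<le> card J) \<Longrightarrow> z J = 0"
  by (auto simp: kchains_def)

lemma kchains_add: "a \<in> kchains L m \<Longrightarrow> b \<in> kchains L m \<Longrightarrow> (\<lambda>J. a J + b J) \<in> kchains L m"
  for a b :: "'l set \<Rightarrow> 'a::comm_ring_1"
  by (rule kchainsI) (metis add.right_neutral kchains_outside)

lemma kchains_mult: "a \<in> kchains L m \<Longrightarrow> (\<lambda>J. r * a J) \<in> kchains L m"
  for a :: "'l set \<Rightarrow> 'a::comm_ring_1"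
  by (rule kchainsI) (metis mult_zero_right kchains_outside)

lemma kchains_minus: "a \<in> kchains L m \<Longrightarrow> (\<lambda>J. - a J) \<in> kchains L m"
  for a :: "'l set \<Rightarrow> 'a::comm_ring_1"
  by (simp add: kchains_def)

lemma kdiff_add: "kdiff y L (\<lambda>J. a J + b J) J = kdiff y L a J + kdiff y L b J"
  by (simp add: kdiff_def algebra_simps sum.distrib)

lemma kdiff_minus: "kdiff y L (\<lambda>J. - a J) J = - kdiff y L a J"
  by (simp add: kdiff_def sum_negf)

lemma kdiff_diff: "kdiff y L (\<lambda>J. a J - b J) J = kdiff y L a J - kdiff y L b J"
  by (simp add: kdiff_def algebra_simps sum_subtractf)

lemma kdiff_mult: "kdiff y L (\<lambda>J. r * a J) J = r * kdiff y L a J"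
  by (simp add: kdiff_def sum_distrib_left mult_ac)

lemma kdiff_sum: "kdiff y L (\<lambda>J. \<Sum>i\<in>A. a i J) J = (\<Sum>i\<in>A. kdiff y L (a i) J)"
  unfolding kdiff_def sum_distrib_left by (rule sum.swap)

lemma kdiff_zero [simp]: "kdiff y L (\<lambda>J. 0) J = 0"
  by (simp add: kdiff_def)

lemma kdiff_cong_sub:
  assumes "\<And>l. l \<in> L - J \<Longrightarrow> y l * z (insert l J) = y' l * z' (insert l J)"
  shows "kdiff y L z J = kdiff y' L z' J"
  unfolding kdiff_def by (rule sum.cong) (use assms in \<open>auto simp: mult.assoc\<close>)

lemma kdiff_kchains_0:
  assumes "z \<in> kchains L 0"
  shows "kdiff y L z \<in> kchains L 0"
proof (rule kchainsI)
  fix J assume "kdiff y L z J \<noteq> 0"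
  then obtain l where "l \<in> L - J" "z (insert l J) \<noteq> 0"
    unfolding kdiff_def by (metis (lifting) mult_zero_right sum.neutral)
  then show "J \<subseteq> L \<and> 0 \<le> card J" using assms by (auto simp: kchains_def)
qed

text \<open>
  \<open>kjoin l a b\<close> stands for \<open>a + e\<^sub>l \<and> b\<close>: it identifies the Koszul complex on \<open>insert l L\<close> with the
  mapping cone of multiplication by \<open>y l\<close> on the Koszul complex on \<open>L\<close>.
\<close>

definition kjoin :: "'l::linorder \<Rightarrow> ('l set \<Rightarrow> 'a::comm_ring_1) \<Rightarrow> ('l set \<Rightarrow> 'a) \<Rightarrow> 'l set \<Rightarrow> 'a" where
  "kjoin l a b J = (if l \<in> J then ksign l (J - {l}) * b (J - {l}) else a J)"

definition kpart0 :: "'l \<Rightarrow> ('l set \<Rightarrow> 'a::comm_ring_1) \<Rightarrow> 'l set \<Rightarrow> 'a" where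
  "kpart0 l z J = (if l \<in> J then 0 else z J)"

definition kpart1 :: "'l::linorder \<Rightarrow> ('l set \<Rightarrow> 'a::comm_ring_1) \<Rightarrow> 'l set \<Rightarrow> 'a" where
  "kpart1 l z J = (if l \<in> J then 0 else ksign l J * z (insert l J))"

lemma kjoin_parts: "kjoin l (kpart0 l z) (kpart1 l z) = z"
  by (auto simp: kjoin_def kpart0_def kpart1_def fun_eq_iff insert_absorb)

lemma kpart0_kchains: "z \<in> kchains (insert l L) m \<Longrightarrow> kpart0 l z \<in> kchains L m"
  by (auto simp: kchains_def kpart0_def)

lemma kpart1_kchains:
  assumes "z \<in> kchains (insert l L) (Suc m)" "finite L"
  shows "kpart1 l z \<in> kchains L m"
proof (rule kchainsI)
  fix J assume "kpart1 l z J \<noteq> 0"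
  then have "l \<notin> J" "z (insert l J) \<noteq> 0" by (auto simp: kpart1_def split: if_splits)
  then have "insert l J \<subseteq> insert l L" "Suc m \<le> card (insert l J)" "J \<subseteq> L" using assms
    by (auto simp: kchains_def)
  then show "J \<subseteq> L \<and> m \<le> card J" using \<open>l \<notin> J\<close> assms(2) finite_subset[of J L] by auto
qed

lemma kjoin_kchains:
  assumes "a \<in> kchains L m" "b \<in> kchains L (m - 1)" "l \<notin> L" "finite L"
  shows "kjoin l a b \<in> kchains (insert l L) m"
proof (rule kchainsI)
  fix J assume J: "kjoin l a b J \<noteq> 0"
  show "J \<subseteq> insert l L \<and> m \<le> card J"
  proof (cases "l \<in> J")
    case True
    then have "b (J - {l}) \<noteq> 0" using J by (auto simp: kjoin_def)
    then have *: "J - {l} \<subseteq> L" "m - 1 \<le> card (J - {l})" using assms by (auto simp: kchains_def)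
    moreover have "finite J" using * assms(4) by (meson finite_Diff2 finite.emptyI finite.insertI finite_subset)
    moreover have "card J > 0" using True \<open>finite J\<close> card_gt_0_iff by blast
    ultimately show ?thesis using True by auto
  next
    case False
    then have "a J \<noteq> 0" using J by (auto simp: kjoin_def)
    then show ?thesis using assms by (auto simp: kchains_def)
  qed
qed

text \<open>The differential of the cone sends \<open>(a, b)\<close> to
  \<open>(d a + y l * b, - d b)\<close>; the minus sign comes from
  \<open>ksign_swap\<close>.\<close>

lemma kdiff_kjoin:
  assumes "l \<notin> L" "finite L" "b \<in> kchains L 0"
  shows "kdiff y (insert l L) (kjoin l a b) =
    kjoin l (\<lambda>J. kdiff y L a J + y l * b J) (\<lambda>J. - kdiff y L b J)"
proof
  fix J
  show "kdiff y (insert l L) (kjoin l a b) J =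
    kjoin l (\<lambda>J. kdiff y L a J + y l * b J) (\<lambda>J. - kdiff y L b J) J"
  proof (cases "l \<in> J")
    case False
    then have "insert l L - J = insert l (L - J)" by auto
    then have "kdiff y (insert l L) (kjoin l a b) J =
       ksign l J * y l * kjoin l a b (insert l J) + kdiff y L (kjoin l a b) J"
      using assms by (simp add: kdiff_def)
    moreover have "kdiff y L (kjoin l a b) J = kdiff y L a J"
      by (rule kdiff_cong_sub) (use False assms in \<open>auto simp: kjoin_def\<close>)
    moreover have "ksign l J * y l * kjoin l a b (insert l J) = y l * b J"
      using False by (simp add: kjoin_def mult_ac)
    ultimately show ?thesis using False by (simp add: kjoin_def)
  next
    case True
    define K where "K = J - {l}"
    have J: "J = insert l K" "l \<notin> K" using True by (auto simp: K_def)
    have "kdiff y (insert l L) (kjoin l a b) J =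
      (\<Sum>w\<in>L - K. - ksign l K * (ksign w K * y w * b (insert w K)))"
      unfolding kdiff_def
    proof (rule sum.cong)
      show "insert l L - J = L - K" using J assms by auto
      fix w assume w: "w \<in> L - K"
      then have wl: "w \<noteq> l" using assms by auto
      then have ins: "insert w J - {l} = insert w K" using J by auto
      show "ksign w J * y w * kjoin l a b (insert w J) = - ksign l K * (ksign w K * y w * b (insert w K))"
      \<comment> \<open>\<open>ksign_swap\<close> asks for a finite set. Outside \<open>L\<close>
        the set may be infinite, but there \<open>b\<close> vanishes.\<close>
      proof (cases "insert w K \<subseteq> L")
        case False
        then have "b (insert w K) = 0" using assms(3) by (auto simp: kchains_def)
        then show ?thesis using True ins by (simp add: kjoin_def)
      next
        case T: True
        then have "finite K" using assms(2) finite_subset by auto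
        then have "ksign w J * ksign l (insert w K) = (- (ksign l K * ksign w K) :: 'b)"
          using ksign_swap[of K w l] w J(2) wl J(1) by simp
        moreover have "ksign w J * y w * kjoin l a b (insert w J) =
          (ksign w J * ksign l (insert w K)) * (y w * b (insert w K))"
          using True ins by (simp add: kjoin_def mult_ac)
        ultimately show ?thesis by (simp add: mult_ac)
      qed
    qed
    also have "\<dots> = ksign l K * (- kdiff y L b K)"
      by (simp add: kdiff_def sum_distrib_left sum_negf)
    finally show ?thesis using True by (simp add: kjoin_def K_def)
  qed
qed

text \<open>By induction along the cone: the two cross terms \<open>y l * kdiff y L b\<close> enter
  with opposite signs.\<close>

lemma kdiff_kdiff:
  assumes "finite L" "z \<in> kchains L 0"
  shows "kdiff y L (kdiff y L z) J = 0"
  using assms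
proof (induction L arbitrary: z J rule: finite_induct)
  case empty
  then show ?case by (simp add: kdiff_def)
next
  case (insert l L)
  define a where "a = kpart0 l z"
  define b where "b = kpart1 l z"
  have z: "z = kjoin l a b" by (simp add: a_def b_def kjoin_parts)
  have a: "a \<in> kchains L 0" using insert.prems by (simp add: a_def kpart0_kchains)
  have b: "b \<in> kchains L 0"
  proof (rule kchainsI)
    fix J assume "b J \<noteq> 0"
    then have "l \<notin> J" "z (insert l J) \<noteq> 0" by (auto simp: b_def kpart1_def split: if_splits)
    then show "J \<subseteq> L \<and> 0 \<le> card J" using insert.prems insert.hyps by (auto simp: kchains_def)
  qed
  have nb: "(\<lambda>J. - kdiff y L b J) \<in> kchains L 0"
    by (intro kchains_minus kdiff_kchains_0 b)
  have "kdiff y (insert l L) z = kjoin l (\<lambda>J. kdiff y L a J + y l * b J) (\<lambda>J. - kdiff y L b J)"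
    using kdiff_kjoin[of l L b y a] insert.hyps b z by simp
  then have "kdiff y (insert l L) (kdiff y (insert l L) z) =
     kjoin l (\<lambda>J. kdiff y L (\<lambda>J. kdiff y L a J + y l * b J) J + y l * (- kdiff y L b J))
       (\<lambda>J. - kdiff y L (\<lambda>J. - kdiff y L b J) J)"
    using kdiff_kjoin[of l L "(\<lambda>J. - kdiff y L b J)" y] insert.hyps nb by simp
  then show ?case using insert.IH[OF a] insert.IH[OF b]
    by (simp add: kdiff_add kdiff_mult kdiff_minus kjoin_def)
qed

section \<open>Koszul homology with coefficients in the quotient by an ideal\<close>

locale cring_ideal =
  fixes I :: "'a::comm_ring_1 set"
  assumes zero_mem [simp, intro]: "0 \<in> I"
    and add_mem: "a \<in> I \<Longrightarrow> b \<in> I \<Longrightarrow> a + b \<in> I"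
    and mult_mem: "a \<in> I \<Longrightarrow> r * a \<in> I"
begin

lemma minus_mem: "a \<in> I \<Longrightarrow> - a \<in> I"
  using mult_mem[of a "- 1"] by simp

lemma diff_mem: "a \<in> I \<Longrightarrow> b \<in> I \<Longrightarrow> a - b \<in> I"
  using add_mem[of a "- b"] minus_mem[of b] by simp

lemma diff_mem_sym: "a - b \<in> I \<Longrightarrow> b - a \<in> I"
  using minus_mem[of "a - b"] by simp

lemma diff_mem_trans: "a - b \<in> I \<Longrightarrow> b - c \<in> I \<Longrightarrow> a - c \<in> I"
  using add_mem[of "a - b" "b - c"] by simp

lemma mem_cong: "a - b \<in> I \<Longrightarrow> a \<in> I \<longleftrightarrow> b \<in> I"
  using add_mem[of "a - b" b] diff_mem[of a "a - b"] by auto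

lemma mult_mem_right: "a \<in> I \<Longrightarrow> a * r \<in> I"
  using mult_mem[of a r] by (simp add: mult.commute)

lemma sum_mem: "(\<And>i. i \<in> A \<Longrightarrow> f i \<in> I) \<Longrightarrow> sum f A \<in> I"
  by (induction A rule: infinite_finite_induct) (auto intro: add_mem)

lemma kdiff_mem: "(\<And>J. z J \<in> I) \<Longrightarrow> kdiff y L z J \<in> I"
  unfolding kdiff_def by (intro sum_mem mult_mem)

lemma kdiff_cong_mem: "(\<And>J. z J - z' J \<in> I) \<Longrightarrow> kdiff y L z J - kdiff y L z' J \<in> I"
  using kdiff_mem[of "\<lambda>J. z J - z' J" y L J] by (simp add: kdiff_diff)

text \<open>Coefficients stay in the ring and equations hold modulo \<open>I\<close>, so no quotient
  ring is formed. Accordingly \<open>koszul_vanishing y L m\<close> says that the Koszul homology of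
  the quotient is zero in all degrees from \<open>m\<close> on.\<close>

definition kcycle :: "('l::linorder \<Rightarrow> 'a) \<Rightarrow> 'l set \<Rightarrow> ('l set \<Rightarrow> 'a) \<Rightarrow> bool" where
  "kcycle y L z \<longleftrightarrow> (\<forall>J. kdiff y L z J \<in> I)"

definition kboundary :: "('l::linorder \<Rightarrow> 'a) \<Rightarrow> 'l set \<Rightarrow> nat \<Rightarrow> ('l set \<Rightarrow> 'a) \<Rightarrow> bool" where
  "kboundary y L m z \<longleftrightarrow> (\<exists>w\<in>kchains L (Suc m). \<forall>J. z J - kdiff y L w J \<in> I)"

definition koszul_vanishing :: "('l::linorder \<Rightarrow> 'a) \<Rightarrow> 'l set \<Rightarrow> nat \<Rightarrow> bool" where
  "koszul_vanishing y L m \<longleftrightarrow> (\<forall>z\<in>kchains L m. kcycle y L z \<longrightarrow> kboundary y L m z)"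

lemma kjoin_mem: "(\<And>J. l \<notin> J \<Longrightarrow> a J \<in> I) \<Longrightarrow> (\<And>J. l \<notin> J \<Longrightarrow> b J \<in> I) \<Longrightarrow> kjoin l a b J \<in> I"
  by (auto simp: kjoin_def intro: mult_mem)

lemma kjoin_diff: "kjoin l a b J - kjoin l a' b' J = kjoin l (\<lambda>J. a J - a' J) (\<lambda>J. b J - b' J) J"
  by (auto simp: kjoin_def algebra_simps)

lemma kchains_mono: "z \<in> kchains L m \<Longrightarrow> k \<le> m \<Longrightarrow> z \<in> kchains L k"
  by (auto simp: kchains_def)

lemma kjoin_memD:
  assumes "\<And>J. kjoin l a b J \<in> I" "l \<notin> J"
  shows "a J \<in> I" "b J \<in> I"
proof -
  show "a J \<in> I" using assms(1)[of J] assms(2) by (simp add: kjoin_def)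
  have "ksign l J * kjoin l a b (insert l J) \<in> I" by (rule mult_mem[OF assms(1)])
  then show "b J \<in> I" using assms(2) by (simp add: kjoin_def)
qed

lemma kcycle_kjoinD:
  assumes "l \<notin> L" "finite L" "a \<in> kchains L 0" "b \<in> kchains L 0" "kcycle y (insert l L) (kjoin l a b)"
  shows "kcycle y L b" "\<And>J. kdiff y L a J + y l * b J \<in> I"
proof -
  have *: "kjoin l (\<lambda>J. kdiff y L a J + y l * b J) (\<lambda>J. - kdiff y L b J) J \<in> I" for J
    using assms(5) kdiff_kjoin[OF assms(1,2,4), of y a] by (auto simp: kcycle_def)
  show "kcycle y L b" unfolding kcycle_def
  proof
    fix J
    show "kdiff y L b J \<in> I"
    proof (cases "l \<in> J")
      case True
      then have "b (insert w J) = 0" for w using assms by (auto simp: kchains_def)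
      then show ?thesis by (simp add: kdiff_def)
    next
      case False
      then show ?thesis using kjoin_memD(2)[OF *] minus_mem by fastforce
    qed
  qed
  fix J
  show "kdiff y L a J + y l * b J \<in> I"
  proof (cases "l \<in> J")
    case True
    then have "b (insert w J) = 0" "a (insert w J) = 0" "b J = 0" for w using assms by (auto simp: kchains_def)
    then show ?thesis by (simp add: kdiff_def)
  next
    case False
    then show ?thesis using kjoin_memD(1)[OF *] by simp
  qed
qed

text \<open>Long exact sequence of the cone: in degree \<open>i > m\<close> the homology on
  \<open>insert l L\<close> sits between those on \<open>L\<close> in degrees \<open>i\<close> and
  \<open>i - 1\<close>, which are both zero. Concretely, a chain \<open>w1\<close> bounding
  \<open>b\<close> turns \<open>a\<close> into the cycle \<open>a + y l * w1\<close>, which bounds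
  as well.\<close>

lemma koszul_vanishing_insert:
  assumes V: "koszul_vanishing y L m" and l: "l \<notin> L" "finite L"
  shows "koszul_vanishing y (insert l L) (Suc m)"
  unfolding koszul_vanishing_def
proof (intro ballI impI)
  fix z assume z: "z \<in> kchains (insert l L) (Suc m)" and cyc: "kcycle y (insert l L) z"
  define a where "a = kpart0 l z"
  define b where "b = kpart1 l z"
  have zab: "z = kjoin l a b" by (simp add: a_def b_def kjoin_parts)
  have a: "a \<in> kchains L (Suc m)" using z by (simp add: a_def kpart0_kchains)
  have b: "b \<in> kchains L m" using z l by (simp add: b_def kpart1_kchains)
  have a0: "a \<in> kchains L 0" and b0: "b \<in> kchains L 0"
    using kchains_mono[OF a, of 0] kchains_mono[OF b, of 0] by auto
  note cd = kcycle_kjoinD[OF l a0 b0 cyc[unfolded zab]]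
  from V b cd(1) obtain w1 where w1: "w1 \<in> kchains L (Suc m)" "\<And>J. b J - kdiff y L w1 J \<in> I"
    unfolding koszul_vanishing_def kboundary_def by blast
  define u where "u J = a J + y l * w1 J" for J
  have u: "u \<in> kchains L (Suc m)" unfolding u_def by (intro kchains_add kchains_mult a w1)
  have "kcycle y L u" unfolding kcycle_def
  proof
    fix J
    have "u = (\<lambda>J. a J + y l * w1 J)" by (simp add: u_def fun_eq_iff)
    then have "kdiff y L u J = (kdiff y L a J + y l * b J) - y l * (b J - kdiff y L w1 J)"
      by (simp add: kdiff_add kdiff_mult) (simp add: algebra_simps)
    then show "kdiff y L u J \<in> I" using cd(2) w1(2) by (auto intro: diff_mem mult_mem)
  qed
  then obtain v where v: "v \<in> kchains L (Suc m)" "\<And>J. u J - kdiff y L v J \<in> I"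
    using V u kchains_mono[OF u, of m] unfolding koszul_vanishing_def kboundary_def by (meson le_SucI order_refl)
  \<comment> \<open>Vanishing at level \<open>m\<close> only yields a chain of degrees from
    \<open>Suc m\<close> on. Its part of degree exactly \<open>Suc m\<close> has its boundary in
    degree \<open>m\<close>, where \<open>u\<close> is zero, so this part can be cut off.\<close>
  have v2: "\<exists>v\<in>kchains L (Suc (Suc m)). \<forall>J. u J - kdiff y L v J \<in> I"
  proof
    define v' where "v' J = (if Suc (Suc m) \<le> card J then v J else 0)" for J
    show "v' \<in> kchains L (Suc (Suc m))" using v by (auto simp: kchains_def v'_def)
    show "\<forall>J. u J - kdiff y L v' J \<in> I"
    proof
      fix J
      show "u J - kdiff y L v' J \<in> I"
      proof (cases "J \<subseteq> L \<and> Suc m \<le> card J")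
        case True
        then have "finite J" using l finite_subset by auto
        then have "kdiff y L v' J = kdiff y L v J"
          by (intro kdiff_cong_sub) (use True in \<open>auto simp: v'_def\<close>)
        then show ?thesis using v by simp
      next
        case False
        then have "u J = 0" using u by (auto simp: kchains_def)
        moreover have "v' (insert k J) = 0" if "k \<notin> J" for k
        proof (cases "insert k J \<subseteq> L")
          case True
          then have "finite J" using l finite_subset by auto
          then show ?thesis using False True that by (auto simp: v'_def)
        qed (use v in \<open>auto simp: v'_def kchains_def\<close>)
        ultimately show ?thesis by (simp add: kdiff_def)
      qed
    qed
  qed
  then obtain w0 where w0: "w0 \<in> kchains L (Suc (Suc m))" "\<And>J. u J - kdiff y L w0 J \<in> I" by blast
  define w where "w = kjoin l w0 (\<lambda>J. - w1 J)"
  have nw1: "(\<lambda>J. - w1 J) \<in> kchains L (Suc m)" using w1 by (auto simp: kchains_def)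
  have "w \<in> kchains (insert l L) (Suc (Suc m))"
    unfolding w_def using w0 nw1 l by (intro kjoin_kchains) auto
  moreover have "z J - kdiff y (insert l L) w J \<in> I" for J
  proof -
    have dw: "kdiff y (insert l L) w = kjoin l (\<lambda>J. kdiff y L w0 J + y l * (- w1 J)) (\<lambda>J. - kdiff y L (\<lambda>J. - w1 J) J)"
      unfolding w_def using nw1 l by (intro kdiff_kjoin) (auto simp: kchains_def)
    show ?thesis unfolding zab dw kjoin_diff
      by (intro kjoin_mem) (use w0(2) w1(2) in \<open>auto simp: u_def kdiff_minus algebra_simps\<close>)
  qed
  ultimately show "kboundary y (insert l L) (Suc m) z" unfolding kboundary_def by blast
qed

lemma koszul_vanishing_Un:
  assumes "koszul_vanishing y L m" "finite L" "finite M" "M \<inter> L = {}"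
  shows "koszul_vanishing y (M \<union> L) (card M + m)"
  using assms(3,4)
proof (induction M rule: finite_induct)
  case empty then show ?case using assms by simp
next
  case (insert l M)
  then show ?case using koszul_vanishing_insert[of y "M \<union> L" "card M + m" l] assms(2) by auto
qed

text \<open>The kernel of \<open>y l\<close> on the homology on \<open>L\<close> is the image of the
  homology on \<open>insert l L\<close> one degree higher. From \<open>y l * z = d u\<close> the
  pair \<open>(- u, z)\<close> is a cycle of the cone; the second component of a chain that it
  bounds shows that \<open>z\<close> is a boundary.\<close>

lemma kboundary_cancel:
  assumes V: "koszul_vanishing y (insert l L) (Suc m)" and l: "l \<notin> L" "finite L"
    and z: "z \<in> kchains L m" "kcycle y L z" and b: "kboundary y L m (\<lambda>J. y l * z J)"
  shows "kboundary y L m z"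
proof -
  obtain u where u: "u \<in> kchains L (Suc m)" "\<And>J. y l * z J - kdiff y L u J \<in> I"
    using b unfolding kboundary_def by blast
  define c where "c = kjoin l (\<lambda>J. - u J) z"
  have nu: "(\<lambda>J. - u J) \<in> kchains L (Suc m)" using u by (auto simp: kchains_def)
  have c: "c \<in> kchains (insert l L) (Suc m)" unfolding c_def using l nu z by (intro kjoin_kchains) auto
  have "kcycle y (insert l L) c"
    unfolding kcycle_def c_def
  proof
    fix J
    have "kdiff y (insert l L) (kjoin l (\<lambda>J. - u J) z) = kjoin l (\<lambda>J. kdiff y L (\<lambda>J. - u J) J + y l * z J) (\<lambda>J. - kdiff y L z J)"
      using l z kchains_mono[OF z(1), of 0] by (intro kdiff_kjoin) auto
    then show "kdiff y (insert l L) (kjoin l (\<lambda>J. - u J) z) J \<in> I"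
      using u z by (auto simp: kcycle_def kdiff_minus intro!: kjoin_mem minus_mem)
  qed
  then obtain w where w: "w \<in> kchains (insert l L) (Suc (Suc m))" "\<And>J. c J - kdiff y (insert l L) w J \<in> I"
    using V c unfolding koszul_vanishing_def kboundary_def by blast
  define w0 where "w0 = kpart0 l w"
  define w1 where "w1 = kpart1 l w"
  have ww: "w = kjoin l w0 w1" by (simp add: w0_def w1_def kjoin_parts)
  have w1: "w1 \<in> kchains L (Suc m)" using w l by (simp add: w1_def kpart1_kchains)
  have dw: "kdiff y (insert l L) w = kjoin l (\<lambda>J. kdiff y L w0 J + y l * w1 J) (\<lambda>J. - kdiff y L w1 J)"
    unfolding ww using l kchains_mono[OF w1, of 0] by (intro kdiff_kjoin) auto
  have "kjoin l (\<lambda>J. - u J - (kdiff y L w0 J + y l * w1 J)) (\<lambda>J. z J - - kdiff y L w1 J) J \<in> I" for J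
    using w(2)[of J] unfolding c_def dw kjoin_diff by simp
  note * = kjoin_memD(2)[OF this]
  have "z J - kdiff y L (\<lambda>J. - w1 J) J \<in> I" for J
  proof (cases "l \<in> J")
    case True
    then have "z J = 0" "w1 (insert k J) = 0" for k using z w1 l by (auto simp: kchains_def)
    then show ?thesis by (simp add: kdiff_def)
  next
    case False
    then show ?thesis using *[OF False] by (simp add: kdiff_minus)
  qed
  moreover have "(\<lambda>J. - w1 J) \<in> kchains L (Suc m)" using w1 by (auto simp: kchains_def)
  ultimately show ?thesis unfolding kboundary_def by blast
qed

text \<open>By \<open>kboundary_cancel\<close> multiplication by \<open>y l\<close> is injective on
  the homology on \<open>L\<close>, and by \<open>nil\<close> a power of it kills each class, so
  every class is zero. The level drops by one, reversing
  \<open>koszul_vanishing_insert\<close>.\<close>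

lemma koszul_vanishing_remove:
  assumes V: "koszul_vanishing y (insert l L) (Suc m)" and l: "l \<notin> L" "finite L"
    and nil: "\<And>z. z \<in> kchains L m \<Longrightarrow> kcycle y L z \<Longrightarrow> \<exists>t. kboundary y L m (\<lambda>J. y l ^ t * z J)"
  shows "koszul_vanishing y L m"
  unfolding koszul_vanishing_def
proof (intro ballI impI)
  fix z assume z: "z \<in> kchains L m" "kcycle y L z"
  obtain t where "kboundary y L m (\<lambda>J. y l ^ t * z J)" using nil[OF z] by blast
  then show "kboundary y L m z"
  proof (induction t)
    case (Suc t)
    have "kboundary y L m (\<lambda>J. y l * (y l ^ t * z J))" using Suc.prems by (simp add: mult_ac)
    moreover have "(\<lambda>J. y l ^ t * z J) \<in> kchains L m" by (intro kchains_mult z)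
    moreover have "kcycle y L (\<lambda>J. y l ^ t * z J)"
      using z by (auto simp: kcycle_def kdiff_mult intro: mult_mem)
    ultimately show ?case using kboundary_cancel[OF V l] Suc.IH by blast
  qed simp
qed

lemma kboundary_add:
  assumes "kboundary y L m a" "kboundary y L m b"
  shows "kboundary y L m (\<lambda>J. a J + b J)"
proof -
  obtain u where u: "u \<in> kchains L (Suc m)" "\<And>J. a J - kdiff y L u J \<in> I"
    using assms(1) unfolding kboundary_def by blast
  obtain v where v: "v \<in> kchains L (Suc m)" "\<And>J. b J - kdiff y L v J \<in> I"
    using assms(2) unfolding kboundary_def by blast
  have "(\<lambda>J. u J + v J) \<in> kchains L (Suc m)" by (intro kchains_add u v)
  moreover have "(a J + b J) - kdiff y L (\<lambda>J. u J + v J) J \<in> I" for J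
    using add_mem[OF u(2)[of J] v(2)[of J]] by (simp add: kdiff_add algebra_simps)
  ultimately show ?thesis unfolding kboundary_def by blast
qed

lemma kboundary_mult:
  assumes "kboundary y L m a"
  shows "kboundary y L m (\<lambda>J. r * a J)"
proof -
  obtain u where u: "u \<in> kchains L (Suc m)" "\<And>J. a J - kdiff y L u J \<in> I"
    using assms(1) unfolding kboundary_def by blast
  have "(\<lambda>J. r * u J) \<in> kchains L (Suc m)" by (intro kchains_mult u)
  moreover have "r * a J - kdiff y L (\<lambda>J. r * u J) J \<in> I" for J
    using mult_mem[OF u(2)[of J], of r] by (simp add: kdiff_mult algebra_simps)
  ultimately show ?thesis unfolding kboundary_def by blast
qed

lemma kboundary_mem:
  assumes "\<And>J. a J \<in> I"
  shows "kboundary y L m a"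
  unfolding kboundary_def by (rule bexI[of _ "\<lambda>J. 0"]) (use assms in \<open>auto simp: kchains_def\<close>)

lemma kboundary_cong:
  assumes "kboundary y L m a" "\<And>J. b J - a J \<in> I"
  shows "kboundary y L m b"
proof -
  have "kboundary y L m (\<lambda>J. a J + (b J - a J))"
    by (intro kboundary_add assms kboundary_mem)
  then show ?thesis by simp
qed

lemma kboundary_sum:
  "finite A \<Longrightarrow> (\<And>i. i \<in> A \<Longrightarrow> kboundary y L m (f i)) \<Longrightarrow> kboundary y L m (\<lambda>J. \<Sum>i\<in>A. f i J)"
  by (induction A rule: finite_induct) (auto intro: kboundary_mem kboundary_add)

text \<open>Exterior multiplication by \<open>e_l\<close> is a homotopy between multiplication by
  \<open>y l\<close> and zero. For \<open>z = a + e_l b\<close> the chain \<open>e_l a\<close>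
  already does: the error \<open>d a + y l * b\<close> lies in \<open>I\<close> because
  \<open>z\<close> is a cycle.\<close>

lemma kboundary_annihilate:
  assumes z: "z \<in> kchains L m" "kcycle y L z" and l: "l \<in> L" and fin: "finite L"
  shows "kboundary y L m (\<lambda>J. y l * z J)"
proof -
  define M where "M = L - {l}"
  have L: "L = insert l M" "l \<notin> M" "finite M" using l fin by (auto simp: M_def)
  define a where "a = kpart0 l z"
  define b where "b = kpart1 l z"
  have zab: "z = kjoin l a b" by (simp add: a_def b_def kjoin_parts)
  have a: "a \<in> kchains M m" using z L by (simp add: a_def kpart0_kchains)
  then have a0: "a \<in> kchains M 0" by (auto simp: kchains_def)
  have b0: "b \<in> kchains M 0"
  proof (rule kchainsI)
    fix J assume "b J \<noteq> 0"
    then have "l \<notin> J" "z (insert l J) \<noteq> 0" by (auto simp: b_def kpart1_def split: if_splits)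
    then show "J \<subseteq> M \<and> 0 \<le> card J" using z(1) L by (auto simp: kchains_def)
  qed
  note cd = kcycle_kjoinD[OF L(2,3) a0 b0 z(2)[unfolded zab L(1)]]
  define w where "w = kjoin l (\<lambda>J. 0) a"
  have "w \<in> kchains L (Suc m)" unfolding w_def L(1)
    by (intro kjoin_kchains) (use a L in \<open>auto simp: kchains_def\<close>)
  moreover have "y l * z J - kdiff y L w J \<in> I" for J
  proof -
    have "kdiff y L w = kjoin l (\<lambda>J. kdiff y M (\<lambda>J. 0) J + y l * a J) (\<lambda>J. - kdiff y M a J)"
      unfolding w_def L(1) using L a0 by (intro kdiff_kjoin) auto
    moreover have "y l * z J = kjoin l (\<lambda>J. y l * a J) (\<lambda>J. y l * b J) J"
      unfolding zab by (auto simp: kjoin_def mult_ac)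
    ultimately show ?thesis
      using cd(2) by (auto simp: kjoin_diff add.commute intro!: kjoin_mem)
  qed
  ultimately show ?thesis unfolding kboundary_def by blast
qed

text \<open>The cokernel of \<open>y l\<close> on the homology on \<open>L\<close> embeds into the
  homology on \<open>insert l L\<close> in the same degree. Once that vanishes, \<open>y l\<close>
  is onto on homology, which is the input of the Nakayama argument.\<close>

lemma kcycle_split:
  assumes V: "koszul_vanishing y (insert l L) m" and l: "l \<notin> L" "finite L"
    and z: "z \<in> kchains L m" "kcycle y L z"
  shows "\<exists>w0\<in>kchains L (Suc m). \<exists>w1\<in>kchains L m. kcycle y L w1 \<and> 
    (\<forall>J. z J - (kdiff y L w0 J + y l * w1 J) \<in> I)"
proof -
  have z': "z = kjoin l z (\<lambda>J. 0)" using z l by (auto simp: kjoin_def kchains_def fun_eq_iff)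
  have "z \<in> kchains (insert l L) m" using z by (auto simp: kchains_def)
  moreover have "kcycle y (insert l L) z"
    unfolding kcycle_def
  proof
    fix J
    have "kdiff y (insert l L) z = kjoin l (\<lambda>J. kdiff y L z J + y l * 0) (\<lambda>J. - kdiff y L (\<lambda>J. 0) J)"
      by (subst z', rule kdiff_kjoin) (use l in \<open>auto simp: kchains_def\<close>)
    then show "kdiff y (insert l L) z J \<in> I" using z by (auto simp: kcycle_def intro!: kjoin_mem)
  qed
  ultimately obtain w where w: "w \<in> kchains (insert l L) (Suc m)" "\<And>J. z J - kdiff y (insert l L) w J \<in> I"
    using V unfolding koszul_vanishing_def kboundary_def by blast
  define w0 where "w0 = kpart0 l w"
  define w1 where "w1 = kpart1 l w"
  have ww: "w = kjoin l w0 w1" by (simp add: w0_def w1_def kjoin_parts)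
  have w1: "w1 \<in> kchains L m" using w l by (simp add: w1_def kpart1_kchains)
  have w0: "w0 \<in> kchains L (Suc m)" using w l by (simp add: w0_def kpart0_kchains)
  have dw: "kdiff y (insert l L) w = kjoin l (\<lambda>J. kdiff y L w0 J + y l * w1 J) (\<lambda>J. - kdiff y L w1 J)"
    unfolding ww using l kchains_mono[OF w1, of 0] by (intro kdiff_kjoin) auto
  have "kjoin l (\<lambda>J. z J - (kdiff y L w0 J + y l * w1 J)) (\<lambda>J. 0 - - kdiff y L w1 J) J \<in> I" for J
  proof -
    have "kjoin l z (\<lambda>J. 0) J - kdiff y (insert l L) w J \<in> I"
      using w(2)[of J] by (simp only: fun_cong[OF z', symmetric])
    then show ?thesis by (simp only: dw kjoin_diff)
  qed
  note * = kjoin_memD[OF this]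
  have "kcycle y L w1" unfolding kcycle_def
  proof
    fix J
    show "kdiff y L w1 J \<in> I"
    proof (cases "l \<in> J")
      case True
      then have "w1 (insert k J) = 0" for k using w1 l by (auto simp: kchains_def)
      then show ?thesis by (simp add: kdiff_def)
    qed (use *(2) in simp)
  qed
  moreover have "z J - (kdiff y L w0 J + y l * w1 J) \<in> I" for J
  proof (cases "l \<in> J")
    case True
    then have "z J = 0" "w1 J = 0" "w0 (insert k J) = 0" for k using z w0 w1 l by (auto simp: kchains_def)
    then show ?thesis by (simp add: kdiff_def)
  qed (use *(1) in simp)
  ultimately show ?thesis using w0 w1 by blast
qed

text \<open>A relation \<open>y l * a = (\<Sum>j\<in>L. y j * b j)\<close> is a Koszul 1-cycle with
  coefficient \<open>- a\<close> at \<open>{l}\<close> and \<open>b j\<close> at \<open>{j}\<close>.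
  It is a boundary, and the coefficient of a boundary at \<open>{l}\<close> is a combination of the
  other \<open>y j\<close>.\<close>

lemma koszul_vanishing_regular:
  assumes V: "koszul_vanishing y (insert l L) 1" and l: "l \<notin> L" "finite L"
    and a: "y l * a - (\<Sum>j\<in>L. y j * b j) \<in> I"
  shows "\<exists>g. a - (\<Sum>j\<in>L. y j * g j) \<in> I"
proof -
  define z where "z J = (if J = {l} then - a else \<Sum>j\<in>L. if J = {j} then b j else 0)" for J
  have zj: "z {j} = b j" if "j \<in> L" for j
    using that l by (auto simp: z_def sum.delta)
  have z0: "z J = 0" if "card J \<noteq> 1" for J
  proof -
    have "J \<noteq> {j}" for j using that by auto
    then show ?thesis by (simp add: z_def)
  qed
  have "z \<in> kchains (insert l L) 1"
  proof (rule kchainsI)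
    fix J assume J: "z J \<noteq> 0"
    then have "card J = 1" using z0 by blast
    moreover have "J \<subseteq> insert l L"
    proof (rule ccontr)
      assume "\<not> J \<subseteq> insert l L"
      then have "J \<noteq> {l}" "\<forall>j\<in>L. J \<noteq> {j}" by auto
      then have "z J = 0" unfolding z_def by (simp add: sum.neutral)
      then show False using J by simp
    qed
    ultimately show "J \<subseteq> insert l L \<and> 1 \<le> card J" by simp
  qed
  moreover have "kcycle y (insert l L) z"
    unfolding kcycle_def
  proof
    fix J
    show "kdiff y (insert l L) z J \<in> I"
    proof (cases "J = {}")
      case True
      have "kdiff y (insert l L) z J = - (y l * a) + (\<Sum>j\<in>L. y j * b j)"
        using l True zj by (simp add: kdiff_def) (simp add: z_def)
      then show ?thesis using diff_mem_sym[OF a] by simp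
    next
      case False
      have "z (insert w J) = 0" if "w \<notin> J" for w
      proof (rule z0, rule notI)
        assume "card (insert w J) = 1"
        then obtain x where "insert w J = {x}" by (rule card_1_singletonE)
        then show False using that False by auto
      qed
      then show ?thesis by (simp add: kdiff_def)
    qed
  qed
  ultimately obtain w where w: "\<And>J. z J - kdiff y (insert l L) w J \<in> I"
    using V unfolding koszul_vanishing_def kboundary_def by blast
  have "insert l L - {l} = L" using l by auto
  then have "a - (\<Sum>j\<in>L. y j * (- ksign j {l} * w {j, l})) = - (z {l} - kdiff y (insert l L) w {l})"
    by (simp add: z_def kdiff_def sum_negf mult_ac)
  then have "a - (\<Sum>j\<in>L. y j * (- ksign j {l} * w {j, l})) \<in> I" using minus_mem[OF w[of "{l}"]] by simp
  then show ?thesis by (rule exI[of _ "\<lambda>j. - ksign j {l} * w {j, l}"])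
qed

end

section \<open>Monomials and Stanley--Reisner ideals\<close>

definition mdeg :: "('v::finite \<Rightarrow>\<^sub>0 nat) \<Rightarrow> nat" where
  "mdeg m = (\<Sum>v\<in>UNIV. Poly_Mapping.lookup m v)"

text \<open>Exponent vector of the squarefree monomial on \<open>F\<close>, which is also the
  multidegree of the Koszul basis element \<open>e_F\<close>.\<close>

definition mind :: "'v::finite set \<Rightarrow> 'v \<Rightarrow>\<^sub>0 nat" where
  "mind F = (\<Sum>v\<in>F. Poly_Mapping.single v 1)"

lemma mdeg_add: "mdeg (a + b) = mdeg a + mdeg b"
  by (simp add: mdeg_def lookup_add sum.distrib)

lemma mdeg_zero [simp]: "mdeg 0 = 0"
  by (simp add: mdeg_def)

lemma lookup_mind: "Poly_Mapping.lookup (mind F) v = (if v \<in> F then 1 else 0)"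
  by (simp add: mind_def lookup_sum lookup_single when_def sum.delta)

lemma mdeg_mind [simp]: "mdeg (mind F) = card F"
  by (simp add: mdeg_def lookup_mind sum.If_cases)

lemma keys_mind [simp]: "Poly_Mapping.keys (mind F) = F"
  by (auto simp: in_keys_iff lookup_mind split: if_splits)

lemma mind_empty [simp]: "mind {} = 0"
  by (simp add: mind_def)

lemma mind_insert: "v \<notin> F \<Longrightarrow> mind (insert v F) = Poly_Mapping.single v 1 + mind F"
  by (simp add: mind_def)

lemma keys_plus_nat: "Poly_Mapping.keys (a + b) = Poly_Mapping.keys a \<union> Poly_Mapping.keys b"
  for a b :: "'v \<Rightarrow>\<^sub>0 nat"
  by (auto simp: in_keys_iff lookup_add)

lemma diff_mind_add:
  assumes "F \<subseteq> Poly_Mapping.keys a"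
  shows "a - mind F + mind F = a"
proof (rule poly_mapping_eqI)
  fix v
  show "Poly_Mapping.lookup (a - mind F + mind F) v = Poly_Mapping.lookup a v"
    using assms by (auto simp: lookup_add lookup_minus lookup_mind in_keys_iff Suc_leI subset_iff)
qed

lemma mind_keys_decomp: "F = Poly_Mapping.keys m \<Longrightarrow> \<exists>r. m = r + mind F"
  by (metis diff_mind_add order_refl)

lemma squarefree_mind:
  assumes "\<And>v. Poly_Mapping.lookup a v \<le> 1"
  shows "a = mind (Poly_Mapping.keys a)"
proof (rule poly_mapping_eqI)
  fix v
  show "Poly_Mapping.lookup a v = Poly_Mapping.lookup (mind (Poly_Mapping.keys a)) v"
    using assms[of v] by (auto simp: lookup_mind in_keys_iff)
qed

lemma keys_mind_diff [simp]: "Poly_Mapping.keys (mind W - mind F) = W - F"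
  by (auto simp: in_keys_iff lookup_minus lookup_mind split: if_splits)

lemma lookup_single_times:
  fixes p :: "('v \<Rightarrow>\<^sub>0 nat) \<Rightarrow>\<^sub>0 'k::comm_ring_1"
  shows "Poly_Mapping.lookup (Poly_Mapping.single a c * p) (a + m) = c * Poly_Mapping.lookup p m"
proof -
  have "Poly_Mapping.lookup (Poly_Mapping.single a c * p) (a + m) =
     (\<Sum>l. (c when a = l) * (\<Sum>q. Poly_Mapping.lookup p q when a + m = l + q))"
    by (simp add: lookup_mult prod_fun_def lookup_single)
  also have "\<dots> = (\<Sum>l. c * (\<Sum>q. Poly_Mapping.lookup p q when a + m = l + q) when a = l)"
    by (simp add: when_mult)
  also have "\<dots> = c * (\<Sum>q. Poly_Mapping.lookup p q when m = q)"
    by simp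
  also have "\<dots> = c * Poly_Mapping.lookup p m" by simp
  finally show ?thesis .
qed

lemma lookup_single_times_0:
  fixes p :: "('v \<Rightarrow>\<^sub>0 nat) \<Rightarrow>\<^sub>0 'k::comm_ring_1"
  assumes "\<And>m'. m \<noteq> a + m'"
  shows "Poly_Mapping.lookup (Poly_Mapping.single a c * p) m = 0"
proof (rule ccontr)
  assume "Poly_Mapping.lookup (Poly_Mapping.single a c * p) m \<noteq> 0"
  then have "m \<in> Poly_Mapping.keys (Poly_Mapping.single a c * p)" by (simp add: in_keys_iff)
  then obtain b where "m = a + b" using keys_mult[of "Poly_Mapping.single a c" p]
    by (auto split: if_splits)
  then show False using assms by blast
qed

lemma lookup_pvar_times:
  "Poly_Mapping.lookup (pvar v * p) m =
    (if v \<in> Poly_Mapping.keys m then Poly_Mapping.lookup p (m - Poly_Mapping.single v 1) else 0)"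
  for p :: "('v::finite, 'k::field) mpoly"
proof (cases "v \<in> Poly_Mapping.keys m")
  case True
  have "m = Poly_Mapping.single v 1 + (m - Poly_Mapping.single v 1)"
    using diff_mind_add[of "{v}" m] True by (simp add: mind_def add.commute)
  then show ?thesis using True lookup_single_times[of "Poly_Mapping.single v 1" 1 p "m - Poly_Mapping.single v 1"]
    by (simp add: pvar_def)
next
  case False
  then have "m \<noteq> Poly_Mapping.single v 1 + m'" for m'
    by (auto simp: in_keys_iff lookup_add)
  then show ?thesis using False by (simp add: pvar_def lookup_single_times_0)
qed

lemma lookup_ksign_times: "Poly_Mapping.lookup (ksign v F * p) m = ksign v F * Poly_Mapping.lookup p m"
  for p :: "('v, 'k::field) mpoly"
  by (cases "even (card {w \<in> F. w < v})") (simp_all add: ksign_def)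

lemma prod_pvar: "(\<Prod>v\<in>F. pvar v) = (Poly_Mapping.single (mind F) 1 :: ('v::finite, 'k::field) mpoly)"
proof (induction F rule: infinite_finite_induct)
  case (insert v F)
  then show ?case by (simp add: pvar_def mult_single mind_insert)
qed (simp_all add: mind_def)

lemma mpoly_sum_single: "p = (\<Sum>m\<in>Poly_Mapping.keys p. Poly_Mapping.single m (Poly_Mapping.lookup p m))"
proof (rule poly_mapping_eqI)
  fix m
  show "Poly_Mapping.lookup p m =
    Poly_Mapping.lookup (\<Sum>m\<in>Poly_Mapping.keys p. Poly_Mapping.single m (Poly_Mapping.lookup p m)) m"
    by (simp add: lookup_sum lookup_single when_def sum.delta in_keys_iff)
qed

text \<open>Subset closure alone, so that \<open>Pow G\<close> is covered too; its face ideal is the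
  prime generated by the variables outside \<open>G\<close>.\<close>

definition down_closed :: "'v set set \<Rightarrow> bool" where
  "down_closed \<Delta> \<longleftrightarrow> (\<forall>F\<in>\<Delta>. \<forall>G\<subseteq>F. G \<in> \<Delta>)"

text \<open>Describes the Stanley-Reisner ideal by supports of monomials, which makes membership a
  condition on single coefficients. For \<open>UNIV\<close> it is the zero ideal, so the same lemmas
  also serve the Koszul complex of the polynomial ring itself.\<close>

definition face_ideal :: "'v set set \<Rightarrow> ('v, 'k::field) mpoly set" where
  "face_ideal \<Delta> = {p. \<forall>m\<in>Poly_Mapping.keys p. Poly_Mapping.keys m \<notin> \<Delta>}"

lemma face_idealI: "(\<And>m. Poly_Mapping.keys m \<in> \<Delta> \<Longrightarrow> Poly_Mapping.lookup p m = 0) \<Longrightarrow> p \<in> face_ideal \<Delta>"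
  by (auto simp: face_ideal_def in_keys_iff)

lemma face_idealD: "p \<in> face_ideal \<Delta> \<Longrightarrow> Poly_Mapping.keys m \<in> \<Delta> \<Longrightarrow> Poly_Mapping.lookup p m = 0"
  by (auto simp: face_ideal_def in_keys_iff)

lemma face_ideal_UNIV [simp]: "face_ideal UNIV = {0}"
proof
  show "face_ideal UNIV \<subseteq> {0 :: ('v, 'k::field) mpoly}"
  proof
    fix p :: "('v, 'k) mpoly" assume "p \<in> face_ideal UNIV"
    then have "Poly_Mapping.lookup p m = 0" for m by (simp add: face_idealD)
    then show "p \<in> {0}" by (simp add: poly_mapping_eqI)
  qed
qed (auto intro: face_idealI)

lemma cring_ideal_face_ideal:
  assumes "down_closed \<Delta>"
  shows "cring_ideal (face_ideal \<Delta> :: ('v, 'k::field) mpoly set)"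
proof
  show "(0 :: ('v, 'k) mpoly) \<in> face_ideal \<Delta>" by (simp add: face_ideal_def)
next
  fix a b :: "('v, 'k) mpoly" assume "a \<in> face_ideal \<Delta>" "b \<in> face_ideal \<Delta>"
  then show "a + b \<in> face_ideal \<Delta>" by (intro face_idealI) (simp add: lookup_add face_idealD)
next
  fix r a :: "('v, 'k) mpoly" assume a: "a \<in> face_ideal \<Delta>"
  show "r * a \<in> face_ideal \<Delta>" unfolding face_ideal_def
  proof (clarify)
    fix m assume m: "m \<in> Poly_Mapping.keys (r * a)" "Poly_Mapping.keys m \<in> \<Delta>"
    then obtain b c where bc: "m = b + c" "c \<in> Poly_Mapping.keys a"
      using keys_mult[of r a] by blast
    have "Poly_Mapping.keys c \<subseteq> Poly_Mapping.keys m" by (simp add: bc keys_plus_nat)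
    then have "Poly_Mapping.keys c \<in> \<Delta>" using assms m(2) unfolding down_closed_def by blast
    then show False using a bc(2) by (simp add: face_ideal_def)
  qed
qed

text \<open>Both inclusions are monomial: generators have nonface support, and a monomial whose
  support \<open>F\<close> is a nonface is a multiple of the generator belonging to
  \<open>F\<close>.\<close>

lemma stanley_reisner_ideal_eq:
  assumes "down_closed \<Delta>"
  shows "stanley_reisner_ideal TYPE('k::field) (\<Delta> :: 'v::finite set set) = face_ideal \<Delta>"
proof -
  let ?R = "poly_ring :: ('v, 'k) mpoly ring"
  interpret R: cring ?R by (rule cring_from_type_algebra)
  interpret I: cring_ideal "face_ideal \<Delta> :: ('v, 'k) mpoly set" by (rule cring_ideal_face_ideal[OF assms])
  have simps: "carrier ?R = UNIV" "\<And>a b. a \<oplus>\<^bsub>?R\<^esub> b = a + b" "\<And>a b. a \<otimes>\<^bsub>?R\<^esub> b = a * b" "\<zero>\<^bsub>?R\<^esub> = 0"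
    by (simp_all add: ring_of_type_algebra_def)
  have inv: "\<ominus>\<^bsub>?R\<^esub> a = - a" for a
    using R.minus_equality[of "- a" a] by (simp add: simps)
  have id: "ideal (face_ideal \<Delta>) ?R"
  proof (rule idealI)
    show "ring ?R" by (rule R.ring_axioms)
    show "subgroup (face_ideal \<Delta>) (add_monoid ?R)"
      by (rule R.add.subgroupI) (auto simp: simps inv intro: I.add_mem I.minus_mem)
  qed (auto simp: simps intro: I.mult_mem I.mult_mem_right)
  let ?G = "{\<Prod>v\<in>F. pvar v | F. F \<notin> \<Delta>} :: ('v, 'k) mpoly set"
  have "?G \<subseteq> face_ideal \<Delta>" by (auto simp: prod_pvar face_ideal_def)
  then have 1: "genideal ?R ?G \<subseteq> face_ideal \<Delta>" by (rule R.genideal_minimal[OF id])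
  have gid: "ideal (genideal ?R ?G) ?R" by (rule R.genideal_ideal) (simp add: simps)
  interpret J: ideal "genideal ?R ?G" ?R by (rule gid)
  have sum: "finite A \<Longrightarrow> (\<And>i. i \<in> A \<Longrightarrow> f i \<in> genideal ?R ?G) \<Longrightarrow> sum f A \<in> genideal ?R ?G" for A and f :: "('v \<Rightarrow>\<^sub>0 nat) \<Rightarrow> _"
    by (induction A rule: finite_induct) (use J.a_closed J.zero_closed in \<open>auto simp: simps\<close>)
  have "p \<in> genideal ?R ?G" if p: "p \<in> face_ideal \<Delta>" for p
  proof -
    have "(\<Sum>m\<in>Poly_Mapping.keys p. Poly_Mapping.single m (Poly_Mapping.lookup p m)) \<in> genideal ?R ?G"
    proof (rule sum)
      fix m assume m: "m \<in> Poly_Mapping.keys p"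
      define F where "F = Poly_Mapping.keys m"
      have "F \<notin> \<Delta>" using p m by (auto simp: F_def face_ideal_def)
      obtain r where r: "m = r + mind F" using mind_keys_decomp[OF F_def] by blast
      have "Poly_Mapping.single m (Poly_Mapping.lookup p m) =
        Poly_Mapping.single r (Poly_Mapping.lookup p m) * (\<Prod>v\<in>F. pvar v)"
        by (simp add: prod_pvar mult_single r)
      moreover have "(\<Prod>v\<in>F. pvar v) \<in> genideal ?R ?G"
        using R.genideal_self[of ?G] \<open>F \<notin> \<Delta>\<close> by (auto simp: simps)
      ultimately show "Poly_Mapping.single m (Poly_Mapping.lookup p m) \<in> genideal ?R ?G"
        using J.I_l_closed by (auto simp: simps)
    qed simp
    then show ?thesis by (simp only: mpoly_sum_single[symmetric])
  qed
  then show ?thesis using 1 unfolding stanley_reisner_ideal_def by blast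
qed

lemma homogeneous_iff: "homogeneous t p \<longleftrightarrow> (\<forall>m\<in>Poly_Mapping.keys p. int (mdeg m) = t)"
  by (simp add: homogeneous_def mdeg_def)

section \<open>Multigraded pieces of the Koszul complex of the variables\<close>

text \<open>The component of multidegree \<open>a\<close> of a Koszul chain on the variables: as
  \<open>e_F\<close> has multidegree \<open>mind F\<close>, its coefficient contributes the monomial
  \<open>a - mind F\<close>. Subtraction of exponents is truncated, so sets outside the support of
  \<open>a\<close> are excluded explicitly.\<close>

definition mcomp :: "('v \<Rightarrow>\<^sub>0 nat) \<Rightarrow> ('v::{finite,linorder} set \<Rightarrow> ('v, 'k::field) mpoly) \<Rightarrow> 'v set \<Rightarrow> 'k" where
  "mcomp a z F = (if F \<subseteq> Poly_Mapping.keys a then Poly_Mapping.lookup (z F) (a - mind F) else 0)"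

abbreviation kd :: "('v::{finite,linorder} set \<Rightarrow> ('v, 'k::field) mpoly) \<Rightarrow> 'v set \<Rightarrow> ('v, 'k) mpoly" where
  "kd \<equiv> kdiff pvar UNIV"

lemma vsign_eq_ksign: "vsign v F = ksign v F"
  by (simp add: vsign_def ksign_def)

lemma simplicial_boundary_eq: "simplicial_boundary z G = kdiff (\<lambda>_. 1) UNIV z G"
  by (simp add: simplicial_boundary_def kdiff_def vsign_eq_ksign)

text \<open>Inside one multidegree, multiplication by a variable merely hands a coefficient on, so
  the Koszul differential becomes the simplicial boundary. Hochster's formula enters in this
  form.\<close>

lemma mcomp_kd: "mcomp a (kd z) F = simplicial_boundary (mcomp a z) F"
proof (cases "F \<subseteq> Poly_Mapping.keys a")
  case True
  have "mcomp a (kd z) F = (\<Sum>v\<in>UNIV - F. ksign v F * Poly_Mapping.lookup (pvar v * z (insert v F)) (a - mind F))"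
    using True unfolding mcomp_def kdiff_def lookup_sum mult.assoc lookup_ksign_times by simp
  also have "\<dots> = (\<Sum>v\<in>UNIV - F. vsign v F * mcomp a z (insert v F))"
  proof (rule sum.cong)
    fix v assume v: "v \<in> UNIV - F"
    have "v \<in> Poly_Mapping.keys (a - mind F) \<longleftrightarrow> v \<in> Poly_Mapping.keys a"
      using v by (simp add: in_keys_iff lookup_minus lookup_mind)
    moreover have "a - mind F - Poly_Mapping.single v 1 = a - mind (insert v F)"
      using v by (intro poly_mapping_eqI) (simp add: lookup_minus mind_insert lookup_add)
    ultimately show "ksign v F * Poly_Mapping.lookup (pvar v * z (insert v F)) (a - mind F) = vsign v F * mcomp a z (insert v F)"
      using True by (simp add: lookup_pvar_times mcomp_def vsign_eq_ksign)
  qed simp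
  finally show ?thesis by (simp add: simplicial_boundary_def)
next
  case False
  then have "mcomp a z (insert v F) = 0" for v by (auto simp: mcomp_def)
  then show ?thesis using False by (simp add: simplicial_boundary_def mcomp_def)
qed

lemma lookup_eq_mcomp:
  fixes z :: "'v::{finite,linorder} set \<Rightarrow> ('v, 'k::field) mpoly"
  shows "Poly_Mapping.lookup (z F) m = mcomp (m + mind F) z F"
proof -
  have "m + mind F - mind F = m" by simp
  then show ?thesis by (simp add: mcomp_def keys_plus_nat)
qed

lemma mem_face_ideal_iff_mcomp:
  fixes z :: "'v::{finite,linorder} set \<Rightarrow> ('v, 'k::field) mpoly"
  shows "z F \<in> face_ideal \<Delta> \<longleftrightarrow> (\<forall>a. F \<subseteq> Poly_Mapping.keys a \<longrightarrow> Poly_Mapping.keys (a - mind F) \<in> \<Delta> \<longrightarrow> mcomp a z F = 0)"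
proof
  assume "z F \<in> face_ideal \<Delta>"
  then show "\<forall>a. F \<subseteq> Poly_Mapping.keys a \<longrightarrow> Poly_Mapping.keys (a - mind F) \<in> \<Delta> \<longrightarrow> mcomp a z F = 0"
    by (auto simp: mcomp_def dest: face_idealD)
next
  assume *: "\<forall>a. F \<subseteq> Poly_Mapping.keys a \<longrightarrow> Poly_Mapping.keys (a - mind F) \<in> \<Delta> \<longrightarrow> mcomp a z F = 0"
  show "z F \<in> face_ideal \<Delta>"
  proof (rule face_idealI)
    fix m :: "'v \<Rightarrow>\<^sub>0 nat" assume "Poly_Mapping.keys m \<in> \<Delta>"
    then show "Poly_Mapping.lookup (z F) m = 0" 
      using *[rule_format, of "m + mind F"] lookup_eq_mcomp[of z F m] by (simp add: keys_plus_nat)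
  qed
qed

lemma mcomp_assemble:
  fixes \<eta> :: "('v::{finite,linorder} \<Rightarrow>\<^sub>0 nat) \<Rightarrow> 'v set \<Rightarrow> 'k::field"
  assumes fin: "finite A" and A: "\<And>a F. \<eta> a F \<noteq> 0 \<Longrightarrow> a \<in> A \<and> F \<subseteq> Poly_Mapping.keys a"
  shows "\<exists>w. \<forall>a F. mcomp a w F = \<eta> a F"
proof -
  define w where "w F = Abs_poly_mapping (\<lambda>m. \<eta> (m + mind F) F)" for F
  have "finite {m. \<eta> (m + mind F) F \<noteq> 0}" for F
  proof (rule finite_subset[OF _ finite_vimageI[OF fin]])
    show "{m. \<eta> (m + mind F) F \<noteq> 0} \<subseteq> (\<lambda>m. m + mind F) -` A" using A by auto
    show "inj (\<lambda>m. m + mind F)" by (simp add: inj_on_def)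
  qed
  then have lw: "Poly_Mapping.lookup (w F) m = \<eta> (m + mind F) F" for F m
    unfolding w_def by simp
  have "mcomp a w F = \<eta> a F" for a F
    using A[of a F] by (auto simp: mcomp_def lw diff_mind_add)
  then show ?thesis by blast
qed

lemma mcomp_diff: "mcomp a (\<lambda>F. z F - z' F) F = mcomp a z F - mcomp a z' F"
  by (simp add: mcomp_def lookup_minus)

text \<open>Exactness in homological degree \<open>i\<close> of the strand of multidegree
  \<open>a\<close> of the Koszul complex of the Stanley-Reisner ring. A set \<open>F\<close> counts
  only if \<open>a - mind F\<close> is supported on a face; elsewhere the coefficient represents
  zero and is left arbitrary.\<close>

definition multidegree_exact :: "'k::field itself \<Rightarrow> 'v::{finite,linorder} set set \<Rightarrow> ('v \<Rightarrow>\<^sub>0 nat) \<Rightarrow> nat \<Rightarrow> bool" where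
  "multidegree_exact _ \<Delta> a i \<longleftrightarrow> (\<forall>\<zeta> :: 'v set \<Rightarrow> 'k.
     (\<forall>F. \<zeta> F \<noteq> 0 \<longrightarrow> F \<subseteq> Poly_Mapping.keys a \<and> card F = i) \<longrightarrow>
     (\<forall>F\<subseteq>Poly_Mapping.keys a. Poly_Mapping.keys (a - mind F) \<in> \<Delta> \<longrightarrow> simplicial_boundary \<zeta> F = 0) \<longrightarrow>
     (\<exists>\<eta>. (\<forall>F. \<eta> F \<noteq> 0 \<longrightarrow> F \<subseteq> Poly_Mapping.keys a \<and> card F = Suc i) \<and>
       (\<forall>F\<subseteq>Poly_Mapping.keys a. Poly_Mapping.keys (a - mind F) \<in> \<Delta> \<longrightarrow> \<zeta> F = simplicial_boundary \<eta> F)))"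

text \<open>\<open>A\<close> is a set of multidegrees: one total degree for Betti numbers, all of
  them for the depth.\<close>

definition kpiece :: "('v::{finite,linorder} \<Rightarrow>\<^sub>0 nat) set \<Rightarrow> nat \<Rightarrow> ('v set \<Rightarrow> ('v, 'k::field) mpoly) set" where
  "kpiece A i = {z. \<forall>F. \<forall>m\<in>Poly_Mapping.keys (z F). card F = i \<and> m + mind F \<in> A}"

lemma mcomp_kpiece:
  assumes "z \<in> kpiece A i" "mcomp a z F \<noteq> 0"
  shows "F \<subseteq> Poly_Mapping.keys a" "card F = i" "a \<in> A"
proof -
  show F: "F \<subseteq> Poly_Mapping.keys a" using assms(2) by (auto simp: mcomp_def split: if_splits)
  have "a - mind F \<in> Poly_Mapping.keys (z F)" using assms(2) F by (simp add: mcomp_def in_keys_iff)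
  then have "card F = i \<and> a - mind F + mind F \<in> A" using assms(1) unfolding kpiece_def by blast
  then show "card F = i" "a \<in> A" by (simp_all add: diff_mind_add[OF F])
qed

lemma kpiece_mcompI:
  assumes "\<And>a F. mcomp a z F \<noteq> 0 \<Longrightarrow> card F = i \<and> a \<in> A"
  shows "z \<in> kpiece A i"
  unfolding kpiece_def
proof (intro CollectI allI ballI)
  fix F m assume "m \<in> Poly_Mapping.keys (z F)"
  then have "mcomp (m + mind F) z F \<noteq> 0" by (simp add: in_keys_iff lookup_eq_mcomp)
  then show "card F = i \<and> m + mind F \<in> A" by (rule assms)
qed

text \<open>The equation is solved in each multidegree separately. Only the finitely many
  multidegrees in \<open>A0\<close> occur in \<open>z\<close>; elsewhere the solution is chosen to
  be zero, so that the pieces assemble to polynomials.\<close>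

lemma koszul_exact:
  fixes z :: "'v::{finite,linorder} set \<Rightarrow> ('v, 'k::field) mpoly"
  assumes E: "\<And>a. a \<in> A \<Longrightarrow> multidegree_exact TYPE('k) \<Delta> a i"
    and z: "z \<in> kpiece A i" and cyc: "\<And>F. kd z F \<in> face_ideal \<Delta>"
  shows "\<exists>w\<in>kpiece A (Suc i). \<forall>F. z F - kd w F \<in> face_ideal \<Delta>"
proof -
  define A0 where "A0 = (\<Union>F. (\<lambda>m. m + mind F) ` Poly_Mapping.keys (z F))"
  have finA0: "finite A0" by (simp add: A0_def)
  have A0: "a \<in> A0" if "mcomp a z F \<noteq> 0" for a F
  proof -
    have F: "F \<subseteq> Poly_Mapping.keys a" using that by (auto simp: mcomp_def split: if_splits)
    then have "a - mind F \<in> Poly_Mapping.keys (z F)" using that by (simp add: mcomp_def in_keys_iff)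
    then have "a - mind F + mind F \<in> A0" unfolding A0_def by blast
    then show ?thesis by (simp add: diff_mind_add[OF F])
  qed
  have "\<exists>\<eta>. (\<forall>F. \<eta> F \<noteq> 0 \<longrightarrow> F \<subseteq> Poly_Mapping.keys a \<and> card F = Suc i \<and> a \<in> A0 \<inter> A) \<and>
       (\<forall>F\<subseteq>Poly_Mapping.keys a. Poly_Mapping.keys (a - mind F) \<in> \<Delta> \<longrightarrow> mcomp a z F = simplicial_boundary \<eta> F)" for a
  proof (cases "a \<in> A0 \<inter> A")
    case True
    have "\<exists>\<eta>. (\<forall>F. \<eta> F \<noteq> 0 \<longrightarrow> F \<subseteq> Poly_Mapping.keys a \<and> card F = Suc i) \<and>
       (\<forall>F\<subseteq>Poly_Mapping.keys a. Poly_Mapping.keys (a - mind F) \<in> \<Delta> \<longrightarrow> mcomp a z F = simplicial_boundary \<eta> F)"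
    proof -
      have "\<forall>F. mcomp a z F \<noteq> 0 \<longrightarrow> F \<subseteq> Poly_Mapping.keys a \<and> card F = i"
        by (intro allI impI conjI) (rule mcomp_kpiece[OF z], assumption)+
      moreover have "\<forall>F\<subseteq>Poly_Mapping.keys a. Poly_Mapping.keys (a - mind F) \<in> \<Delta> \<longrightarrow> simplicial_boundary (mcomp a z) F = 0"
      proof (intro allI impI)
        fix F assume "F \<subseteq> Poly_Mapping.keys a" "Poly_Mapping.keys (a - mind F) \<in> \<Delta>"
        then have "mcomp a (kd z) F = 0" using cyc[of F] mem_face_ideal_iff_mcomp[of "kd z" F \<Delta>] by simp
        then show "simplicial_boundary (mcomp a z) F = 0" by (simp add: mcomp_kd)
      qed
      ultimately show ?thesis
        using E[of a, unfolded multidegree_exact_def, THEN spec, of "mcomp a z"] True by simp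
    qed
    then show ?thesis using True by blast
  next
    case False
    then have "mcomp a z F = 0" for F using A0 mcomp_kpiece(3)[OF z] by blast
    then show ?thesis by (intro exI[of _ "\<lambda>_. 0"]) (simp add: simplicial_boundary_def)
  qed
  then obtain \<eta> where \<eta>: "\<And>a F. \<eta> a F \<noteq> 0 \<Longrightarrow> F \<subseteq> Poly_Mapping.keys a \<and> card F = Suc i \<and> a \<in> A0 \<inter> A"
    "\<And>a F. F \<subseteq> Poly_Mapping.keys a \<Longrightarrow> Poly_Mapping.keys (a - mind F) \<in> \<Delta> \<Longrightarrow> mcomp a z F = simplicial_boundary (\<eta> a) F"
    by metis
  obtain w where w: "\<And>a F. mcomp a w F = \<eta> a F"
    using mcomp_assemble[of A0 \<eta>] finA0 \<eta>(1) by blast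
  then have mw: "mcomp a w = \<eta> a" for a by auto
  have "w \<in> kpiece A (Suc i)" by (rule kpiece_mcompI) (use \<eta>(1) w in auto)
  moreover have "z F - kd w F \<in> face_ideal \<Delta>" for F
    using mem_face_ideal_iff_mcomp[of "\<lambda>F. z F - kd w F" F \<Delta>] \<eta>(2) by (simp add: mcomp_diff mcomp_kd mw)
  ultimately show ?thesis by blast
qed

lemma kpiece_boundary_mcomp:
  assumes "\<And>F. z F - kd w F \<in> face_ideal \<Delta>" "F \<subseteq> Poly_Mapping.keys a" "Poly_Mapping.keys (a - mind F) \<in> \<Delta>"
  shows "mcomp a z F = simplicial_boundary (mcomp a w) F"
  using assms(1)[of F] assms(2,3) mem_face_ideal_iff_mcomp[of "\<lambda>F. z F - kd w F" F \<Delta>]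
  by (simp add: mcomp_diff mcomp_kd)

section \<open>Multidegrees without homology, by coning\<close>

definition contraction :: "'v::{finite,linorder} \<Rightarrow> ('v set \<Rightarrow> 'k::field) \<Rightarrow> 'v set \<Rightarrow> 'k" where
  "contraction v \<zeta> F = (if v \<in> F then ksign v (F - {v}) * \<zeta> (F - {v}) else 0)"

lemma contraction_homotopy:
  fixes \<zeta> :: "'v::{finite,linorder} set \<Rightarrow> 'k::field"
  shows "simplicial_boundary (contraction v \<zeta>) F + contraction v (simplicial_boundary \<zeta>) F = \<zeta> F"
proof (cases "v \<in> F")
  case False
  then have "simplicial_boundary (contraction v \<zeta>) F = (\<Sum>u\<in>UNIV - F. if u = v then \<zeta> F else 0)"
    unfolding simplicial_boundary_def by (intro sum.cong) (auto simp: contraction_def vsign_eq_ksign)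
  then show ?thesis using False by (simp add: contraction_def)
next
  case True
  define G where "G = F - {v}"
  have F: "F = insert v G" "v \<notin> G" using True by (auto simp: G_def)
  have "UNIV - G = insert v (UNIV - F)" using F by auto
  then have "contraction v (simplicial_boundary \<zeta>) F = \<zeta> F + (\<Sum>u\<in>UNIV - F. ksign v G * (ksign u G * \<zeta> (insert u G)))"
    using F True by (simp add: contraction_def simplicial_boundary_def vsign_eq_ksign sum_distrib_left distrib_left)
  moreover have "simplicial_boundary (contraction v \<zeta>) F = (\<Sum>u\<in>UNIV - F. - (ksign v G * (ksign u G * \<zeta> (insert u G))))"
    unfolding simplicial_boundary_def
  proof (rule sum.cong)
    fix u assume u: "u \<in> UNIV - F"
    then have "insert u F - {v} = insert u G" using F by auto
    moreover have "ksign u F * ksign v (insert u G) = (- (ksign v G * ksign u G) :: 'k)"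
      using ksign_swap[of G u v] u F by auto
    ultimately show "vsign u F * contraction v \<zeta> (insert u F) = - (ksign v G * (ksign u G * \<zeta> (insert u G)))"
      using True by (simp add: contraction_def vsign_eq_ksign flip: mult.assoc)
  qed simp
  ultimately show ?thesis by (simp add: sum_negf)
qed

text \<open>Coning with apex \<open>v\<close> contracts the full simplex on the support of
  \<open>a\<close>. It works on the strand if \<open>F - {v}\<close> counts whenever
  \<open>F\<close> does: the cycle condition at \<open>F - {v}\<close> then removes the second term
  of \<open>contraction_homotopy\<close>. Sets of size other than \<open>i\<close> cause no trouble,
  because there that term involves no value of \<open>\<zeta>\<close>.\<close>

lemma multidegree_exact_contraction:
  fixes a :: "'v::{finite,linorder} \<Rightarrow>\<^sub>0 nat"
  assumes v: "v \<in> Poly_Mapping.keys a"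
    and *: "\<And>F. F \<subseteq> Poly_Mapping.keys a \<Longrightarrow> card F = i \<Longrightarrow> v \<in> F \<Longrightarrow> Poly_Mapping.keys (a - mind F) \<in> \<Delta> \<Longrightarrow>
       Poly_Mapping.keys (a - mind (F - {v})) \<in> \<Delta>"
  shows "multidegree_exact TYPE('k::field) \<Delta> a i"
  unfolding multidegree_exact_def
proof (intro allI impI)
  fix \<zeta> :: "'v set \<Rightarrow> 'k"
  assume supp: "\<forall>F. \<zeta> F \<noteq> 0 \<longrightarrow> F \<subseteq> Poly_Mapping.keys a \<and> card F = i"
    and cyc: "\<forall>F\<subseteq>Poly_Mapping.keys a. Poly_Mapping.keys (a - mind F) \<in> \<Delta> \<longrightarrow> simplicial_boundary \<zeta> F = 0"
  show "\<exists>\<eta>. (\<forall>F. \<eta> F \<noteq> 0 \<longrightarrow> F \<subseteq> Poly_Mapping.keys a \<and> card F = Suc i) \<and>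
       (\<forall>F\<subseteq>Poly_Mapping.keys a. Poly_Mapping.keys (a - mind F) \<in> \<Delta> \<longrightarrow> \<zeta> F = simplicial_boundary \<eta> F)"
  proof (intro exI conjI allI impI)
    fix F assume "contraction v \<zeta> F \<noteq> 0"
    then have "v \<in> F" "\<zeta> (F - {v}) \<noteq> 0" by (auto simp: contraction_def split: if_splits)
    then have "F - {v} \<subseteq> Poly_Mapping.keys a" "card (F - {v}) = i" "v \<in> F" using supp by auto
    then show "F \<subseteq> Poly_Mapping.keys a" "card F = Suc i" using v card_Suc_Diff1[of F v]
      by auto
  next
    fix F assume F: "F \<subseteq> Poly_Mapping.keys a" "Poly_Mapping.keys (a - mind F) \<in> \<Delta>"
    have "contraction v (simplicial_boundary \<zeta>) F = 0"
    proof (cases "v \<in> F \<and> card F = i")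
      case True
      then have "Poly_Mapping.keys (a - mind (F - {v})) \<in> \<Delta>" using *[OF F(1)] F(2) by blast
      moreover have "F - {v} \<subseteq> Poly_Mapping.keys a" using F(1) by blast
      ultimately have "simplicial_boundary \<zeta> (F - {v}) = 0" using cyc by blast
      then show ?thesis by (simp add: contraction_def)
    next
      case False
      have "simplicial_boundary \<zeta> (F - {v}) = 0" if vF: "v \<in> F"
      proof -
        have "\<zeta> (insert u (F - {v})) = 0" if "u \<notin> F - {v}" for u
        proof -
          have "card (insert u (F - {v})) = card F" using that vF
            by (metis card_Suc_Diff1 card_insert_disjoint finite)
          then show ?thesis using False vF supp by metis
        qed
        then show ?thesis by (simp add: simplicial_boundary_def)
      qed
      then show ?thesis by (simp add: contraction_def)
    qed
    then show "\<zeta> F = simplicial_boundary (contraction v \<zeta>) F" using contraction_homotopy[of v \<zeta> F] by simp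
  qed
qed

lemma multidegree_exact_0:
  fixes \<Delta> :: "'v::{finite,linorder} set set"
  assumes "i > 0"
  shows "multidegree_exact TYPE('k::field) \<Delta> 0 i"
  unfolding multidegree_exact_def
proof (intro allI impI)
  fix \<zeta> :: "'v set \<Rightarrow> 'k"
  assume "\<forall>F. \<zeta> F \<noteq> 0 \<longrightarrow> F \<subseteq> Poly_Mapping.keys (0 :: 'v \<Rightarrow>\<^sub>0 nat) \<and> card F = i"
  then have "\<zeta> F = 0" for F using assms by fastforce
  then show "\<exists>\<eta>. (\<forall>F. \<eta> F \<noteq> 0 \<longrightarrow> F \<subseteq> Poly_Mapping.keys (0 :: 'v \<Rightarrow>\<^sub>0 nat) \<and> card F = Suc i) \<and>
     (\<forall>F\<subseteq>Poly_Mapping.keys (0 :: 'v \<Rightarrow>\<^sub>0 nat). Poly_Mapping.keys (0 - mind F) \<in> \<Delta> \<longrightarrow> \<zeta> F = simplicial_boundary \<eta> F)"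
    by (intro exI[of _ "\<lambda>_. 0"]) (simp add: simplicial_boundary_def)
qed

text \<open>With exponent at least 2 at \<open>v\<close>, removing \<open>v\<close> from
  \<open>F\<close> does not change the support of \<open>a - mind F\<close>. Hence only squarefree
  multidegrees carry homology.\<close>

lemma multidegree_exact_nonsquarefree:
  assumes "Poly_Mapping.lookup a v \<ge> 2"
  shows "multidegree_exact TYPE('k::field) \<Delta> a i"
proof (rule multidegree_exact_contraction[of v])
  show "v \<in> Poly_Mapping.keys a" using assms by (simp add: in_keys_iff)
  fix F assume "v \<in> F" "Poly_Mapping.keys (a - mind F) \<in> \<Delta>"
  moreover have "Poly_Mapping.keys (a - mind F) = Poly_Mapping.keys (a - mind (F - {v}))"
    using assms by (auto simp: in_keys_iff lookup_minus lookup_mind split: if_splits)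
  ultimately show "Poly_Mapping.keys (a - mind (F - {v})) \<in> \<Delta>" by simp
qed

text \<open>For the zero ideal coning is unrestricted, so any \<open>v\<close> in the support is a
  valid apex.\<close>

lemma multidegree_exact_full:
  assumes "a \<noteq> 0"
  shows "multidegree_exact TYPE('k::field) UNIV a i"
proof -
  obtain v where "v \<in> Poly_Mapping.keys a" using assms by (metis ex_in_conv keys_eq_empty poly_mapping_eqI in_keys_iff lookup_zero)
  then show ?thesis by (rule multidegree_exact_contraction) simp
qed

section \<open>Independent and spanning families of simplices\<close>

definition coboundary :: "('v::{finite,linorder} set \<Rightarrow> 'k::field) \<Rightarrow> 'v set \<Rightarrow> 'k" where
  "coboundary u G = (\<Sum>v\<in>G. ksign v (G - {v}) * u (G - {v}))"

definition cochains_onto :: "'k::field itself \<Rightarrow> 'v::{finite,linorder} set set \<Rightarrow> bool" where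
  "cochains_onto _ B \<longleftrightarrow> (\<forall>f :: 'v set \<Rightarrow> 'k. \<exists>u. \<forall>G\<in>B. coboundary u G = f G)"

text \<open>Dual form of spanning: a functional that kills the columns in \<open>B\<close> of the
  boundary matrix kills all columns.\<close>

definition cochains_determine :: "'k::field itself \<Rightarrow> nat \<Rightarrow> 'v::{finite,linorder} set set \<Rightarrow> bool" where
  "cochains_determine _ d B \<longleftrightarrow>
     (\<forall>u :: 'v set \<Rightarrow> 'k. (\<forall>G\<in>B. coboundary u G = 0) \<longrightarrow> (\<forall>G. card G = d \<longrightarrow> coboundary u G = 0))"

lemma coboundary_add_mult: "coboundary (\<lambda>F. u F + r * u' F) G = coboundary u G + r * coboundary u' G"
  by (simp add: coboundary_def algebra_simps sum.distrib sum_distrib_left)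

text \<open>A maximal independent family spans: a cochain \<open>u0\<close> whose coboundary
  vanishes on \<open>M\<close> but not at \<open>G0\<close> would allow the value at
  \<open>G0\<close> to be adjusted freely without disturbing \<open>M\<close>, making
  \<open>insert G0 M\<close> independent.\<close>

lemma extend_to_basis:
  fixes B :: "'v::{finite,linorder} set set"
  assumes "cochains_onto TYPE('k::field) B" "\<And>G. G \<in> B \<Longrightarrow> card G = d"
  shows "\<exists>B'. B \<subseteq> B' \<and> (\<forall>G\<in>B'. card G = d) \<and> cochains_onto TYPE('k) B' \<and> cochains_determine TYPE('k) d B'"
proof -
  let ?P = "\<lambda>B'. B \<subseteq> B' \<and> (\<forall>G\<in>B'. card G = d) \<and> cochains_onto TYPE('k) B'"
  define S where "S = {B'. ?P B'}"
  have "finite S" by simp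
  moreover have "B \<in> S" using assms by (auto simp: S_def)
  ultimately obtain M where MS: "M \<in> S" and max: "\<forall>B'\<in>S. M \<le> B' \<longrightarrow> M = B'"
    using finite_has_maximal2[of S B] by blast
  have M: "?P M" using MS by (simp add: S_def)
  have "cochains_determine TYPE('k) d M"
    unfolding cochains_determine_def
  proof (intro allI impI, rule ccontr)
    fix u0 :: "'v set \<Rightarrow> 'k" and G0
    assume u0: "\<forall>G\<in>M. coboundary u0 G = 0" and G0: "card G0 = d" "coboundary u0 G0 \<noteq> 0"
    have "cochains_onto TYPE('k) (insert G0 M)"
      unfolding cochains_onto_def
    proof
      fix f :: "'v set \<Rightarrow> 'k"
      obtain u where u: "\<forall>G\<in>M. coboundary u G = f G" using M unfolding cochains_onto_def by blast
      define r where "r = (f G0 - coboundary u G0) / coboundary u0 G0"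
      have "r * coboundary u0 G0 = f G0 - coboundary u G0" using G0(2) by (simp add: r_def)
      then have "\<forall>G\<in>insert G0 M. coboundary (\<lambda>F. u F + r * u0 F) G = f G"
        unfolding coboundary_add_mult using u u0 by simp
      then show "\<exists>u. \<forall>G\<in>insert G0 M. coboundary u G = f G" by blast
    qed
    then have "insert G0 M \<in> S" using M G0(1) by (auto simp: S_def)
    then have "M = insert G0 M" using max by blast
    then have "G0 \<in> M" by blast
    then show False using u0 G0(2) by simp
  qed
  then show ?thesis using M by blast
qed

text \<open>
  Complementation \<open>F \<mapsto> W - F\<close> turns the boundary into the coboundary, up to the signs
  \<open>complement_sign\<close>.
\<close>

definition complement_sign :: "'v::{finite,linorder} set \<Rightarrow> 'v set \<Rightarrow> 'k::field" where
  "complement_sign W F = (\<Prod>w\<in>F. ksign w W)"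

definition complement_twist :: "'v::{finite,linorder} set \<Rightarrow> ('v set \<Rightarrow> 'k::field) \<Rightarrow> 'v set \<Rightarrow> 'k" where
  "complement_twist W u F = (if F \<subseteq> W then complement_sign W F * u (W - F) else 0)"

lemma complement_sign_mult_self [simp]: "complement_sign W F * complement_sign W F = (1 :: 'k::field)"
  unfolding complement_sign_def prod.distrib[symmetric] by simp

lemma ksign_partition:
  fixes W F :: "'v::{finite,linorder} set"
  assumes "F \<subseteq> W" "v \<in> W - F"
  shows "ksign v F * ksign v (W - insert v F) = (ksign v W :: 'k::field)"
proof -
  have "{w \<in> W. w < v} = {w \<in> F. w < v} \<union> {w \<in> W - insert v F. w < v}"
    using assms by auto
  moreover have "card ({w \<in> F. w < v} \<union> {w \<in> W - insert v F. w < v}) = card {w \<in> F. w < v} + card {w \<in> W - insert v F. w < v}"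
    by (rule card_Un_disjoint) auto
  ultimately have "card {w \<in> W. w < v} = card {w \<in> F. w < v} + card {w \<in> W - insert v F. w < v}"
    by (simp only:)
  then show ?thesis by (simp add: ksign_def power_add)
qed

lemma complement_sign_insert:
  fixes W F :: "'v::{finite,linorder} set"
  assumes "F \<subseteq> W" "v \<in> W - F"
  shows "ksign v F * complement_sign W (insert v F) = complement_sign W F * (ksign v (W - insert v F) :: 'k::field)"
proof -
  have "ksign v F * complement_sign W (insert v F) = ksign v F * (ksign v W * (complement_sign W F :: 'k))"
    using assms by (simp add: complement_sign_def)
  also have "\<dots> = ksign v F * ((ksign v F * ksign v (W - insert v F)) * complement_sign W F)"
    by (simp only: ksign_partition[OF assms])
  also have "\<dots> = ksign v (W - insert v F) * complement_sign W F"
    by (simp only: mult.assoc ksign_mult_self_left)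
  finally show ?thesis by (simp only: mult.commute)
qed

lemma simplicial_boundary_complement_twist:
  fixes u :: "'v::{finite,linorder} set \<Rightarrow> 'k::field"
  shows "simplicial_boundary (complement_twist W u) F = complement_twist W (coboundary u) F"
proof (cases "F \<subseteq> W")
  case True
  have "simplicial_boundary (complement_twist W u) F = (\<Sum>v\<in>W - F. vsign v F * complement_twist W u (insert v F))"
    unfolding simplicial_boundary_def
    by (rule sum.mono_neutral_right) (auto simp: complement_twist_def)
  also have "\<dots> = (\<Sum>v\<in>W - F. complement_sign W F * (ksign v (W - F - {v}) * u (W - F - {v})))"
  proof (rule sum.cong)
    fix v assume v: "v \<in> W - F"
    then have "W - F - {v} = W - insert v F" by auto
    then show "vsign v F * complement_twist W u (insert v F) = complement_sign W F * (ksign v (W - F - {v}) * u (W - F - {v}))"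
      using True v complement_sign_insert[OF True v, where ?'k = 'k]
      by (simp add: complement_twist_def vsign_eq_ksign flip: mult.assoc)
  qed simp
  also have "\<dots> = complement_twist W (coboundary u) F"
    using True by (simp add: complement_twist_def coboundary_def sum_distrib_left)
  finally show ?thesis .
next
  case False
  then have "complement_twist W u (insert v F) = 0" for v by (auto simp: complement_twist_def)
  then show ?thesis using False by (simp add: simplicial_boundary_def complement_twist_def)
qed

lemma complement_twist_inverse:
  assumes "\<And>F. \<zeta> F \<noteq> 0 \<Longrightarrow> F \<subseteq> W"
  shows "complement_twist W (\<lambda>G. complement_sign W (W - G) * \<zeta> (W - G)) F = \<zeta> F"
proof (cases "F \<subseteq> W")
  case True
  then have "W - (W - F) = F" by auto
  then show ?thesis using True by (simp add: complement_twist_def flip: mult.assoc)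
next
  case False
  then show ?thesis using assms by (auto simp: complement_twist_def)
qed

lemma simplicial_boundary_boundary:
  fixes \<zeta> :: "'v::{finite,linorder} set \<Rightarrow> 'k::field"
  shows "simplicial_boundary (simplicial_boundary \<zeta>) F = 0"
proof -
  have "simplicial_boundary \<zeta> = kdiff (\<lambda>_. 1) UNIV \<zeta>" for \<zeta> :: "'v set \<Rightarrow> 'k"
    by (simp add: fun_eq_iff simplicial_boundary_eq)
  then show ?thesis using kdiff_kdiff[of UNIV \<zeta> "\<lambda>_. 1" F] by (simp add: kchains_def)
qed

text \<open>Transported from the boundary by complementation inside \<open>G\<close> itself and read
  off at the empty set.\<close>

lemma coboundary_coboundary:
  fixes u :: "'v::{finite,linorder} set \<Rightarrow> 'k::field"
  shows "coboundary (coboundary u) G = 0"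
proof -
  have "simplicial_boundary (complement_twist G u) = complement_twist G (coboundary u)" for u :: "'v set \<Rightarrow> 'k"
    by (simp add: fun_eq_iff simplicial_boundary_complement_twist)
  then have "complement_twist G (coboundary (coboundary u)) {} = 0"
    using simplicial_boundary_boundary[of "complement_twist G u" "{}"] by simp
  then show ?thesis by (simp add: complement_twist_def complement_sign_def)
qed

text \<open>The \<open>d\<close>-subsets of a set with \<open>d + 1\<close> elements are tied by
  \<open>coboundary (coboundary u) = 0\<close>, which a coboundary equal to the indicator of one of
  them violates. The set missing from \<open>B\<close> later serves as a nonface that keeps the
  initial degree at \<open>d\<close>.\<close>

lemma not_cochains_onto_all:
  fixes B :: "'v::{finite,linorder} set set"
  assumes onto: "cochains_onto TYPE('k::field) B" and d: "d < CARD('v)"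
  shows "\<exists>G. card G = d \<and> G \<notin> B"
proof (rule ccontr)
  assume "\<not> ?thesis"
  then have all: "\<And>G. card G = d \<Longrightarrow> G \<in> B" by auto
  obtain G :: "'v set" where G: "card G = d" using obtain_subset_with_card_n[of d "UNIV :: 'v set"] d by auto
  have "G \<noteq> UNIV" using G d by auto
  then obtain v where v: "v \<notin> G" by auto
  obtain u :: "'v set \<Rightarrow> 'k" where u: "\<And>H. H \<in> B \<Longrightarrow> coboundary u H = (if H = G then 1 else 0)"
    using onto[unfolded cochains_onto_def, rule_format, of "\<lambda>H. if H = G then 1 else 0"] by blast
  have "coboundary (coboundary u) (insert v G) = (\<Sum>w\<in>insert v G. ksign w (insert v G - {w}) * (if w = v then 1 else 0))"
    unfolding coboundary_def[of "coboundary u"]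
  proof (rule sum.cong)
    fix w assume w: "w \<in> insert v G"
    then have "card (insert v G - {w}) = d" using v G by (simp add: card_Diff_singleton)
    moreover have "insert v G - {w} = G \<longleftrightarrow> w = v" using v w by auto
    ultimately show "ksign w (insert v G - {w}) * coboundary u (insert v G - {w}) = ksign w (insert v G - {w}) * (if w = v then 1 else 0)"
      using u all by simp
  qed simp
  also have "\<dots> = ksign v G" using v by (simp add: if_distrib sum.delta cong: if_cong)
  finally show False using ksign_mult_self[of v G, where ?'a = 'k] coboundary_coboundary[of u "insert v G"] by simp
qed

section \<open>Koszul homology of complexes with complete codimension one skeleton\<close>

locale skeletal_complex =
  fixes \<Delta> :: "'v::{finite,linorder} set set" and d :: nat
  assumes small_faces: "\<And>F. card F < d \<Longrightarrow> F \<in> \<Delta>"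
    and face_card: "\<And>F. F \<in> \<Delta> \<Longrightarrow> card F \<le> d"
    and d_ge_2: "d \<ge> 2"
begin

definition tops :: "'v set set" where
  "tops = {G \<in> \<Delta>. card G = d}"

text \<open>Below the linear strand: deleting \<open>i - 1\<close> elements from \<open>W\<close>
  leaves fewer than \<open>d\<close>, always a face, so coning applies.\<close>

lemma exact_below:
  assumes "W \<noteq> {}" "card W + 2 \<le> i + d"
  shows "multidegree_exact TYPE('k::field) \<Delta> (mind W) i"
proof -
  obtain v where v: "v \<in> W" using assms by auto
  show ?thesis
  proof (rule multidegree_exact_contraction[of v])
    fix F assume F: "F \<subseteq> Poly_Mapping.keys (mind W)" "card F = i" "v \<in> F"
    have "card (W - (F - {v})) = card W - card (F - {v})"
      using F by (intro card_Diff_subset) auto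
    also have "\<dots> < d"
    proof -
      have "card (F - {v}) = i - 1" "0 < i" using F by (auto simp: card_Diff_singleton card_gt_0_iff)
      then show ?thesis using assms(2) d_ge_2 by linarith
    qed
    finally show "Poly_Mapping.keys (mind W - mind (F - {v})) \<in> \<Delta>" by (simp add: small_faces)
  qed (use v in simp)
qed

text \<open>Deleting \<open>i\<close> elements from \<open>W\<close> leaves more than
  \<open>d\<close>, never a face, so the strand is zero in this degree.\<close>

lemma exact_above:
  assumes "card W > i + d"
  shows "multidegree_exact TYPE('k::field) \<Delta> (mind W) i"
  unfolding multidegree_exact_def
proof (intro allI impI)
  fix \<zeta> :: "'v set \<Rightarrow> 'k"
  assume supp: "\<forall>F. \<zeta> F \<noteq> 0 \<longrightarrow> F \<subseteq> Poly_Mapping.keys (mind W) \<and> card F = i"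
  have "\<zeta> F = 0" if "F \<subseteq> W" "W - F \<in> \<Delta>" for F
  proof (rule ccontr)
    assume "\<zeta> F \<noteq> 0"
    then have "card F = i" using supp by blast
    then have "card (W - F) > d" using assms that(1) by (simp add: card_Diff_subset)
    then show False using face_card[OF that(2)] by simp
  qed
  then show "\<exists>\<eta>. (\<forall>F. \<eta> F \<noteq> 0 \<longrightarrow> F \<subseteq> Poly_Mapping.keys (mind W) \<and> card F = Suc i) \<and>
       (\<forall>F\<subseteq>Poly_Mapping.keys (mind W). Poly_Mapping.keys (mind W - mind F) \<in> \<Delta> \<longrightarrow> \<zeta> F = simplicial_boundary \<eta> F)"
    by (intro exI[of _ "\<lambda>_. 0"]) (simp add: simplicial_boundary_def)
qed

text \<open>The relevant \<open>F\<close> of size \<open>i\<close> are complements in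
  \<open>W\<close> of top faces. After complementation, solving for \<open>\<eta>\<close> means
  prescribing a coboundary on top faces, which independence permits.\<close>

lemma exact_top:
  assumes onto: "cochains_onto TYPE('k::field) tops" and W: "card W = i + d"
  shows "multidegree_exact TYPE('k::field) \<Delta> (mind W) i"
  unfolding multidegree_exact_def
proof (intro allI impI)
  fix \<zeta> :: "'v set \<Rightarrow> 'k"
  assume supp: "\<forall>F. \<zeta> F \<noteq> 0 \<longrightarrow> F \<subseteq> Poly_Mapping.keys (mind W) \<and> card F = i"
  obtain u where u: "\<forall>G\<in>tops. coboundary u G = complement_sign W (W - G) * \<zeta> (W - G)"
    using onto[unfolded cochains_onto_def, rule_format, of "\<lambda>G. complement_sign W (W - G) * \<zeta> (W - G)"] by blast
  define \<eta> where "\<eta> F = (if card F = Suc i then complement_twist W u F else 0)" for F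
  have "\<zeta> F = simplicial_boundary \<eta> F" if F: "F \<subseteq> W" "W - F \<in> \<Delta>" for F
  proof (cases "card F = i")
    case True
    then have "W - F \<in> tops" using F W by (simp add: tops_def card_Diff_subset)
    moreover have "W - (W - F) = F" using F by auto
    ultimately have "\<zeta> F = complement_twist W (coboundary u) F"
      using u F by (simp add: complement_twist_def flip: mult.assoc)
    also have "\<dots> = simplicial_boundary (complement_twist W u) F"
      by (simp add: simplicial_boundary_complement_twist)
    also have "\<dots> = simplicial_boundary \<eta> F"
      unfolding simplicial_boundary_def by (rule sum.cong) (use True in \<open>auto simp: \<eta>_def\<close>)
    finally show ?thesis .
  next
    case False
    then have "\<zeta> F = 0" using supp by blast
    moreover have "\<eta> (insert v F) = 0" if "v \<notin> F" for v using that False by (simp add: \<eta>_def)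
    ultimately show ?thesis by (simp add: simplicial_boundary_def)
  qed
  moreover have "F \<subseteq> W \<and> card F = Suc i" if "\<eta> F \<noteq> 0" for F
    using that by (auto simp: \<eta>_def complement_twist_def split: if_splits)
  ultimately show "\<exists>\<eta>. (\<forall>F. \<eta> F \<noteq> 0 \<longrightarrow> F \<subseteq> Poly_Mapping.keys (mind W) \<and> card F = Suc i) \<and>
       (\<forall>F\<subseteq>Poly_Mapping.keys (mind W). Poly_Mapping.keys (mind W - mind F) \<in> \<Delta> \<longrightarrow> \<zeta> F = simplicial_boundary \<eta> F)"
    by (intro exI[of _ \<eta>]) simp
qed

text \<open>The only squarefree multidegree of the linear strand in homological degree
  \<open>n - d + 1\<close>. After complementation the cycle condition says that a coboundary
  vanishes on the top faces; spanning extends this to all \<open>d\<close>-sets, so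
  \<open>\<zeta>\<close> is a cycle of the full simplex, which is acyclic.\<close>

lemma exact_corner:
  assumes det: "cochains_determine TYPE('k::field) d tops" and i: "CARD('v) + 1 = i + d"
  shows "multidegree_exact TYPE('k::field) \<Delta> (mind UNIV) i"
  unfolding multidegree_exact_def
proof (intro allI impI)
  fix \<zeta> :: "'v set \<Rightarrow> 'k"
  assume supp: "\<forall>F. \<zeta> F \<noteq> 0 \<longrightarrow> F \<subseteq> Poly_Mapping.keys (mind UNIV) \<and> card F = i"
    and cyc: "\<forall>F\<subseteq>Poly_Mapping.keys (mind UNIV). Poly_Mapping.keys (mind UNIV - mind F) \<in> \<Delta> \<longrightarrow> simplicial_boundary \<zeta> F = 0"
  define u where "u G = complement_sign UNIV (UNIV - G) * \<zeta> (UNIV - G)" for G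
  have \<zeta>: "\<zeta> = complement_twist UNIV u"
    unfolding u_def fun_eq_iff using complement_twist_inverse[of \<zeta> UNIV] by simp
  have tw: "simplicial_boundary \<zeta> F = complement_sign UNIV F * coboundary u (UNIV - F)" for F
    unfolding \<zeta> simplicial_boundary_complement_twist by (simp add: complement_twist_def)
  have sgn: "complement_sign UNIV F \<noteq> (0 :: 'k)" for F :: "'v set"
    using complement_sign_mult_self[of UNIV F, where ?'k = 'k] by (auto simp del: complement_sign_mult_self)
  have "\<forall>G\<in>tops. coboundary u G = 0"
  proof
    fix G assume "G \<in> tops"
    then have "simplicial_boundary \<zeta> (UNIV - G) = 0" using cyc by (simp add: tops_def double_diff)
    then show "coboundary u G = 0" using tw[of "UNIV - G"] sgn[of "UNIV - G"] by (simp add: double_diff)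
  qed
  then have cu: "coboundary u G = 0" if "card G = d" for G
    using det that unfolding cochains_determine_def by blast
  have "simplicial_boundary \<zeta> F = 0" for F
  proof (cases "Suc (card F) = i")
    case True
    then have "card (UNIV - F) = d" using i card_Diff_subset[of F UNIV] by simp
    then show ?thesis using tw[of F] cu by simp
  next
    case False
    then have "\<zeta> (insert v F) = 0" if "v \<notin> F" for v using supp[rule_format, of "insert v F"] that by auto
    then show ?thesis by (simp add: simplicial_boundary_def)
  qed
  moreover have "mind (UNIV :: 'v set) \<noteq> 0" using keys_mind[of "UNIV :: 'v set"] by (auto simp del: keys_mind)
  ultimately obtain \<eta> where "\<forall>F. \<eta> F \<noteq> 0 \<longrightarrow> F \<subseteq> Poly_Mapping.keys (mind UNIV) \<and> card F = Suc i"
    "\<forall>F. \<zeta> F = simplicial_boundary \<eta> F"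
    using multidegree_exact_full[of "mind UNIV :: 'v \<Rightarrow>\<^sub>0 nat" i, where ?'k = 'k, unfolded multidegree_exact_def, THEN spec, of \<zeta>] supp
    by auto
  then show "\<exists>\<eta>. (\<forall>F. \<eta> F \<noteq> 0 \<longrightarrow> F \<subseteq> Poly_Mapping.keys (mind UNIV) \<and> card F = Suc i) \<and>
       (\<forall>F\<subseteq>Poly_Mapping.keys (mind UNIV). Poly_Mapping.keys (mind UNIV - mind F) \<in> \<Delta> \<longrightarrow> \<zeta> F = simplicial_boundary \<eta> F)"
    by (intro exI[of _ \<eta>]) simp
qed

lemma exact_linear_strand:
  assumes onto: "cochains_onto TYPE('k::field) tops" and a: "a \<noteq> 0" "mdeg a + 1 \<noteq> i + d"
  shows "multidegree_exact TYPE('k::field) \<Delta> a i"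
proof (cases "\<exists>v. Poly_Mapping.lookup a v \<ge> 2")
  case True
  then show ?thesis using multidegree_exact_nonsquarefree by blast
next
  case False
  have "Poly_Mapping.lookup a v \<le> 1" for v using False[unfolded not_ex, rule_format, of v] by linarith
  then obtain W where W: "a = mind W" using squarefree_mind by blast
  then have "W \<noteq> {}" using a by auto
  consider "card W + 2 \<le> i + d" | "card W > i + d" | "card W = i + d" using a(2) W by fastforce
  then show ?thesis using W \<open>W \<noteq> {}\<close> exact_below exact_above exact_top[OF onto] by cases auto
qed

text \<open>A squarefree multidegree on the linear strand has degree \<open>i + d - 1\<close>, here
  at least \<open>n\<close>; so it is all of \<open>V\<close>, and \<open>i = n - d + 1\<close> is
  the corner case.\<close>

lemma exact_high:
  assumes onto: "cochains_onto TYPE('k::field) tops" and det: "cochains_determine TYPE('k) d tops"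
    and i: "CARD('v) < i + d" "i > 0"
  shows "multidegree_exact TYPE('k::field) \<Delta> a i"
proof (cases "a = 0")
  case True
  show ?thesis unfolding True by (rule multidegree_exact_0[OF i(2)])
next
  case False
  show ?thesis
  proof (cases "mdeg a + 1 = i + d \<and> (\<forall>v. Poly_Mapping.lookup a v < 2)")
    case True
    then have "Poly_Mapping.lookup a v \<le> 1" for v using True[THEN conjunct2, rule_format, of v] by linarith
    then obtain W where W: "a = mind W" using squarefree_mind by blast
    then have "card W + 1 = i + d" using True by simp
    moreover have "card W \<le> CARD('v)" by (rule card_mono) auto
    ultimately have "card W = CARD('v)" using i by linarith
    then have "W = UNIV" by (intro card_subset_eq) auto
    then show ?thesis using exact_corner[OF det] W \<open>card W + 1 = i + d\<close> by simp
  next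
    case ndeg: False
    then show ?thesis
      using exact_linear_strand[OF onto False] multidegree_exact_nonsquarefree[of a _ \<Delta> i, where ?'k = 'k] not_less by blast
  qed
qed

text \<open>Converse of \<open>exact_top\<close> in the multidegree of all variables. A function on
  \<open>d\<close>-sets, moved to their complements, is a chain whose boundary sits on sets with
  \<open>d + 1\<close> elements in the complement; these are nonfaces, so it is a cycle modulo the
  ideal. A chain that it bounds is, after complementation, the desired cochain.\<close>

lemma onto_of_exact:
  assumes d: "d \<le> CARD('v)"
    and E: "\<And>z. z \<in> kpiece {a. mdeg a = CARD('v)} (CARD('v) - d) \<Longrightarrow> (\<And>F. kd z F \<in> face_ideal \<Delta>) \<Longrightarrow>
      \<exists>w. \<forall>F. z F - kd w F \<in> (face_ideal \<Delta> :: ('v, 'k::field) mpoly set)"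
  shows "cochains_onto TYPE('k) tops"
  unfolding cochains_onto_def
proof
  fix f :: "'v set \<Rightarrow> 'k"
  define i where "i = CARD('v) - d"
  define \<zeta> where "\<zeta> F = (if card F = i then complement_sign UNIV F * f (UNIV - F) else 0)" for F
  have "\<exists>z. \<forall>a F. mcomp a z F = (if a = mind UNIV then \<zeta> F else 0)"
    by (rule mcomp_assemble[of "{mind UNIV}"]) (auto split: if_splits)
  then obtain z where z: "\<And>a F. mcomp a z F = (if a = mind UNIV then \<zeta> F else 0)" by blast
  have mz: "mcomp a z = (if a = mind UNIV then \<zeta> else (\<lambda>_. 0))" for a by (simp add: fun_eq_iff z)
  have "z \<in> kpiece {a. mdeg a = CARD('v)} (CARD('v) - d)"
    by (rule kpiece_mcompI) (auto simp: z \<zeta>_def i_def split: if_splits)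
  moreover have "kd z F \<in> face_ideal \<Delta>" for F
    unfolding mem_face_ideal_iff_mcomp mcomp_kd
  proof (intro allI impI)
    fix a assume F: "F \<subseteq> Poly_Mapping.keys a" "Poly_Mapping.keys (a - mind F) \<in> \<Delta>"
    show "simplicial_boundary (mcomp a z) F = 0"
    proof (cases "a = mind UNIV")
      case True
      have "card (UNIV - F) \<le> d" using F(2) True face_card by simp
      then have "i \<le> card F" using card_Diff_subset[of F UNIV] unfolding i_def by simp
      then have "\<zeta> (insert v F) = 0" if "v \<notin> F" for v using that by (simp add: \<zeta>_def)
      then show ?thesis using True by (simp add: mz simplicial_boundary_def)
    qed (simp add: mz simplicial_boundary_def)
  qed
  ultimately obtain w where w: "\<And>F. z F - kd w F \<in> face_ideal \<Delta>" using E by blast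
  define \<eta> where "\<eta> = mcomp (mind UNIV) w"
  define u where "u G = complement_sign UNIV (UNIV - G) * \<eta> (UNIV - G)" for G
  have \<eta>: "\<eta> = complement_twist UNIV u"
    unfolding u_def fun_eq_iff using complement_twist_inverse[of \<eta> UNIV] by simp
  have "coboundary u G = f G" if G: "G \<in> tops" for G
  proof -
    have GG: "UNIV - (UNIV - G) = G" by auto
    have cG: "card (UNIV - G) = i" using G d by (simp add: tops_def card_Diff_subset i_def)
    have "\<zeta> (UNIV - G) = simplicial_boundary \<eta> (UNIV - G)"
      using kpiece_boundary_mcomp[OF w, of "UNIV - G" "mind UNIV"] G GG
      by (simp add: mz \<eta>_def tops_def)
    also have "\<dots> = complement_sign UNIV (UNIV - G) * coboundary u G"
      unfolding \<eta> simplicial_boundary_complement_twist by (simp add: complement_twist_def GG)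
    finally have "complement_sign UNIV (UNIV - G) * f G = complement_sign UNIV (UNIV - G) * coboundary u G"
      using cG by (simp add: \<zeta>_def GG)
    then have "complement_sign UNIV (UNIV - G) * (complement_sign UNIV (UNIV - G) * f G) =
      complement_sign UNIV (UNIV - G) * (complement_sign UNIV (UNIV - G) * coboundary u G)" by simp
    then show ?thesis by (simp flip: mult.assoc)
  qed
  then show "\<exists>u. \<forall>G\<in>tops. coboundary u G = f G" by blast
qed

text \<open>The Koszul class of a minimal generator: \<open>e_v\<close> times the monomial of
  \<open>G - {v}\<close>, with differential the monomial of \<open>G\<close>. All
  \<open>G - {u}\<close> are faces, so if it were a boundary then \<open>\<zeta>\<close> would agree
  with \<open>simplicial_boundary \<eta>\<close> on all singletons, and the double boundary at the
  empty set would be 1 instead of 0.\<close>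

lemma nonface_not_exact:
  assumes G: "card G = d" "G \<notin> \<Delta>"
  shows "\<exists>z. z \<in> kpiece {a. mdeg a = d} 1 \<and> (\<forall>F. kd z F \<in> face_ideal \<Delta>) \<and>
    \<not> (\<exists>w. \<forall>F. z F - kd w F \<in> (face_ideal \<Delta> :: ('v, 'k::field) mpoly set))"
proof -
  obtain v where v: "v \<in> G" using G(1) d_ge_2 by fastforce
  define \<zeta> :: "'v set \<Rightarrow> 'k" where "\<zeta> F = (if F = {v} then 1 else 0)" for F
  have "\<exists>z. \<forall>a F. mcomp a z F = (if a = mind G then \<zeta> F else 0)"
    by (rule mcomp_assemble[of "{mind G}"]) (use v in \<open>auto simp: \<zeta>_def split: if_splits\<close>)
  then obtain z where z: "\<And>a F. mcomp a z F = (if a = mind G then \<zeta> F else 0)" by blast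
  have mz: "mcomp a z = (if a = mind G then \<zeta> else (\<lambda>_. 0))" for a by (simp add: fun_eq_iff z)
  have "z \<in> kpiece {a. mdeg a = d} 1"
    by (rule kpiece_mcompI) (auto simp: z \<zeta>_def G(1) split: if_splits)
  moreover have "kd z F \<in> face_ideal \<Delta>" for F
    unfolding mem_face_ideal_iff_mcomp mcomp_kd
  proof (intro allI impI)
    fix a assume F: "F \<subseteq> Poly_Mapping.keys a" "Poly_Mapping.keys (a - mind F) \<in> \<Delta>"
    show "simplicial_boundary (mcomp a z) F = 0"
    proof (cases "a = mind G")
      case True
      then have "F \<noteq> {}" using F G by auto
      then have "\<zeta> (insert w F) = 0" if "w \<notin> F" for w using that by (auto simp: \<zeta>_def)
      then show ?thesis using True by (simp add: mz simplicial_boundary_def)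
    qed (simp add: mz simplicial_boundary_def)
  qed
  moreover have "\<not> (\<exists>w. \<forall>F. z F - kd w F \<in> face_ideal \<Delta>)"
  proof
    assume "\<exists>w. \<forall>F. z F - kd w F \<in> face_ideal \<Delta>"
    then obtain w where w: "\<And>F. z F - kd w F \<in> face_ideal \<Delta>" by blast
    define \<eta> where "\<eta> = mcomp (mind G) w"
    have eq: "\<zeta> {u} = simplicial_boundary \<eta> {u}" for u
    proof (cases "u \<in> G")
      case True
      then have "card (G - {u}) < d" using G d_ge_2 by (simp add: card_Diff_singleton)
      then show ?thesis
        using kpiece_boundary_mcomp[OF w, of "{u}" "mind G"] True small_faces[of "G - {u}"] by (simp add: mz \<eta>_def)
    next
      case False
      then have "\<eta> (insert t {u}) = 0" for t by (auto simp: \<eta>_def mcomp_def)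
      then show ?thesis using False v by (auto simp: \<zeta>_def simplicial_boundary_def)
    qed
    have "simplicial_boundary \<zeta> {} = simplicial_boundary (simplicial_boundary \<eta>) {}"
      unfolding simplicial_boundary_def[of \<zeta>] simplicial_boundary_def[of "simplicial_boundary \<eta>"]
      using eq by simp
    moreover have "simplicial_boundary \<zeta> {} = 1"
      by (simp add: simplicial_boundary_def \<zeta>_def vsign_eq_ksign if_distrib sum.delta cong: if_cong)
    ultimately show False by (simp add: simplicial_boundary_boundary)
  qed
  ultimately show ?thesis by blast
qed

end

section \<open>Balancing the two homologies of a double complex\<close>

text \<open>A linear relation takes the place of a linear map, since the comparisons below depend on
  choices of lifts. Totality and reflection of boundaries are what carries a family independent
  modulo \<open>B\<close> to one independent modulo \<open>B'\<close>.\<close>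

lemma subquotient_dim_le:
  fixes sc :: "'k::field \<Rightarrow> 'w::ab_group_add \<Rightarrow> 'w" and sc' :: "'k \<Rightarrow> 'w'::ab_group_add \<Rightarrow> 'w'"
    and R :: "('i \<Rightarrow> 'w) \<Rightarrow> ('j \<Rightarrow> 'w') \<Rightarrow> bool"
  assumes vs: "vector_space sc'"
    and total: "\<And>z. z \<in> Z \<Longrightarrow> \<exists>z'\<in>Z'. R z z'"
    and R0: "R (\<lambda>_. 0) (\<lambda>_. 0)"
    and Radd: "\<And>x x' y y'. R x x' \<Longrightarrow> R y y' \<Longrightarrow> R (\<lambda>t. x t + y t) (\<lambda>t. x' t + y' t)"
    and Rsc: "\<And>a x x'. R x x' \<Longrightarrow> R (\<lambda>t. sc a (x t)) (\<lambda>t. sc' a (x' t))"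
    and refl: "\<And>x x'. R x x' \<Longrightarrow> x' \<in> B' \<Longrightarrow> x \<in> B"
    and B0: "(\<lambda>_. 0) \<in> B'"
  shows "subquotient_dim sc Z B \<le> subquotient_dim sc' Z' B'"
  unfolding subquotient_dim_def
proof (rule Sup_least, clarify)
  interpret vector_space sc' by (rule vs)
  fix U assume U: "finite U" "U \<subseteq> Z"
    and ind: "\<forall>a. (\<lambda>t. \<Sum>u\<in>U. sc (a u) (u t)) \<in> B \<longrightarrow> (\<forall>u\<in>U. a u = 0)"
  have "\<forall>u\<in>U. \<exists>z'\<in>Z'. R u z'" using total U(2) by blast
  then obtain \<rho> where \<rho>: "\<And>u. u \<in> U \<Longrightarrow> \<rho> u \<in> Z'" "\<And>u. u \<in> U \<Longrightarrow> R u (\<rho> u)" by metis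
  have "finite V \<Longrightarrow> V \<subseteq> U \<Longrightarrow> R (\<lambda>t. \<Sum>u\<in>V. sc (a u) (u t)) (\<lambda>t. \<Sum>u\<in>V. sc' (a u) (\<rho> u t))" for V a
  proof (induction V rule: finite_induct)
    case empty
    then show ?case using R0 by simp
  next
    case (insert u V)
    then show ?case using Radd[OF Rsc[OF \<rho>(2)[of u], of "a u"]] by simp
  qed
  then have comb: "R (\<lambda>t. \<Sum>u\<in>U. sc (a u) (u t)) (\<lambda>t. \<Sum>u\<in>U. sc' (a u) (\<rho> u t))" for a using U(1) by blast
  then have zero: "\<forall>u\<in>U. a u = 0" if "(\<lambda>t. \<Sum>u\<in>U. sc' (a u) (\<rho> u t)) \<in> B'" for a
    using refl[OF comb that] ind by blast
  \<comment> \<open>Dimensions count sets, so the images must be distinct. Two equal images would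
    give the relation with coefficients 1 and -1.\<close>
  have inj: "inj_on \<rho> U"
  proof (rule inj_onI, rule ccontr)
    fix u u' assume u: "u \<in> U" "u' \<in> U" "\<rho> u = \<rho> u'" "u \<noteq> u'"
    define a :: "('i \<Rightarrow> 'w) \<Rightarrow> 'k" where "a w = (if w = u then 1 else if w = u' then - 1 else 0)" for w
    have "(\<Sum>w\<in>U. sc' (a w) (\<rho> w t)) = 0" for t
    proof -
      have "(\<Sum>w\<in>U. sc' (a w) (\<rho> w t)) = (\<Sum>w\<in>{u, u'}. sc' (a w) (\<rho> w t))"
        by (rule sum.mono_neutral_right) (use U u in \<open>auto simp: a_def\<close>)
      also have "\<dots> = 0" using u by (simp add: a_def scale_minus_left)
      finally show ?thesis .
    qed
    then have "\<forall>w\<in>U. a w = 0" using zero[of a] B0 by simp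
    then show False using u(1) by (auto simp: a_def)
  qed
  have "enat (card (\<rho> ` U)) \<in> {enat (card U) | U. finite U \<and> U \<subseteq> Z' \<and>
       (\<forall>a. (\<lambda>t. \<Sum>u\<in>U. sc' (a u) (u t)) \<in> B' \<longrightarrow> (\<forall>u\<in>U. a u = 0))}"
  proof (intro CollectI exI[of _ "\<rho> ` U"] conjI allI impI refl)
    show "finite (\<rho> ` U)" using U by simp
    show "\<rho> ` U \<subseteq> Z'" using \<rho>(1) by blast
    fix b assume "(\<lambda>t. \<Sum>u\<in>\<rho> ` U. sc' (b u) (u t)) \<in> B'"
    then have "(\<lambda>t. \<Sum>u\<in>U. sc' (b (\<rho> u)) (\<rho> u t)) \<in> B'" by (simp add: sum.reindex[OF inj])
    then show "\<forall>u\<in>\<rho> ` U. b u = 0" using zero[of "\<lambda>u. b (\<rho> u)"] by blast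
  qed (rule HOL.refl)
  then show "enat (card U) \<le> Sup {enat (card U) | U. finite U \<and> U \<subseteq> Z' \<and>
       (\<forall>a. (\<lambda>t. \<Sum>u\<in>U. sc' (a u) (u t)) \<in> B' \<longrightarrow> (\<forall>u\<in>U. a u = 0))}"
    using card_image[OF inj] by (simp add: Sup_upper)
qed

lemma subquotient_dim_eq_0_iff:
  assumes vs: "vector_space sc"
    and scB: "\<And>a x. x \<in> B \<Longrightarrow> (\<lambda>t. sc a (x t)) \<in> B"
  shows "subquotient_dim sc Z B = 0 \<longleftrightarrow> Z \<subseteq> B"
proof -
  interpret vector_space sc by (rule vs)
  show ?thesis
  proof
    assume 0: "subquotient_dim sc Z B = 0"
    show "Z \<subseteq> B"
    proof (rule ccontr)
      assume "\<not> Z \<subseteq> B"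
      then obtain z where z: "z \<in> Z" "z \<notin> B" by blast
      have "\<forall>u\<in>{z}. a u = 0" if "(\<lambda>t. \<Sum>u\<in>{z}. sc (a u) (u t)) \<in> B" for a
      proof (rule ccontr)
        assume "\<not> (\<forall>u\<in>{z}. a u = 0)"
        then have "a z \<noteq> 0" by simp
        then have "z \<in> B" using scB[of "\<lambda>t. sc (a z) (z t)" "inverse (a z)"] that by simp
        then show False using z(2) by simp
      qed
      then have "enat (card {z}) \<le> subquotient_dim sc Z B"
        unfolding subquotient_dim_def using z(1) by (intro Sup_upper CollectI exI[of _ "{z}"]) simp
      then show False using 0 by (simp add: enat_0_iff)
    qed
  next
    assume ZB: "Z \<subseteq> B"
    have card0: "card U = 0" if "finite U" "U \<subseteq> Z" "\<forall>a. (\<lambda>t. \<Sum>u\<in>U. sc (a u) (u t)) \<in> B \<longrightarrow> (\<forall>u\<in>U. a u = 0)" for U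
    proof (rule ccontr)
      assume "card U \<noteq> 0"
      then obtain z where z: "z \<in> U" by fastforce
      have "(\<Sum>u\<in>U. sc (if u = z then 1 else 0) (u t)) = (\<Sum>u\<in>{z}. sc (if u = z then 1 else 0) (u t))" for t
        by (rule sum.mono_neutral_right) (use that z in auto)
      then have "(\<lambda>t. \<Sum>u\<in>U. sc (if u = z then 1 else 0) (u t)) = z" by simp
      then have "(\<lambda>t. \<Sum>u\<in>U. sc (if u = z then 1 else 0) (u t)) \<in> B" using that(2) ZB z by auto
      then have "(if z = z then 1 else 0 :: 'a) = 0"
        using that(3)[THEN spec, of "\<lambda>u. if u = z then 1 else 0"] z by blast
      then show False by simp
    qed
    have "subquotient_dim sc Z B \<le> 0"
      unfolding subquotient_dim_def
    proof (rule Sup_least, clarify)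
      fix U assume U: "finite U" "U \<subseteq> Z" "\<forall>a. (\<lambda>t. \<Sum>u\<in>U. sc (a u) (u t)) \<in> B \<longrightarrow> (\<forall>u\<in>U. a u = 0)"
      show "enat (card U) \<le> 0" unfolding card0[OF U] by (simp add: zero_enat_def)
    qed
    then show "subquotient_dim sc Z B = 0" by simp
  qed
qed

text \<open>A first quadrant double complex with commuting differentials, exact in positive degree
  in both directions. Homology is left only on the two edges: \<open>vcycles\<close> and
  \<open>vboundaries\<close> describe, by representatives, the homology under \<open>dv\<close> of
  the cokernels of \<open>dh 0\<close>, and \<open>hcycles\<close> and \<open>hboundaries\<close>
  that under \<open>dh\<close> of the cokernels of \<open>dv 0\<close>.\<close>

locale exact_double_complex =
  fixes M :: "nat \<Rightarrow> nat \<Rightarrow> ('i \<Rightarrow> 'w::ab_group_add) set"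
    and dh dv :: "nat \<Rightarrow> ('i \<Rightarrow> 'w) \<Rightarrow> 'i \<Rightarrow> 'w"
  assumes M_0: "(\<lambda>_. 0) \<in> M p q"
    and M_add: "x \<in> M p q \<Longrightarrow> y \<in> M p q \<Longrightarrow> (\<lambda>t. x t + y t) \<in> M p q"
    and M_minus: "x \<in> M p q \<Longrightarrow> (\<lambda>t. - x t) \<in> M p q"
    and dh_M: "x \<in> M (Suc p) q \<Longrightarrow> dh p x \<in> M p q"
    and dv_M: "x \<in> M p (Suc q) \<Longrightarrow> dv q x \<in> M p q"
    and dh_add: "dh p (\<lambda>t. x t + y t) = (\<lambda>t. dh p x t + dh p y t)"
    and dv_add: "dv q (\<lambda>t. x t + y t) = (\<lambda>t. dv q x t + dv q y t)"
    and comm: "x \<in> M (Suc p) (Suc q) \<Longrightarrow> dh p (dv q x) = dv q (dh p x)"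
    and dh_dh: "x \<in> M (Suc (Suc p)) q \<Longrightarrow> dh p (dh (Suc p) x) = (\<lambda>_. 0)"
    and dv_dv: "x \<in> M p (Suc (Suc q)) \<Longrightarrow> dv q (dv (Suc q) x) = (\<lambda>_. 0)"
    and dh_exact: "x \<in> M (Suc p) q \<Longrightarrow> dh p x = (\<lambda>_. 0) \<Longrightarrow> \<exists>y\<in>M (Suc (Suc p)) q. dh (Suc p) y = x"
    and dv_exact: "x \<in> M p (Suc q) \<Longrightarrow> dv q x = (\<lambda>_. 0) \<Longrightarrow> \<exists>y\<in>M p (Suc (Suc q)). dv (Suc q) y = x"
begin

definition vcycles :: "nat \<Rightarrow> ('i \<Rightarrow> 'w) set" where
  "vcycles i = {x \<in> M 0 i. i > 0 \<longrightarrow> dv (i - 1) x \<in> dh 0 ` M 1 (i - 1)}"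

definition vboundaries :: "nat \<Rightarrow> ('i \<Rightarrow> 'w) set" where
  "vboundaries i = {x. \<exists>a\<in>M 0 (Suc i). \<exists>b\<in>M 1 i. x = (\<lambda>t. dv i a t + dh 0 b t)}"

definition hcycles :: "nat \<Rightarrow> ('i \<Rightarrow> 'w) set" where
  "hcycles i = {y \<in> M i 0. i > 0 \<longrightarrow> dh (i - 1) y \<in> dv 0 ` M (i - 1) 1}"

definition hboundaries :: "nat \<Rightarrow> ('i \<Rightarrow> 'w) set" where
  "hboundaries i = {y. \<exists>a\<in>M (Suc i) 0. \<exists>b\<in>M i 1. y = (\<lambda>t. dh i a t + dv 0 b t)}"

text \<open>A staircase of total degree \<open>i\<close> from one edge to the other. Its entries are
  chosen lifts, so the two edges are matched by a relation.\<close>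

definition zigzag :: "nat \<Rightarrow> ('i \<Rightarrow> 'w) \<Rightarrow> ('i \<Rightarrow> 'w) \<Rightarrow> bool" where
  "zigzag i x y \<longleftrightarrow> (\<exists>c. c 0 = x \<and> c i = y \<and> (\<forall>p\<le>i. c p \<in> M p (i - p)) \<and>
     (\<forall>p<i. dv (i - Suc p) (c p) = dh p (c (Suc p))))"

lemma dh_0 [simp]: "dh p (\<lambda>_. 0) = (\<lambda>_. 0)"
proof -
  have "dh p (\<lambda>_. 0) t = dh p (\<lambda>_. 0) t + dh p (\<lambda>_. 0) t" for t
    using fun_cong[OF dh_add[of p "\<lambda>_. 0" "\<lambda>_. 0"], of t] by simp
  then show ?thesis by (simp add: fun_eq_iff)
qed

lemma dv_0 [simp]: "dv p (\<lambda>_. 0) = (\<lambda>_. 0)"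
proof -
  have "dv p (\<lambda>_. 0) t = dv p (\<lambda>_. 0) t + dv p (\<lambda>_. 0) t" for t
    using fun_cong[OF dv_add[of p "\<lambda>_. 0" "\<lambda>_. 0"], of t] by simp
  then show ?thesis by (simp add: fun_eq_iff)
qed

lemma dh_minus: "dh p (\<lambda>t. - x t) t = - dh p x t"
  using fun_cong[OF dh_add[of p "\<lambda>t. - x t" x], of t] by (simp add: eq_neg_iff_add_eq_0)

lemma dh_diff: "dh p (\<lambda>t. x t - y t) t = dh p x t - dh p y t"
  using fun_cong[OF dh_add[of p x "\<lambda>t. - y t"], of t] by (simp add: dh_minus)

lemma M_diff: "x \<in> M p q \<Longrightarrow> y \<in> M p q \<Longrightarrow> (\<lambda>t. x t - y t) \<in> M p q"
  using M_add[of x p q "\<lambda>t. - y t"] M_minus[of y p q] by simp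

lemma vboundaries_add:
  assumes "x \<in> vboundaries i" "y \<in> vboundaries i"
  shows "(\<lambda>t. x t + y t) \<in> vboundaries i"
proof -
  obtain a b where a: "a \<in> M 0 (Suc i)" "b \<in> M 1 i" "x = (\<lambda>t. dv i a t + dh 0 b t)"
    using assms(1) unfolding vboundaries_def by blast
  obtain a' b' where b: "a' \<in> M 0 (Suc i)" "b' \<in> M 1 i" "y = (\<lambda>t. dv i a' t + dh 0 b' t)"
    using assms(2) unfolding vboundaries_def by blast
  show ?thesis unfolding vboundaries_def
  proof (intro CollectI bexI)
    show "(\<lambda>t. x t + y t) = (\<lambda>t. dv i (\<lambda>t. a t + a' t) t + dh 0 (\<lambda>t. b t + b' t) t)"
      by (simp add: a b dv_add dh_add add_ac)
  qed (use a b M_add in auto)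
qed

lemma vboundaries_dh: "b \<in> M 1 i \<Longrightarrow> dh 0 b \<in> vboundaries i"
  unfolding vboundaries_def by (intro CollectI bexI[of _ "\<lambda>_. 0"] bexI[of _ b]) (simp_all add: M_0)

text \<open>Each step lifts \<open>dv\<close> of the last entry along \<open>dh\<close>. The lift
  exists since this element is a \<open>dh\<close>-cycle: commuting past \<open>dh\<close> produces
  two successive \<open>dv\<close>.\<close>

lemma zigzag_exists:
  assumes x: "x \<in> vcycles i"
  shows "\<exists>y\<in>hcycles i. zigzag i x y"
proof -
  have "\<exists>c. c 0 = x \<and> (\<forall>p\<le>k. c p \<in> M p (i - p)) \<and> (\<forall>p<k. dv (i - Suc p) (c p) = dh p (c (Suc p)))" if "k \<le> i" for k
    using that
  proof (induction k)
    case 0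
    show ?case by (rule exI[of _ "\<lambda>_. x"]) (use x in \<open>simp add: vcycles_def\<close>)
  next
    case (Suc k)
    then obtain c where c: "c 0 = x" "\<And>p. p \<le> k \<Longrightarrow> c p \<in> M p (i - p)"
      "\<And>p. p < k \<Longrightarrow> dv (i - Suc p) (c p) = dh p (c (Suc p))" by auto
    have ik: "i - k = Suc (i - Suc k)" using Suc.prems by simp
    have "\<exists>e\<in>M (Suc k) (i - Suc k). dh k e = dv (i - Suc k) (c k)"
    proof (cases k)
      case 0
      then have "dv (i - 1) x \<in> dh 0 ` M 1 (i - 1)" using x Suc.prems by (simp add: vcycles_def)
      then show ?thesis using 0 c(1) by auto
    next
      case (Suc l)
      have il: "i - l = Suc (Suc (i - Suc k))" using Suc ik \<open>Suc k \<le> i\<close> by simp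
      have ck: "c k \<in> M (Suc l) (Suc (i - Suc k))" using c(2)[of k] ik Suc by simp
      have "dh l (dv (i - Suc k) (c k)) = dv (i - Suc k) (dh l (c k))" by (rule comm[OF ck])
      also have "dh l (c k) = dv (Suc (i - Suc k)) (c l)" using c(3)[of l] Suc ik by simp
      also have "dv (i - Suc k) \<dots> = (\<lambda>_. 0)" by (rule dv_dv[of _ l]) (use c(2)[of l] Suc il in simp)
      finally have "dh l (dv (i - Suc k) (c k)) = (\<lambda>_. 0)" .
      then show ?thesis using dh_exact[of "dv (i - Suc k) (c k)" l "i - Suc k"] dv_M[OF ck] Suc by blast
    qed
    then obtain e where e: "e \<in> M (Suc k) (i - Suc k)" "dh k e = dv (i - Suc k) (c k)" by blast
    show ?case
      by (rule exI[of _ "c(Suc k := e)"]) (use c e in \<open>auto simp: le_Suc_eq less_Suc_eq\<close>)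
  qed
  from this[of i] obtain c where c: "c 0 = x" "\<And>p. p \<le> i \<Longrightarrow> c p \<in> M p (i - p)"
    "\<And>p. p < i \<Longrightarrow> dv (i - Suc p) (c p) = dh p (c (Suc p))" by auto
  have "c i \<in> hcycles i" unfolding hcycles_def
  proof (intro CollectI conjI impI)
    show "c i \<in> M i 0" using c(2)[of i] by simp
    assume i: "i > 0"
    then have "dh (i - 1) (c i) = dv 0 (c (i - 1))" using c(3)[of "i - 1"] by simp
    moreover have "c (i - 1) \<in> M (i - 1) 1" using c(2)[of "i - 1"] i by simp
    ultimately show "dh (i - 1) (c i) \<in> dv 0 ` M (i - 1) 1" by simp
  qed
  moreover have "zigzag i x (c i)" unfolding zigzag_def using c by blast
  ultimately show ?thesis by blast
qed

text \<open>Inductively every entry is a \<open>dv\<close>-image plus a \<open>dh\<close>-image: if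
  \<open>b\<close> is the \<open>dh\<close>-preimage used for one entry, then the next entry minus
  \<open>dv\<close> of \<open>b\<close> is a \<open>dh\<close>-cycle, hence a
  \<open>dh\<close>-image.\<close>

lemma zigzag_boundary:
  assumes z: "zigzag i x y" and x: "x \<in> vboundaries i"
  shows "y \<in> hboundaries i"
proof -
  obtain c where c: "c 0 = x" "c i = y" "\<And>p. p \<le> i \<Longrightarrow> c p \<in> M p (i - p)"
    "\<And>p. p < i \<Longrightarrow> dv (i - Suc p) (c p) = dh p (c (Suc p))" using z unfolding zigzag_def by blast
  have "\<exists>a\<in>M p (Suc (i - p)). \<exists>b\<in>M (Suc p) (i - p). c p = (\<lambda>t. dv (i - p) a t + dh p b t)" if "p \<le> i" for p
    using that
  proof (induction p)
    case 0
    then show ?case using x c(1) by (auto simp: vboundaries_def)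
  next
    case (Suc p)
    then obtain a b where ab: "a \<in> M p (Suc (i - p))" "b \<in> M (Suc p) (i - p)"
      "c p = (\<lambda>t. dv (i - p) a t + dh p b t)" by auto
    have ip: "i - p = Suc (i - Suc p)" using Suc.prems by simp
    have b: "b \<in> M (Suc p) (Suc (i - Suc p))" using ab(2) ip by simp
    have "dh p (c (Suc p)) = dv (i - Suc p) (c p)" using c(4) Suc.prems by simp
    also have "\<dots> = (\<lambda>t. dv (i - Suc p) (dv (i - p) a) t + dv (i - Suc p) (dh p b) t)"
      unfolding ab(3) dv_add ..
    also have "dv (i - Suc p) (dv (i - p) a) = (\<lambda>_. 0)"
      using dv_dv[of a p "i - Suc p"] ab(1) ip by simp
    also have "dv (i - Suc p) (dh p b) = dh p (dv (i - Suc p) b)" using comm[OF b] by simp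
    finally have eq: "dh p (c (Suc p)) = dh p (dv (i - Suc p) b)" by simp
    define e where "e = (\<lambda>t. c (Suc p) t - dv (i - Suc p) b t)"
    have "e \<in> M (Suc p) (i - Suc p)"
      unfolding e_def using c(3)[OF Suc.prems] dv_M[OF b] by (rule M_diff)
    moreover have "dh p e = (\<lambda>_. 0)" unfolding e_def using eq by (simp add: fun_eq_iff dh_diff)
    ultimately obtain a' where a': "a' \<in> M (Suc (Suc p)) (i - Suc p)" "dh (Suc p) a' = e"
      using dh_exact by blast
    have "c (Suc p) = (\<lambda>t. dv (i - Suc p) b t + dh (Suc p) a' t)"
      unfolding a' e_def by (simp add: fun_eq_iff)
    then show ?case using b a'(1) by blast
  qed
  from this[of i] obtain a b where "a \<in> M i (Suc 0)" "b \<in> M (Suc i) 0" "y = (\<lambda>t. dv 0 a t + dh i b t)"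
    using c(2) by auto
  then show ?thesis unfolding hboundaries_def by (auto simp: add.commute)
qed

lemma zigzag_0: "zigzag i (\<lambda>_. 0) (\<lambda>_. 0)"
  unfolding zigzag_def by (rule exI[of _ "\<lambda>_ _. 0"]) (simp add: M_0)

lemma zigzag_add:
  assumes "zigzag i x y" "zigzag i x' y'"
  shows "zigzag i (\<lambda>t. x t + x' t) (\<lambda>t. y t + y' t)"
proof -
  obtain c where c: "c 0 = x" "c i = y" "\<forall>p\<le>i. c p \<in> M p (i - p)"
    "\<forall>p<i. dv (i - Suc p) (c p) = dh p (c (Suc p))" using assms(1) unfolding zigzag_def by blast
  obtain c' where c': "c' 0 = x'" "c' i = y'" "\<forall>p\<le>i. c' p \<in> M p (i - p)"
    "\<forall>p<i. dv (i - Suc p) (c' p) = dh p (c' (Suc p))" using assms(2) unfolding zigzag_def by blast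
  show ?thesis unfolding zigzag_def
    by (rule exI[of _ "\<lambda>p t. c p t + c' p t"]) (use c c' in \<open>simp add: M_add dv_add dh_add\<close>)
qed

lemma zigzag_scale:
  assumes z: "zigzag i x y"
    and M: "\<And>p q x. x \<in> M p q \<Longrightarrow> (\<lambda>t. s (x t)) \<in> M p q"
    and h: "\<And>p x. dh p (\<lambda>t. s (x t)) = (\<lambda>t. s (dh p x t))"
    and v: "\<And>p x. dv p (\<lambda>t. s (x t)) = (\<lambda>t. s (dv p x t))"
  shows "zigzag i (\<lambda>t. s (x t)) (\<lambda>t. s (y t))"
proof -
  obtain c where c: "c 0 = x" "c i = y" "\<forall>p\<le>i. c p \<in> M p (i - p)"
    "\<forall>p<i. dv (i - Suc p) (c p) = dh p (c (Suc p))" using z unfolding zigzag_def by blast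
  show ?thesis unfolding zigzag_def
    by (rule exI[of _ "\<lambda>p t. s (c p t)"]) (use c in \<open>simp add: M h v\<close>)
qed

end

text \<open>The axioms are symmetric in the two directions, so the converse halves of the comparison
  come from the transposed complex.\<close>

lemma exact_double_complex_transpose:
  assumes "exact_double_complex M dh dv"
  shows "exact_double_complex (\<lambda>p q. M q p) dv dh"
proof -
  interpret exact_double_complex M dh dv by (rule assms)
  show ?thesis
    by unfold_locales
      (simp_all add: M_0 M_add M_minus dh_M dv_M dh_add dv_add comm dh_dh dv_dv dh_exact dv_exact)
qed

context exact_double_complex
begin

interpretation T: exact_double_complex "\<lambda>p q. M q p" dv dh
  by (rule exact_double_complex_transpose) unfold_locales

lemma transpose_eqs:
  "T.vcycles = hcycles" "T.hcycles = vcycles" "T.vboundaries = hboundaries" "T.hboundaries = vboundaries"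
  unfolding T.vcycles_def hcycles_def T.hcycles_def vcycles_def T.vboundaries_def hboundaries_def
    T.hboundaries_def vboundaries_def by (rule refl)+

lemma transpose_zigzag: "T.zigzag i y x \<Longrightarrow> zigzag i x y"
proof -
  assume "T.zigzag i y x"
  then obtain c where c: "c 0 = y" "c i = x" "\<And>p. p \<le> i \<Longrightarrow> c p \<in> M (i - p) p"
    "\<And>p. p < i \<Longrightarrow> dh (i - Suc p) (c p) = dv p (c (Suc p))" unfolding T.zigzag_def by blast
  have "dv (i - Suc p) (c (i - p)) = dh p (c (i - Suc p))" if "p < i" for p
  proof -
    have "i - (Suc (i - Suc p)) = p" "Suc (i - Suc p) = i - p" using that by auto
    then show ?thesis using c(4)[of "i - Suc p"] that by simp
  qed
  moreover have "c (i - p) \<in> M p (i - p)" if "p \<le> i" for p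
    using c(3)[of "i - p"] that by simp
  ultimately show "zigzag i x y" unfolding zigzag_def using c(1,2) by (intro exI[of _ "\<lambda>p. c (i - p)"]) simp
qed

lemma zigzag_transpose: "zigzag i x y \<Longrightarrow> T.zigzag i y x"
proof -
  assume "zigzag i x y"
  then obtain c where c: "c 0 = x" "c i = y" "\<And>p. p \<le> i \<Longrightarrow> c p \<in> M p (i - p)"
    "\<And>p. p < i \<Longrightarrow> dv (i - Suc p) (c p) = dh p (c (Suc p))" unfolding zigzag_def by blast
  have "dh (i - Suc p) (c (i - p)) = dv p (c (i - Suc p))" if "p < i" for p
  proof -
    have "i - (Suc (i - Suc p)) = p" "Suc (i - Suc p) = i - p" using that by auto
    then show ?thesis using c(4)[of "i - Suc p"] that by simp
  qed
  moreover have "c (i - p) \<in> M (i - p) p" if "p \<le> i" for p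
    using c(3)[of "i - p"] that by simp
  ultimately show "T.zigzag i y x" unfolding T.zigzag_def using c(1,2) by (intro exI[of _ "\<lambda>p. c (i - p)"]) simp
qed

lemma zigzag_exists':
  assumes "y \<in> hcycles i"
  shows "\<exists>x\<in>vcycles i. zigzag i x y"
  using T.zigzag_exists[unfolded transpose_eqs, OF assms] transpose_zigzag by blast

lemma zigzag_boundary':
  assumes "zigzag i x y" "y \<in> hboundaries i"
  shows "x \<in> vboundaries i"
  using T.zigzag_boundary[unfolded transpose_eqs, OF zigzag_transpose[OF assms(1)] assms(2)] .

end

section \<open>Homogeneous components\<close>

lemma homogeneous_lookup: "homogeneous t p \<longleftrightarrow> (\<forall>m. Poly_Mapping.lookup p m \<noteq> 0 \<longrightarrow> int (mdeg m) = t)"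
  by (auto simp: homogeneous_iff in_keys_iff)

text \<open>The degree is an integer because shifted degrees can be negative; the part is then
  zero.\<close>

definition hpart :: "int \<Rightarrow> ('v::finite, 'k::field) mpoly \<Rightarrow> ('v, 'k) mpoly" where
  "hpart t p = Abs_poly_mapping (\<lambda>m. if int (mdeg m) = t then Poly_Mapping.lookup p m else 0)"

lemma lookup_hpart: "Poly_Mapping.lookup (hpart t p) m = (if int (mdeg m) = t then Poly_Mapping.lookup p m else 0)"
proof -
  have "finite {m. (if int (mdeg m) = t then Poly_Mapping.lookup p m else 0) \<noteq> 0}"
    by (rule finite_subset[OF _ finite_keys[of p]]) (auto simp: in_keys_iff)
  then show ?thesis by (simp add: hpart_def)
qed

lemma homogeneous_hpart [simp]: "homogeneous t (hpart t p)"
  by (simp add: homogeneous_lookup lookup_hpart)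

lemma homogeneous_0 [simp]: "homogeneous t 0"
  by (simp add: homogeneous_lookup)

lemma homogeneous_add: "homogeneous t p \<Longrightarrow> homogeneous t q \<Longrightarrow> homogeneous t (p + q)"
  unfolding homogeneous_lookup lookup_add by (metis add.right_neutral)

lemma homogeneous_minus: "homogeneous t p \<Longrightarrow> homogeneous t (- p)"
  by (simp add: homogeneous_lookup)

lemma homogeneous_sum: "(\<And>i. i \<in> A \<Longrightarrow> homogeneous t (f i)) \<Longrightarrow> homogeneous t (sum f A)"
  by (induction A rule: infinite_finite_induct) (auto intro: homogeneous_add)

lemma homogeneous_mult:
  assumes "homogeneous s p" "homogeneous t q"
  shows "homogeneous (s + t) (p * q)"
  unfolding homogeneous_iff
proof
  fix m assume "m \<in> Poly_Mapping.keys (p * q)"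
  then obtain a b where "a \<in> Poly_Mapping.keys p" "b \<in> Poly_Mapping.keys q" "m = a + b"
    using keys_mult[of p q] by blast
  then show "int (mdeg m) = s + t" using assms by (simp add: homogeneous_iff mdeg_add)
qed

lemma homogeneous_pvar: "homogeneous 1 (pvar (v :: 'a::finite) :: ('a, 'b::field) mpoly)"
proof -
  have "(pvar v :: ('a, 'b) mpoly) = Poly_Mapping.single (mind {v}) 1" by (simp add: pvar_def mind_def)
  moreover have "homogeneous 1 (Poly_Mapping.single (mind {v}) 1 :: ('a, 'b) mpoly)"
    unfolding homogeneous_lookup lookup_single when_def by auto
  ultimately show ?thesis by simp
qed

lemma hpart_add: "hpart t (p + q) = hpart t p + hpart t q"
  by (rule poly_mapping_eqI) (simp add: lookup_hpart lookup_add)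

lemma hpart_diff: "hpart t (p - q) = hpart t p - hpart t q"
  by (rule poly_mapping_eqI) (simp add: lookup_hpart lookup_minus)

lemma hpart_0 [simp]: "hpart t 0 = 0"
  by (rule poly_mapping_eqI) (simp add: lookup_hpart)

lemma hpart_sum: "hpart t (sum f A) = (\<Sum>i\<in>A. hpart t (f i))"
  by (induction A rule: infinite_finite_induct) (simp_all add: hpart_add)

lemma hpart_homogeneous: "homogeneous t p \<Longrightarrow> hpart t p = p"
  by (rule poly_mapping_eqI) (auto simp: lookup_hpart homogeneous_lookup)

lemma hpart_mult:
  assumes "homogeneous s q"
  shows "hpart (s + t) (q * p) = q * hpart t p"
proof -
  define p' where "p' = p - hpart t p"
  have "hpart (s + t) (q * p') = 0"
  proof (rule poly_mapping_eqI, rule ccontr)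
    fix m assume "Poly_Mapping.lookup (hpart (s + t) (q * p')) m \<noteq> Poly_Mapping.lookup 0 m"
    then have m: "int (mdeg m) = s + t" "m \<in> Poly_Mapping.keys (q * p')"
      by (auto simp: lookup_hpart in_keys_iff split: if_splits)
    then obtain a b where ab: "a \<in> Poly_Mapping.keys q" "b \<in> Poly_Mapping.keys p'" "m = a + b"
      using keys_mult[of q p'] by blast
    have "int (mdeg a) = s" using ab(1) assms by (simp add: homogeneous_iff)
    then have "int (mdeg b) = t" using m(1) ab(3) by (simp add: mdeg_add)
    then show False using ab(2) by (simp add: p'_def in_keys_iff lookup_minus lookup_hpart)
  qed
  moreover have "q * p = q * hpart t p + q * p'" by (simp add: p'_def algebra_simps)
  moreover have "hpart (s + t) (q * hpart t p) = q * hpart t p"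
    by (intro hpart_homogeneous homogeneous_mult assms homogeneous_hpart)
  ultimately show ?thesis by (simp add: hpart_add)
qed

lemma hpart_mult': "homogeneous s q \<Longrightarrow> hpart u (q * p) = q * hpart (u - s) p"
  using hpart_mult[of s q "u - s" p] by simp

lemma hpart_face_ideal: "p \<in> face_ideal \<Delta> \<Longrightarrow> hpart t p \<in> face_ideal \<Delta>"
  by (rule face_idealI) (simp add: lookup_hpart face_idealD)

lemma lookup_times_0: "Poly_Mapping.lookup (p * q) 0 = Poly_Mapping.lookup p 0 * Poly_Mapping.lookup q 0"
  for p q :: "('v::finite, 'k::field) mpoly"
proof -
  define p' where "p' = p - Poly_Mapping.single 0 (Poly_Mapping.lookup p 0)"
  have "Poly_Mapping.lookup (p' * q) 0 = 0"
  proof (rule ccontr)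
    assume "Poly_Mapping.lookup (p' * q) 0 \<noteq> 0"
    then have "0 \<in> Poly_Mapping.keys (p' * q)" by (simp add: in_keys_iff)
    then obtain a b where ab: "a \<in> Poly_Mapping.keys p'" "b \<in> Poly_Mapping.keys q" "0 = a + b"
      using keys_mult[of p' q] by blast
    have "a = 0"
    proof (rule poly_mapping_eqI)
      fix v
      have "Poly_Mapping.lookup (a + b) v = Poly_Mapping.lookup 0 v" by (simp only: ab(3))
      then show "Poly_Mapping.lookup a v = Poly_Mapping.lookup 0 v" by (simp add: lookup_add)
    qed
    then show False using ab(1) by (simp add: p'_def in_keys_iff lookup_minus)
  qed
  moreover have "Poly_Mapping.lookup (Poly_Mapping.single 0 (Poly_Mapping.lookup p 0) * q) 0 =
      Poly_Mapping.lookup p 0 * Poly_Mapping.lookup q 0"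
    using lookup_single_times[of 0 "Poly_Mapping.lookup p 0" q 0] by simp
  moreover have "p * q = Poly_Mapping.single 0 (Poly_Mapping.lookup p 0) * q + p' * q"
    by (simp add: p'_def algebra_simps)
  ultimately show ?thesis by (simp add: lookup_add)
qed

lemma vector_space_scalar: "vector_space (\<lambda>(a::'k::field) p :: ('v, 'k) mpoly. Poly_Mapping.single 0 a * p)"
proof
  fix a b :: 'k and p q :: "('v, 'k) mpoly"
  show "Poly_Mapping.single 0 a * (p + q) = Poly_Mapping.single 0 a * p + Poly_Mapping.single 0 a * q"
    by (rule distrib_left)
  show "Poly_Mapping.single 0 (a + b) * p = Poly_Mapping.single 0 a * p + Poly_Mapping.single 0 b * p"
    by (simp only: single_add distrib_right)
  show "Poly_Mapping.single 0 a * (Poly_Mapping.single 0 b * p) = Poly_Mapping.single 0 (a * b) * p"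
    by (simp add: mult_single flip: mult.assoc)
qed simp

lemma vector_space_mult: "vector_space ((*) :: 'k::field \<Rightarrow> 'k \<Rightarrow> 'k)"
  by unfold_locales (simp_all add: algebra_simps)

abbreviation degree_slice :: "int \<Rightarrow> ('v::finite \<Rightarrow>\<^sub>0 nat) set" where
  "degree_slice t \<equiv> {a. int (mdeg a) = t}"

lemma kpiece_degree_iff:
  "z \<in> kpiece (degree_slice t) i \<longleftrightarrow> (\<forall>F. z F \<noteq> 0 \<longrightarrow> card F = i \<and> homogeneous (t - int i) (z F))"
proof
  assume z: "z \<in> kpiece (degree_slice t) i"
  show "\<forall>F. z F \<noteq> 0 \<longrightarrow> card F = i \<and> homogeneous (t - int i) (z F)"
  proof (intro allI impI)
    fix F assume "z F \<noteq> 0"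
    then obtain m where "m \<in> Poly_Mapping.keys (z F)" by (metis ex_in_conv keys_eq_empty)
    then have c: "card F = i" using z by (auto simp: kpiece_def)
    show "card F = i \<and> homogeneous (t - int i) (z F)"
      unfolding homogeneous_iff
    proof (intro conjI ballI c)
      fix m assume "m \<in> Poly_Mapping.keys (z F)"
      then have "m + mind F \<in> degree_slice t" using z unfolding kpiece_def by blast
      then show "int (mdeg m) = t - int i" using c by (simp add: mdeg_add)
    qed
  qed
next
  assume *: "\<forall>F. z F \<noteq> 0 \<longrightarrow> card F = i \<and> homogeneous (t - int i) (z F)"
  show "z \<in> kpiece (degree_slice t) i"
    unfolding kpiece_def
  proof (intro CollectI allI ballI)
    fix F m assume m: "m \<in> Poly_Mapping.keys (z F)"
    then have "z F \<noteq> 0" by auto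
    then have "card F = i" "homogeneous (t - int i) (z F)" using * by auto
    then show "card F = i \<and> m + mind F \<in> degree_slice t" using m by (simp add: homogeneous_iff mdeg_add)
  qed
qed

lemma kpieceD:
  assumes "z \<in> kpiece (degree_slice t) i"
  shows "z F \<noteq> 0 \<Longrightarrow> card F = i" "homogeneous (t - int i) (z F)"
  using assms unfolding kpiece_degree_iff by (cases "z F = 0"; simp)+

lemma homogeneous_ksign_times: "homogeneous t p \<Longrightarrow> homogeneous t (ksign v F * p)"
  by (simp add: homogeneous_lookup lookup_ksign_times)

lemma kd_kpiece:
  assumes "z \<in> kpiece (degree_slice t) (Suc i)"
  shows "kd z \<in> kpiece (degree_slice t) i"
  unfolding kpiece_degree_iff
proof (intro allI impI conjI)
  fix F assume "kd z F \<noteq> 0"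
  then obtain v where "v \<in> UNIV - F" "z (insert v F) \<noteq> 0"
    unfolding kdiff_def by (metis (lifting) mult_zero_right sum.neutral)
  then show "card F = i" using kpieceD(1)[OF assms, of "insert v F"] by simp
next
  fix F
  have "homogeneous (1 + (t - int (Suc i))) (pvar v * z (insert v F))" for v
    by (intro homogeneous_mult homogeneous_pvar kpieceD[OF assms])
  then show "homogeneous (t - int i) (kd z F)"
    unfolding kdiff_def mult.assoc by (intro homogeneous_sum homogeneous_ksign_times) simp
qed

text \<open>The Koszul complex of the polynomial ring resolves \<open>k\<close>. Multidegree 0 in
  homological degree 0 is the only strand with homology; it is left out of \<open>A\<close>, and
  \<open>const\<close> says that \<open>z\<close> has no component there.\<close>

lemma kd_lift:
  fixes z :: "'v::{finite,linorder} set \<Rightarrow> ('v, 'k::field) mpoly"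
  assumes z: "z \<in> kpiece (degree_slice t) i"
    and cyc: "i > 0 \<Longrightarrow> \<forall>F. kd z F = 0" and const: "i = 0 \<Longrightarrow> Poly_Mapping.lookup (z {}) 0 = 0"
  shows "\<exists>w\<in>kpiece (degree_slice t) (Suc i). kd w = z"
proof -
  define A :: "('v \<Rightarrow>\<^sub>0 nat) set" where "A = {a \<in> degree_slice t. a \<noteq> 0 \<or> i > 0}"
  have "multidegree_exact TYPE('k) UNIV a i" if "a \<in> A" for a :: "'v \<Rightarrow>\<^sub>0 nat"
  proof (cases "a = 0")
    case True
    then have i: "i > 0" using that by (simp add: A_def)
    show ?thesis unfolding True by (rule multidegree_exact_0[OF i])
  qed (rule multidegree_exact_full)
  moreover have "z \<in> kpiece A i"
  proof (rule kpiece_mcompI)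
    fix a F assume a: "mcomp a z F \<noteq> 0"
    note F = mcomp_kpiece[OF z a]
    have "\<not> (a = 0 \<and> i = 0)" using F const a by (auto simp: mcomp_def)
    then show "card F = i \<and> a \<in> A" using F by (auto simp: A_def)
  qed
  moreover have "kd z F \<in> face_ideal UNIV" for F
  proof (cases "i = 0")
    case True
    then have "z (insert v F) = 0" for v using kpieceD(1)[OF z, of "insert v F"] by auto
    then show ?thesis by (simp add: kdiff_def)
  qed (use cyc in simp)
  ultimately obtain w where w: "w \<in> kpiece A (Suc i)" "\<forall>F. z F - kd w F \<in> face_ideal UNIV"
    using koszul_exact[of A UNIV i z] by blast
  have "kd w = z" using w(2) by (simp add: fun_eq_iff)
  moreover have "w \<in> kpiece (degree_slice t) (Suc i)" using w(1) by (auto simp: kpiece_def A_def)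
  ultimately show ?thesis by blast
qed

lemma kd_const: "Poly_Mapping.lookup (kd z F) 0 = 0"
  by (simp add: kdiff_def lookup_sum mult.assoc lookup_ksign_times lookup_pvar_times)

section \<open>Tor is Koszul homology\<close>

definition koszul_cycles :: "('v::{finite,linorder}, 'k::field) mpoly set \<Rightarrow> nat \<Rightarrow> int \<Rightarrow> ('v set \<Rightarrow> ('v, 'k) mpoly) set" where
  "koszul_cycles I i j = {z \<in> kpiece (degree_slice j) i. \<forall>F. kd z F \<in> I}"

definition koszul_boundaries :: "('v::{finite,linorder}, 'k::field) mpoly set \<Rightarrow> nat \<Rightarrow> int \<Rightarrow> ('v set \<Rightarrow> ('v, 'k) mpoly) set" where
  "koszul_boundaries I i j = {z \<in> kpiece (degree_slice j) i. \<exists>w\<in>kpiece (degree_slice j) (Suc i). \<forall>F. z F - kd w F \<in> I}"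

locale resolved_ideal = cring_ideal I for I :: "('v::{finite,linorder}, 'k::field) mpoly set" +
  fixes r :: "nat \<Rightarrow> nat" and e :: "nat \<Rightarrow> nat \<Rightarrow> int" and \<epsilon> :: "nat \<Rightarrow> ('v, 'k) mpoly"
    and D :: "nat \<Rightarrow> nat \<Rightarrow> nat \<Rightarrow> ('v, 'k) mpoly" and j :: int
  assumes resolution: "graded_free_resolution I r e \<epsilon> D"
    and hpart_mem: "p \<in> I \<Longrightarrow> hpart t p \<in> I"
begin

text \<open>The part of internal degree \<open>j\<close> of the tensor product of the Koszul complex
  (index \<open>p\<close>) with the resolution (index \<open>q\<close>). A pair
  \<open>(F, a)\<close> names a basis element, of degree \<open>p + e q a\<close> when
  \<open>card F = p\<close>.\<close>

definition M :: "nat \<Rightarrow> nat \<Rightarrow> ('v set \<times> nat \<Rightarrow> ('v, 'k) mpoly) set" where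
  "M p q = {x. \<forall>a. (a < r q \<longrightarrow> (\<lambda>F. x (F, a)) \<in> kpiece (degree_slice (j - e q a)) p) \<and>
     (r q \<le> a \<longrightarrow> (\<forall>F. x (F, a) = 0))}"

definition dh :: "nat \<Rightarrow> ('v set \<times> nat \<Rightarrow> ('v, 'k) mpoly) \<Rightarrow> 'v set \<times> nat \<Rightarrow> ('v, 'k) mpoly" where
  "dh p x = (\<lambda>(F, a). kd (\<lambda>F. x (F, a)) F)"

definition dv :: "nat \<Rightarrow> ('v set \<times> nat \<Rightarrow> ('v, 'k) mpoly) \<Rightarrow> 'v set \<times> nat \<Rightarrow> ('v, 'k) mpoly" where
  "dv q x = (\<lambda>(F, a). mat_apply (r q) (r (Suc q)) (D q) (\<lambda>b. x (F, b)) a)"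

definition aug :: "('v set \<times> nat \<Rightarrow> ('v, 'k) mpoly) \<Rightarrow> 'v set \<Rightarrow> ('v, 'k) mpoly" where
  "aug x F = (\<Sum>a<r 0. \<epsilon> a * x (F, a))"

lemmas resolution_conds = resolution[unfolded graded_free_resolution_def]

lemma hom_\<epsilon>: "a < r 0 \<Longrightarrow> homogeneous (e 0 a) (\<epsilon> a)"
  using resolution_conds[THEN conjunct1] by simp

lemma hom_D: "a < r q \<Longrightarrow> b < r (Suc q) \<Longrightarrow> homogeneous (e (Suc q) b - e q a) (D q a b)"
  using resolution_conds[THEN conjunct2, THEN conjunct1] by simp

lemma gen: "\<exists>v\<in>free_module (r 0). p - (\<Sum>a<r 0. \<epsilon> a * v a) \<in> I"
  using resolution_conds[THEN conjunct2, THEN conjunct2, THEN conjunct1] by simp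

lemma exact_0: "mat_apply (r 0) (r 1) (D 0) ` free_module (r 1) = {v \<in> free_module (r 0). (\<Sum>a<r 0. \<epsilon> a * v a) \<in> I}"
  using resolution unfolding graded_free_resolution_def by blast

lemma exact_Suc: "mat_apply (r (Suc q)) (r (Suc (Suc q))) (D (Suc q)) ` free_module (r (Suc (Suc q)))
    = {v \<in> free_module (r (Suc q)). mat_apply (r q) (r (Suc q)) (D q) v = (\<lambda>_. 0)}"
proof -
  have "\<forall>i. mat_apply (r (i + 1)) (r (i + 2)) (D (i + 1)) ` free_module (r (i + 2))
       = {v \<in> free_module (r (i + 1)). mat_apply (r i) (r (i + 1)) (D i) v = (\<lambda>_. 0)}"
    using resolution unfolding graded_free_resolution_def by blast
  from spec[OF this, of q] show ?thesis by (simp only: Suc_eq_plus1 add.assoc one_add_one)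
qed

lemma M_col: "x \<in> M p q \<Longrightarrow> a < r q \<Longrightarrow> (\<lambda>F. x (F, a)) \<in> kpiece (degree_slice (j - e q a)) p"
  and M_out: "x \<in> M p q \<Longrightarrow> r q \<le> a \<Longrightarrow> x (F, a) = 0"
  by (auto simp: M_def)

lemma M_hom: "x \<in> M p q \<Longrightarrow> a < r q \<Longrightarrow> homogeneous (j - e q a - int p) (x (F, a))"
  using kpieceD(2)[OF M_col, of x p q a F] by simp

lemma M_card: "x \<in> M p q \<Longrightarrow> x (F, a) \<noteq> 0 \<Longrightarrow> card F = p"
  using kpieceD(1)[OF M_col, of x p q a F] M_out[of x p q a F] by (metis not_less)

lemma M_intro:
  assumes "\<And>F a. a < r q \<Longrightarrow> x (F, a) \<noteq> 0 \<Longrightarrow> card F = p"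
    "\<And>F a. a < r q \<Longrightarrow> homogeneous (j - e q a - int p) (x (F, a))"
    "\<And>F a. r q \<le> a \<Longrightarrow> x (F, a) = 0"
  shows "x \<in> M p q"
  unfolding M_def kpiece_degree_iff using assms by auto

lemma M_row: "x \<in> M p q \<Longrightarrow> (\<lambda>a. x (F, a)) \<in> free_module (r q)"
  by (simp add: free_module_def M_out)

lemma M_choose:
  assumes "\<And>a. a < r q \<Longrightarrow> \<exists>w\<in>kpiece (degree_slice (j - e q a)) p. P a w"
  shows "\<exists>y\<in>M p q. \<forall>a<r q. P a (\<lambda>F. y (F, a))"
proof -
  have "\<forall>a. \<exists>w. a < r q \<longrightarrow> w \<in> kpiece (degree_slice (j - e q a)) p \<and> P a w" using assms by blast
  then obtain w where w: "\<And>a. a < r q \<Longrightarrow> w a \<in> kpiece (degree_slice (j - e q a)) p \<and> P a (w a)" by metis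
  define y where "y = (\<lambda>(F, a). if a < r q then w a F else 0)"
  have "(\<lambda>F. y (F, a)) = w a" if "a < r q" for a using that by (simp add: y_def)
  then show ?thesis using w by (intro bexI[of _ y]) (auto simp: M_def y_def)
qed

lemma dh_M: "x \<in> M (Suc p) q \<Longrightarrow> dh p x \<in> M p q"
  unfolding M_def by (auto simp: dh_def intro: kd_kpiece)

lemma hpart_row:
  assumes v: "v \<in> free_module (r (Suc q))"
  shows "mat_apply (r q) (r (Suc q)) (D q) (\<lambda>b. hpart (s - e (Suc q) b) (v b)) a =
    hpart (s - e q a) (mat_apply (r q) (r (Suc q)) (D q) v a)"
proof (cases "a < r q")
  case True
  have "hpart (s - e q a) (D q a b * v b) = D q a b * hpart (s - e (Suc q) b) (v b)" if "b < r (Suc q)" for b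
    using hpart_mult'[OF hom_D[OF True that], of "s - e q a" "v b"] by simp
  then show ?thesis using True by (simp add: mat_apply_def hpart_sum)
qed (simp add: mat_apply_def)

text \<open>\<open>graded_free_resolution\<close> states exactness for arbitrary vectors. Cutting
  each coordinate of a lift down to its proper degree keeps it a lift, because \<open>x\<close> is
  homogeneous.\<close>

lemma row_lift:
  assumes x: "x \<in> M p q" and L: "\<And>F. \<exists>v\<in>free_module (r (Suc q)). mat_apply (r q) (r (Suc q)) (D q) v = (\<lambda>a. x (F, a))"
  shows "\<exists>y\<in>M p (Suc q). dv q y = x"
proof -
  obtain v where v: "\<And>F. v F \<in> free_module (r (Suc q))" "\<And>F. mat_apply (r q) (r (Suc q)) (D q) (v F) = (\<lambda>a. x (F, a))"
    using L by metis
  define y where "y = (\<lambda>(F, b). if card F = p then hpart (j - e (Suc q) b - int p) (v F b) else 0)"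
  have "y \<in> M p (Suc q)"
    by (rule M_intro) (use v(1) in \<open>auto simp: y_def free_module_def split: if_splits\<close>)
  moreover have "dv q y = x"
  proof
    fix t show "dv q y t = x t"
    proof (cases t)
      case (Pair F a)
      show ?thesis
      proof (cases "card F = p")
        case True
        have "dv q y (F, a) = mat_apply (r q) (r (Suc q)) (D q) (\<lambda>b. hpart ((j - int p) - e (Suc q) b) (v F b)) a"
          using True by (simp add: dv_def y_def algebra_simps)
        also have "\<dots> = hpart ((j - int p) - e q a) (x (F, a))"
          unfolding hpart_row[OF v(1)] v(2) ..
        also have "\<dots> = x (F, a)"
        proof (cases "a < r q")
          case True
          then show ?thesis using M_hom[OF x True, of F] by (intro hpart_homogeneous) (simp add: algebra_simps)
        qed (simp add: M_out[OF x])
        finally show ?thesis by (simp add: Pair)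
      next
        case False
        then have "x (F, a) = 0" using M_card[OF x] by blast
        then show ?thesis using False by (simp add: Pair dv_def y_def mat_apply_def)
      qed
    qed
  qed
  ultimately show ?thesis by blast
qed

lemma dv_M:
  assumes x: "x \<in> M p (Suc q)"
  shows "dv q x \<in> M p q"
proof (rule M_intro)
  fix F a assume a: "a < r q"
  show "card F = p" if "dv q x (F, a) \<noteq> 0"
  proof -
    have "\<exists>b. x (F, b) \<noteq> 0"
    proof (rule ccontr)
      assume "\<nexists>b. x (F, b) \<noteq> 0"
      then have "dv q x (F, a) = 0" by (simp add: dv_def mat_apply_def)
      then show False using that by simp
    qed
    then show ?thesis using M_card[OF x] by blast
  qed
  have "homogeneous (j - e q a - int p) (D q a b * x (F, b))" if "b < r (Suc q)" for b
  proof -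
    have "j - e q a - int p = e (Suc q) b - e q a + (j - e (Suc q) b - int p)" by simp
    then show ?thesis using homogeneous_mult[OF hom_D[OF a that] M_hom[OF x that, of F]] by metis
  qed
  then have "homogeneous (j - e q a - int p) (\<Sum>b<r (Suc q). D q a b * x (F, b))"
    by (intro homogeneous_sum) simp
  then show "homogeneous (j - e q a - int p) (dv q x (F, a))"
    using a by (simp add: dv_def mat_apply_def)
qed (simp add: dv_def mat_apply_def)

lemma mat_apply_kd:
  "mat_apply (r q) (r (Suc q)) (D q) (\<lambda>b. kd (\<lambda>F. x (F, b)) F) a = kd (\<lambda>F. mat_apply (r q) (r (Suc q)) (D q) (\<lambda>b. x (F, b)) a) F"
proof (cases "a < r q")
  case True
  have "kd (\<lambda>F. mat_apply (r q) (r (Suc q)) (D q) (\<lambda>b. x (F, b)) a) F = kd (\<lambda>F. \<Sum>b<r (Suc q). D q a b * x (F, b)) F"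
    using True by (simp add: mat_apply_def)
  also have "\<dots> = (\<Sum>b<r (Suc q). D q a b * kd (\<lambda>F. x (F, b)) F)"
    by (simp add: kdiff_sum kdiff_mult)
  finally show ?thesis using True by (simp add: mat_apply_def)
qed (simp add: mat_apply_def)

lemma aug_kd: "aug (dh p x) F = kd (aug x) F"
proof -
  have "aug x = (\<lambda>F. \<Sum>a<r 0. \<epsilon> a * x (F, a))" by (simp add: aug_def fun_eq_iff)
  then show ?thesis by (simp add: aug_def dh_def kdiff_sum kdiff_mult)
qed

text \<open>In the \<open>dh\<close> direction there are shifted copies of the Koszul complex, exact
  by \<open>kd_lift\<close>; in the \<open>dv\<close> direction copies of the resolution, exact by
  \<open>row_lift\<close>.\<close>

sublocale exact_double_complex M dh dv
proof
  fix p q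
  show "(\<lambda>_. 0) \<in> M p q" by (simp add: M_def kpiece_def)
  fix x y assume x: "x \<in> M p q"
  show "(\<lambda>t. - x t) \<in> M p q"
    by (rule M_intro) (use x in \<open>auto intro: homogeneous_minus M_hom M_card simp: M_out\<close>)
  assume y: "y \<in> M p q"
  show "(\<lambda>t. x t + y t) \<in> M p q"
  proof (rule M_intro)
    fix F a
    show "card F = p" if "x (F, a) + y (F, a) \<noteq> 0"
      using that M_card[OF x, of F a] M_card[OF y, of F a] by fastforce
    show "homogeneous (j - e q a - int p) (x (F, a) + y (F, a))" if "a < r q"
      using that by (intro homogeneous_add M_hom x y)
    show "x (F, a) + y (F, a) = 0" if "r q \<le> a" using that by (simp add: M_out[OF x] M_out[OF y])
  qed
next
  fix p q x assume "x \<in> M (Suc p) q" then show "dh p x \<in> M p q" by (rule dh_M)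
next
  fix p q x assume "x \<in> M p (Suc q)" then show "dv q x \<in> M p q" by (rule dv_M)
next
  fix p x y show "dh p (\<lambda>t. x t + y t) = (\<lambda>t. dh p x t + dh p y t)"
    by (simp add: dh_def kdiff_add fun_eq_iff)
next
  fix q x y show "dv q (\<lambda>t. x t + y t) = (\<lambda>t. dv q x t + dv q y t)"
    by (simp add: dv_def mat_apply_def fun_eq_iff distrib_left sum.distrib)
next
  fix x p q show "dh p (dv q x) = dv q (dh p x)"
    by (simp add: dh_def dv_def fun_eq_iff mat_apply_kd)
next
  fix x p q show "dh p (dh (Suc p) x) = (\<lambda>_. 0)"
  proof
    fix t :: "'v set \<times> nat" show "dh p (dh (Suc p) x) t = 0"
    proof (cases t)
      case (Pair F a)
      have "(\<lambda>F. dh (Suc p) x (F, a)) = kd (\<lambda>F. x (F, a))" by (simp add: dh_def fun_eq_iff)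
      then show ?thesis using kdiff_kdiff[of UNIV "\<lambda>F. x (F, a)" pvar F] by (simp add: Pair dh_def kchains_def)
    qed
  qed
next
  fix x p q assume x: "x \<in> M p (Suc (Suc q))"
  show "dv q (dv (Suc q) x) = (\<lambda>_. 0)"
  proof
    fix t show "dv q (dv (Suc q) x) t = 0"
    proof (cases t)
      case (Pair F a)
      have "mat_apply (r (Suc q)) (r (Suc (Suc q))) (D (Suc q)) (\<lambda>b. x (F, b)) \<in>
        {v \<in> free_module (r (Suc q)). mat_apply (r q) (r (Suc q)) (D q) v = (\<lambda>_. 0)}"
        unfolding exact_Suc[symmetric] using M_row[OF x] by blast
      then show ?thesis by (simp add: Pair dv_def)
    qed
  qed
next
  fix x p q assume x: "x \<in> M (Suc p) q" and d: "dh p x = (\<lambda>_. 0)"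
  have "\<exists>y\<in>M (Suc (Suc p)) q. \<forall>a<r q. kd (\<lambda>F. y (F, a)) = (\<lambda>F. x (F, a))"
  proof (rule M_choose)
    fix a assume a: "a < r q"
    have "kd (\<lambda>F. x (F, a)) F = 0" for F using fun_cong[OF d, of "(F, a)"] by (simp add: dh_def)
    then show "\<exists>w\<in>kpiece (degree_slice (j - e q a)) (Suc (Suc p)). kd w = (\<lambda>F. x (F, a))"
      by (intro kd_lift M_col[OF x a]) auto
  qed
  then obtain y where y: "y \<in> M (Suc (Suc p)) q" "\<And>a. a < r q \<Longrightarrow> kd (\<lambda>F. y (F, a)) = (\<lambda>F. x (F, a))" by blast
  have "dh (Suc p) y (F, a) = x (F, a)" for F a
  proof (cases "a < r q")
    case True
    then show ?thesis using fun_cong[OF y(2)[OF True], of F] by (simp add: dh_def)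
  next
    case False
    then show ?thesis using M_out[OF x, of a F] M_out[OF y(1)] by (simp add: dh_def)
  qed
  then show "\<exists>y\<in>M (Suc (Suc p)) q. dh (Suc p) y = x" using y(1) by (intro bexI[of _ y]) auto
next
  fix x p q assume x: "x \<in> M p (Suc q)" and d: "dv q x = (\<lambda>_. 0)"
  show "\<exists>y\<in>M p (Suc (Suc q)). dv (Suc q) y = x"
  proof (rule row_lift[OF x])
    fix F
    have "mat_apply (r q) (r (Suc q)) (D q) (\<lambda>a. x (F, a)) = (\<lambda>_. 0)"
      using d by (simp add: dv_def fun_eq_iff)
    then have "(\<lambda>a. x (F, a)) \<in> mat_apply (r (Suc q)) (r (Suc (Suc q))) (D (Suc q)) ` free_module (r (Suc (Suc q)))"
      unfolding exact_Suc using M_row[OF x] by blast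
    then obtain v where "(\<lambda>a. x (F, a)) = mat_apply (r (Suc q)) (r (Suc (Suc q))) (D (Suc q)) v"
      "v \<in> free_module (r (Suc (Suc q)))" by (rule imageE)
    then show "\<exists>v\<in>free_module (r (Suc (Suc q))). mat_apply (r (Suc q)) (r (Suc (Suc q))) (D (Suc q)) v = (\<lambda>a. x (F, a))"
      by (intro bexI[of _ v]) simp_all
  qed
qed

end

lemma homogeneous_scalar: "homogeneous t p \<Longrightarrow> homogeneous t (Poly_Mapping.single 0 a * p)"
  using homogeneous_mult[of 0 "Poly_Mapping.single 0 a" t p]
  by (simp add: homogeneous_lookup lookup_single when_def)

lemma kd_scalar: "kd (\<lambda>F. Poly_Mapping.single 0 a * z F) F = Poly_Mapping.single 0 a * kd z F"
  by (rule kdiff_mult)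

section \<open>The two edges of the double complex: Tor and Koszul homology\<close>

context resolved_ideal
begin

text \<open>On the edge \<open>p = 0\<close> only constant terms survive modulo the Koszul
  differential. \<open>emb\<close> and \<open>cst\<close> pass between this edge and the complex
  defining \<open>tor_dim\<close>.\<close>

definition emb :: "(nat \<Rightarrow> 'k) \<Rightarrow> 'v set \<times> nat \<Rightarrow> ('v, 'k) mpoly" where
  "emb v = (\<lambda>(F, a). if F = {} then Poly_Mapping.single 0 (v a) else 0)"

definition cst :: "('v set \<times> nat \<Rightarrow> ('v, 'k) mpoly) \<Rightarrow> nat \<Rightarrow> 'k" where
  "cst x a = Poly_Mapping.lookup (x ({}, a)) 0"

definition tor_cycles :: "nat \<Rightarrow> (nat \<Rightarrow> 'k) set" where
  "tor_cycles i = {v \<in> tensor_chains r e i j.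
     i > 0 \<longrightarrow> mat_apply (r (i - 1)) (r i) (reduced_mat (D (i - 1))) v = (\<lambda>_. 0)}"

definition tor_boundaries :: "nat \<Rightarrow> (nat \<Rightarrow> 'k) set" where
  "tor_boundaries i = mat_apply (r i) (r (i + 1)) (reduced_mat (D i)) ` tensor_chains r e (i + 1) j"

lemma cst_emb [simp]: "cst (emb v) = v"
  by (simp add: cst_def emb_def fun_eq_iff)

lemma cst_diff: "cst (\<lambda>t. x t - y t) a = cst x a - cst y a"
  by (simp add: cst_def lookup_minus)

lemma cst_add: "cst (\<lambda>t. x t + y t) a = cst x a + cst y a"
  by (simp add: cst_def lookup_add)

lemma cst_dh [simp]: "cst (dh p x) a = 0"
  by (simp add: cst_def dh_def kd_const)

lemma cst_dv: "cst (dv q x) = mat_apply (r q) (r (Suc q)) (reduced_mat (D q)) (cst x)"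
  by (simp add: fun_eq_iff cst_def dv_def mat_apply_def reduced_mat_def lookup_sum lookup_times_0)

lemma emb_M:
  assumes "v \<in> tensor_chains r e i j"
  shows "emb v \<in> M 0 i"
proof (rule M_intro)
  fix F a
  show "card F = 0" if "emb v (F, a) \<noteq> 0" using that by (auto simp: emb_def split: if_splits)
  show "homogeneous (j - e i a - int 0) (emb v (F, a))"
    using assms by (auto simp: emb_def tensor_chains_def homogeneous_lookup lookup_single when_def)
  show "emb v (F, a) = 0" if "r i \<le> a"
  proof -
    have "v a = 0" using that assms unfolding tensor_chains_def by (metis (mono_tags, lifting) mem_Collect_eq not_less)
    then show ?thesis by (simp add: emb_def)
  qed
qed

lemma cst_tensor:
  assumes x: "x \<in> M 0 i"
  shows "cst x \<in> tensor_chains r e i j"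
  unfolding tensor_chains_def
proof (intro CollectI allI impI)
  fix a assume a: "cst x a \<noteq> 0"
  then have ar: "a < r i" using M_out[OF x, of a "{}"] by (cases "a < r i") (simp_all add: cst_def)
  have "int (mdeg (0 :: 'v \<Rightarrow>\<^sub>0 nat)) = j - e i a - int 0"
    using M_hom[OF x ar, of "{}"] a unfolding homogeneous_lookup cst_def by blast
  then show "a < r i \<and> e i a = j" using ar by simp
qed

lemma M_const:
  assumes x: "x \<in> M 0 q" and c: "\<And>a. cst x a = 0"
  shows "\<exists>b\<in>M 1 q. dh 0 b = x"
proof -
  have "\<exists>y\<in>M (Suc 0) q. \<forall>a<r q. kd (\<lambda>F. y (F, a)) = (\<lambda>F. x (F, a))"
  proof (rule M_choose)
    fix a assume a: "a < r q"
    show "\<exists>w\<in>kpiece (degree_slice (j - e q a)) (Suc 0). kd w = (\<lambda>F. x (F, a))"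
      by (rule kd_lift[OF M_col[OF x a]]) (use c[of a] in \<open>simp_all add: cst_def\<close>)
  qed
  then obtain y where y: "y \<in> M (Suc 0) q" "\<And>a. a < r q \<Longrightarrow> kd (\<lambda>F. y (F, a)) = (\<lambda>F. x (F, a))" by blast
  have "dh 0 y (F, a) = x (F, a)" for F a
  proof (cases "a < r q")
    case True
    then show ?thesis using fun_cong[OF y(2)[OF True], of F] by (simp add: dh_def)
  next
    case False
    then show ?thesis using M_out[OF x, of a F] M_out[OF y(1)] by (simp add: dh_def)
  qed
  then have "dh 0 y = x" by (simp add: fun_eq_iff)
  then show ?thesis using y(1) by auto
qed

lemma emb_cycle:
  assumes v: "v \<in> tor_cycles i"
  shows "emb v \<in> vcycles i"
  unfolding vcycles_def
proof (intro CollectI conjI impI)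
  have vt: "v \<in> tensor_chains r e i j" using v by (simp add: tor_cycles_def)
  then show E: "emb v \<in> M 0 i" by (rule emb_M)
  assume i: "i > 0"
  then obtain k where k: "i = Suc k" by (cases i) auto
  have "cst (dv k (emb v)) = (\<lambda>_. 0)" using v k by (simp add: cst_dv tor_cycles_def)
  then obtain b where "b \<in> M 1 k" "dh 0 b = dv k (emb v)"
    using M_const[of "dv k (emb v)" k] dv_M[of "emb v" 0 k] E k by (auto simp: fun_eq_iff)
  then show "dv (i - 1) (emb v) \<in> dh 0 ` M 1 (i - 1)" using k by (metis diff_Suc_1 image_eqI)
qed

lemma cst_cycle:
  assumes x: "x \<in> vcycles i"
  shows "cst x \<in> tor_cycles i"
  unfolding tor_cycles_def
proof (intro CollectI conjI impI)
  have xM: "x \<in> M 0 i" using x by (simp add: vcycles_def)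
  then show "cst x \<in> tensor_chains r e i j" by (rule cst_tensor)
  assume i: "i > 0"
  then obtain k where k: "i = Suc k" by (cases i) auto
  then obtain y where "dv k x = dh 0 y" using x by (auto simp: vcycles_def)
  then have "cst (dv k x) a = 0" for a by (simp only: cst_dh)
  then have "cst (dv k x) = (\<lambda>_. 0)" by (rule ext)
  then show "mat_apply (r (i - 1)) (r i) (reduced_mat (D (i - 1))) (cst x) = (\<lambda>_. 0)"
    using k by (simp add: cst_dv)
qed

lemma split_const:
  assumes x: "x \<in> M 0 i"
  shows "\<exists>b\<in>M 1 i. \<forall>t. x t = emb (cst x) t + dh 0 b t"
proof -
  have "(\<lambda>t. x t - emb (cst x) t) \<in> M 0 i"
    by (rule M_diff[OF x emb_M[OF cst_tensor[OF x]]])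
  then obtain b where b: "b \<in> M 1 i" "dh 0 b = (\<lambda>t. x t - emb (cst x) t)"
    using M_const[of "\<lambda>t. x t - emb (cst x) t" i] by (auto simp: cst_diff)
  show ?thesis by (rule bexI[OF _ b(1)]) (simp add: b(2))
qed

lemma emb_boundary:
  assumes "v \<in> tor_boundaries i"
  shows "emb v \<in> vboundaries i"
proof -
  obtain w where w: "w \<in> tensor_chains r e (Suc i) j" "v = mat_apply (r i) (r (Suc i)) (reduced_mat (D i)) w"
    using assms by (auto simp: tor_boundaries_def)
  have a: "emb w \<in> M 0 (Suc i)" using w(1) by (rule emb_M)
  then have dM: "dv i (emb w) \<in> M 0 i" by (rule dv_M)
  have cv: "cst (dv i (emb w)) = v" by (simp add: cst_dv w(2))
  obtain b where b: "b \<in> M 1 i" "\<forall>t. dv i (emb w) t = emb v t + dh 0 b t"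
    using split_const[OF dM] cv by auto
  have nb: "(\<lambda>t. - b t) \<in> M 1 i" by (rule M_minus[OF b(1)])
  have "emb v = (\<lambda>t. dv i (emb w) t + dh 0 (\<lambda>t. - b t) t)"
    using b(2) by (simp add: fun_eq_iff dh_minus)
  then show ?thesis unfolding vboundaries_def using a nb by blast
qed

lemma emb_boundaryD:
  assumes "emb v \<in> vboundaries i"
  shows "v \<in> tor_boundaries i"
proof -
  obtain a b where ab: "a \<in> M 0 (Suc i)" "emb v = (\<lambda>t. dv i a t + dh 0 b t)"
    using assms unfolding vboundaries_def by blast
  have "cst (emb v) = cst (dv i a)" unfolding ab(2) by (simp add: fun_eq_iff cst_add)
  then have "v = mat_apply (r i) (r (Suc i)) (reduced_mat (D i)) (cst a)" by (simp add: cst_dv)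
  then show ?thesis using cst_tensor[OF ab(1)] by (auto simp: tor_boundaries_def)
qed

lemma scale_M: "x \<in> M p q \<Longrightarrow> (\<lambda>t. Poly_Mapping.single 0 c * x t) \<in> M p q"
  by (rule M_intro) (auto intro: homogeneous_scalar M_hom M_card simp: M_out)

lemma scale_dh: "dh p (\<lambda>t. Poly_Mapping.single 0 c * x t) = (\<lambda>t. Poly_Mapping.single 0 c * dh p x t)"
  by (simp add: dh_def fun_eq_iff kd_scalar)

lemma scale_dv: "dv q (\<lambda>t. Poly_Mapping.single 0 c * x t) = (\<lambda>t. Poly_Mapping.single 0 c * dv q x t)"
  by (simp add: dv_def mat_apply_def fun_eq_iff sum_distrib_left mult_ac)

lemma zigzag_scalar:
  "zigzag i x y \<Longrightarrow> zigzag i (\<lambda>t. Poly_Mapping.single 0 c * x t) (\<lambda>t. Poly_Mapping.single 0 c * y t)"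
  by (rule zigzag_scale) (simp_all add: scale_M scale_dh scale_dv)

lemma emb_0: "emb (\<lambda>_. 0) = (\<lambda>_. 0)"
  by (simp add: emb_def fun_eq_iff)

lemma emb_add: "emb (\<lambda>t. x t + y t) = (\<lambda>t. emb x t + emb y t)"
  by (simp add: emb_def fun_eq_iff single_add)

lemma emb_scale: "emb (\<lambda>t. c * x t) = (\<lambda>t. Poly_Mapping.single 0 c * emb x t)"
  by (simp add: emb_def fun_eq_iff mult_single)

abbreviation scal :: "'k \<Rightarrow> ('v, 'k) mpoly \<Rightarrow> ('v, 'k) mpoly" where
  "scal \<equiv> \<lambda>c p. Poly_Mapping.single 0 c * p"

lemma zero_hboundaries: "(\<lambda>_. 0) \<in> hboundaries i"
  unfolding hboundaries_def by (intro CollectI bexI[of _ "\<lambda>_. 0"]) (simp_all add: M_0)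

lemma tor_dim_le: "tor_dim r e D i j \<le> subquotient_dim scal (hcycles i) (hboundaries i)"
  unfolding tor_dim_def tor_cycles_def[symmetric] tor_boundaries_def[symmetric]
proof (rule subquotient_dim_le[where R = "\<lambda>v y. zigzag i (emb v) y"])
  show "vector_space scal" by (rule vector_space_scalar)
  show "\<exists>z'\<in>hcycles i. zigzag i (emb z) z'" if "z \<in> tor_cycles i" for z
    by (rule zigzag_exists[OF emb_cycle[OF that]])
  show "zigzag i (emb (\<lambda>_. 0)) (\<lambda>_. 0)" unfolding emb_0 by (rule zigzag_0)
  show "zigzag i (emb (\<lambda>t. x t + y t)) (\<lambda>t. x' t + y' t)" if "zigzag i (emb x) x'" "zigzag i (emb y) y'" for x x' y y'
    unfolding emb_add by (rule zigzag_add[OF that])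
  show "zigzag i (emb (\<lambda>t. a * x t)) (\<lambda>t. Poly_Mapping.single 0 a * x' t)" if "zigzag i (emb x) x'" for a x x'
    unfolding emb_scale by (rule zigzag_scalar[OF that])
  show "x \<in> tor_boundaries i" if "zigzag i (emb x) x'" "x' \<in> hboundaries i" for x x'
    by (rule emb_boundaryD[OF zigzag_boundary'[OF that]])
qed (rule zero_hboundaries)

lemma tor_dim_ge: "subquotient_dim scal (hcycles i) (hboundaries i) \<le> tor_dim r e D i j"
  unfolding tor_dim_def tor_cycles_def[symmetric] tor_boundaries_def[symmetric]
\<comment> \<open>The zigzag may start at an element that is not of the form \<open>emb v\<close>.
  An error in the image of \<open>dh 0\<close> is allowed, as it is a boundary on this edge.\<close>
proof (rule subquotient_dim_le[where R = "\<lambda>y v. \<exists>x. zigzag i x y \<and> (\<exists>b\<in>M 1 i. \<forall>t. x t = emb v t + dh 0 b t)"])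
  show "vector_space ((*) :: 'k \<Rightarrow> _)" by (rule vector_space_mult)
  show "\<exists>v\<in>tor_cycles i. \<exists>x. zigzag i x z \<and> (\<exists>b\<in>M 1 i. \<forall>t. x t = emb v t + dh 0 b t)" if z: "z \<in> hcycles i" for z
  proof -
    obtain x where x: "x \<in> vcycles i" "zigzag i x z" using zigzag_exists'[OF z] by blast
    then have "x \<in> M 0 i" by (simp add: vcycles_def)
    from split_const[OF this] show ?thesis using cst_cycle[OF x(1)] x(2) by blast
  qed
  show "\<exists>x. zigzag i x (\<lambda>_. 0) \<and> (\<exists>b\<in>M 1 i. \<forall>t. x t = emb (\<lambda>_. 0) t + dh 0 b t)"
    by (rule exI[of _ "\<lambda>_. 0"], intro conjI zigzag_0 bexI[of _ "\<lambda>_. 0"]) (simp_all add: emb_0 M_0)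
next
  fix y v y' v'
  assume "\<exists>x. zigzag i x y \<and> (\<exists>b\<in>M 1 i. \<forall>t. x t = emb v t + dh 0 b t)"
    "\<exists>x. zigzag i x y' \<and> (\<exists>b\<in>M 1 i. \<forall>t. x t = emb v' t + dh 0 b t)"
  then obtain x b x' b' where *: "zigzag i x y" "b \<in> M 1 i" "\<And>t. x t = emb v t + dh 0 b t"
    "zigzag i x' y'" "b' \<in> M 1 i" "\<And>t. x' t = emb v' t + dh 0 b' t" by blast
  show "\<exists>x. zigzag i x (\<lambda>t. y t + y' t) \<and> (\<exists>b\<in>M 1 i. \<forall>t. x t = emb (\<lambda>t. v t + v' t) t + dh 0 b t)"
  proof (intro exI conjI bexI)
    show "zigzag i (\<lambda>t. x t + x' t) (\<lambda>t. y t + y' t)" using *(1,4) by (rule zigzag_add)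
    show "(\<lambda>t. b t + b' t) \<in> M 1 i" using *(2,5) by (rule M_add)
    show "\<forall>t. x t + x' t = emb (\<lambda>t. v t + v' t) t + dh 0 (\<lambda>t. b t + b' t) t"
      by (simp add: *(3,6) emb_add dh_add)
  qed
next
  fix c y v
  assume "\<exists>x. zigzag i x y \<and> (\<exists>b\<in>M 1 i. \<forall>t. x t = emb v t + dh 0 b t)"
  then obtain x b where *: "zigzag i x y" "b \<in> M 1 i" "\<And>t. x t = emb v t + dh 0 b t" by blast
  show "\<exists>x. zigzag i x (\<lambda>t. scal c (y t)) \<and> (\<exists>b\<in>M 1 i. \<forall>t. x t = emb (\<lambda>t. c * v t) t + dh 0 b t)"
  proof (intro exI conjI bexI)
    show "zigzag i (\<lambda>t. scal c (x t)) (\<lambda>t. scal c (y t))" using *(1) by (rule zigzag_scalar)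
    show "(\<lambda>t. scal c (b t)) \<in> M 1 i" using *(2) by (rule scale_M)
    show "\<forall>t. scal c (x t) = emb (\<lambda>t. c * v t) t + dh 0 (\<lambda>t. scal c (b t)) t"
      by (simp add: *(3) emb_scale scale_dh distrib_left)
  qed
next
  fix y v
  assume "\<exists>x. zigzag i x y \<and> (\<exists>b\<in>M 1 i. \<forall>t. x t = emb v t + dh 0 b t)" and v: "v \<in> tor_boundaries i"
  then obtain x b where *: "zigzag i x y" "b \<in> M 1 i" "\<And>t. x t = emb v t + dh 0 b t" by blast
  have "(\<lambda>t. emb v t + dh 0 b t) \<in> vboundaries i"
    by (intro vboundaries_add emb_boundary v vboundaries_dh *(2))
  moreover have "x = (\<lambda>t. emb v t + dh 0 b t)" using *(3) by (simp add: fun_eq_iff)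
  ultimately have "x \<in> vboundaries i" by simp
  then show "y \<in> hboundaries i" by (rule zigzag_boundary[OF *(1)])
next
  have "(\<lambda>_. 0) \<in> tensor_chains r e (i + 1) j" by (simp add: tensor_chains_def)
  moreover have "mat_apply (r i) (r (i + 1)) (reduced_mat (D i)) (\<lambda>_. 0) = (\<lambda>_. 0)"
    by (simp add: mat_apply_def fun_eq_iff)
  ultimately show "(\<lambda>_. 0) \<in> tor_boundaries i" unfolding tor_boundaries_def by (metis image_eqI)
qed

lemma aug_dv:
  assumes x: "x \<in> M p 1"
  shows "aug (dv 0 x) F \<in> I"
proof -
  have "mat_apply (r 0) (r 1) (D 0) (\<lambda>b. x (F, b)) \<in> {v \<in> free_module (r 0). (\<Sum>a<r 0. \<epsilon> a * v a) \<in> I}"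
    unfolding exact_0[symmetric] using M_row[OF x] by blast
  then show ?thesis by (simp add: aug_def dv_def)
qed

lemma aug_add: "aug (\<lambda>t. x t + y t) F = aug x F + aug y F"
  by (simp add: aug_def distrib_left sum.distrib)

lemma aug_diff: "aug (\<lambda>t. x t - y t) F = aug x F - aug y F"
  by (simp add: aug_def right_diff_distrib sum_subtractf)

lemma aug_scale: "aug (\<lambda>t. scal c (x t)) F = scal c (aug x F)"
  by (simp add: aug_def sum_distrib_left mult_ac)

lemma aug_kpiece:
  assumes x: "x \<in> M i 0"
  shows "aug x \<in> kpiece (degree_slice j) i"
  unfolding kpiece_degree_iff
proof (intro allI impI conjI)
  fix F assume "aug x F \<noteq> 0"
  then obtain a where "x (F, a) \<noteq> 0" unfolding aug_def by (metis (lifting) mult_zero_right sum.neutral)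
  then show "card F = i" by (rule M_card[OF x])
next
  fix F
  have "homogeneous (j - int i) (\<epsilon> a * x (F, a))" if a: "a < r 0" for a
  proof -
    have "e 0 a + (j - e 0 a - int i) = j - int i" by simp
    then show ?thesis using homogeneous_mult[OF hom_\<epsilon>[OF a] M_hom[OF x a, of F]] by metis
  qed
  then show "homogeneous (j - int i) (aug x F)" unfolding aug_def by (intro homogeneous_sum) simp
qed

text \<open>Arbitrary preimages exist by \<open>gen\<close>; passing to homogeneous parts keeps the
  error inside \<open>I\<close> since \<open>I\<close> is a homogeneous ideal.\<close>

lemma aug_lift:
  assumes z: "z \<in> kpiece (degree_slice j) i"
  shows "\<exists>y\<in>M i 0. \<forall>F. z F - aug y F \<in> I"
proof -
  have "\<forall>F. \<exists>v. v \<in> free_module (r 0) \<and> z F - (\<Sum>a<r 0. \<epsilon> a * v a) \<in> I" using gen by blast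
  then obtain v where v: "\<And>F. v F \<in> free_module (r 0)" "\<And>F. z F - (\<Sum>a<r 0. \<epsilon> a * v F a) \<in> I" by metis
  define y where "y = (\<lambda>(F, a). if card F = i then hpart (j - e 0 a - int i) (v F a) else 0)"
  have "y \<in> M i 0"
    by (rule M_intro) (use v(1) in \<open>auto simp: y_def free_module_def split: if_splits\<close>)
  moreover have "z F - aug y F \<in> I" for F
  proof (cases "card F = i")
    case True
    have "hpart (j - int i) (\<epsilon> a * v F a) = \<epsilon> a * hpart (j - e 0 a - int i) (v F a)" if "a < r 0" for a
      using hpart_mult'[OF hom_\<epsilon>[OF that], of "j - int i" "v F a"] by (simp add: algebra_simps)
    then have "aug y F = hpart (j - int i) (\<Sum>a<r 0. \<epsilon> a * v F a)"
      using True by (simp add: aug_def y_def hpart_sum)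
    then have "z F - aug y F = hpart (j - int i) (z F - (\<Sum>a<r 0. \<epsilon> a * v F a))"
      using kpieceD(2)[OF z, of F] by (simp add: hpart_diff hpart_homogeneous)
    then show ?thesis using hpart_mem[OF v(2)] by simp
  next
    case False
    then have "z F = 0" using kpieceD(1)[OF z] by blast
    then show ?thesis using False by (simp add: aug_def y_def)
  qed
  ultimately show ?thesis by blast
qed

lemma aug_kernel:
  assumes y: "y \<in> M p 0" and a: "\<And>F. aug y F \<in> I"
  shows "y \<in> dv 0 ` M p 1"
proof -
  have "\<exists>b\<in>M p (Suc 0). dv 0 b = y"
  proof (rule row_lift[OF y])
    fix F
    have "(\<lambda>a. y (F, a)) \<in> mat_apply (r 0) (r 1) (D 0) ` free_module (r 1)"
      unfolding exact_0 using M_row[OF y] a[of F] by (simp add: aug_def)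
    then obtain v where "(\<lambda>a. y (F, a)) = mat_apply (r 0) (r 1) (D 0) v" "v \<in> free_module (r 1)" by (rule imageE)
    then show "\<exists>v\<in>free_module (r (Suc 0)). mat_apply (r 0) (r (Suc 0)) (D 0) v = (\<lambda>a. y (F, a))"
      by (intro bexI[of _ v]) simp_all
  qed
  then show ?thesis by auto
qed

lemma aug_cycle:
  assumes y: "y \<in> hcycles i"
  shows "aug y \<in> koszul_cycles I i j"
  unfolding koszul_cycles_def
proof (intro CollectI conjI allI)
  have yM: "y \<in> M i 0" using y by (simp add: hcycles_def)
  then show "aug y \<in> kpiece (degree_slice j) i" by (rule aug_kpiece)
  fix F
  show "kd (aug y) F \<in> I"
  proof (cases i)
    case 0
    have "aug y (insert v F) = 0" for v
      using kpieceD(1)[OF aug_kpiece[OF yM], of "insert v F"] 0 by auto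
    then show ?thesis by (simp add: kdiff_def)
  next
    case (Suc k)
    then obtain x where x: "x \<in> M k 1" "dh k y = dv 0 x" using y by (auto simp: hcycles_def)
    then show ?thesis using aug_dv[OF x(1)] by (simp flip: aug_kd[of k] x(2))
  qed
qed

lemma aug_boundary:
  assumes "y \<in> hboundaries i"
  shows "aug y \<in> koszul_boundaries I i j"
proof -
  obtain a b where ab: "a \<in> M (Suc i) 0" "b \<in> M i 1" "y = (\<lambda>t. dh i a t + dv 0 b t)"
    using assms unfolding hboundaries_def by blast
  have "y \<in> M i 0" unfolding ab(3) using dh_M[OF ab(1)] dv_M[of b i 0] ab(2) by (intro M_add) simp_all
  moreover have "aug y F - kd (aug a) F \<in> I" for F
    unfolding ab(3) aug_add aug_kd using aug_dv[OF ab(2)] by simp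
  ultimately show ?thesis unfolding koszul_boundaries_def using aug_kpiece ab(1) by blast
qed

lemma aug_boundaryD:
  assumes y: "y \<in> M i 0" and b: "aug y \<in> koszul_boundaries I i j"
  shows "y \<in> hboundaries i"
proof -
  obtain w where w: "w \<in> kpiece (degree_slice j) (Suc i)" "\<And>F. aug y F - kd w F \<in> I"
    using b unfolding koszul_boundaries_def by blast
  obtain a where a: "a \<in> M (Suc i) 0" "\<And>F. w F - aug a F \<in> I" using aug_lift[OF w(1)] by blast
  have "aug (\<lambda>t. y t - dh i a t) F \<in> I" for F
  proof -
    have "aug (\<lambda>t. y t - dh i a t) F = (aug y F - kd w F) + (kd w F - kd (aug a) F)"
      by (simp add: aug_diff aug_kd)
    moreover have "kd w F - kd (aug a) F \<in> I" by (rule kdiff_cong_mem) (rule a(2))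
    ultimately show ?thesis using add_mem[OF w(2)[of F], of "kd w F - kd (aug a) F"] by (simp only:)
  qed
  then have "(\<lambda>t. y t - dh i a t) \<in> dv 0 ` M i 1"
    by (intro aug_kernel M_diff y dh_M[OF a(1)])
  then obtain c where c: "c \<in> M i 1" "(\<lambda>t. y t - dh i a t) = dv 0 c" by (rule imageE) simp
  have "y = (\<lambda>t. dh i a t + dv 0 c t)" by (simp flip: c(2))
  then show ?thesis unfolding hboundaries_def using a(1) c(1) by blast
qed

lemma koszul_boundaries_cong:
  assumes "z \<in> koszul_boundaries I i j" "z' \<in> kpiece (degree_slice j) i" "\<And>F. z F - z' F \<in> I"
  shows "z' \<in> koszul_boundaries I i j"
proof -
  obtain w where w: "w \<in> kpiece (degree_slice j) (Suc i)" "\<And>F. z F - kd w F \<in> I"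
    using assms(1) unfolding koszul_boundaries_def by blast
  have "z' F - kd w F \<in> I" for F using diff_mem_trans[OF diff_mem_sym[OF assms(3)] w(2)] .
  then show ?thesis unfolding koszul_boundaries_def using w(1) assms(2) by blast
qed

lemma kpiece_add: "x \<in> kpiece (degree_slice t) i \<Longrightarrow> y \<in> kpiece (degree_slice t) i \<Longrightarrow> (\<lambda>F. x F + y F) \<in> kpiece (degree_slice t) i"
  unfolding kpiece_degree_iff by (metis add.left_neutral add.right_neutral homogeneous_add)

lemma kpiece_scal: "x \<in> kpiece (degree_slice t) i \<Longrightarrow> (\<lambda>F. scal c (x F)) \<in> kpiece (degree_slice t) i"
  unfolding kpiece_degree_iff by (metis homogeneous_scalar mult_zero_right)

text \<open>Relates an element of the edge \<open>q = 0\<close> to the Koszul chain that it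
  represents modulo \<open>I\<close>; used in both directions.\<close>

definition lifts :: "nat \<Rightarrow> ('v set \<times> nat \<Rightarrow> ('v, 'k) mpoly) \<Rightarrow> ('v set \<Rightarrow> ('v, 'k) mpoly) \<Rightarrow> bool" where
  "lifts i y z \<longleftrightarrow> y \<in> M i 0 \<and> z \<in> kpiece (degree_slice j) i \<and> (\<forall>F. z F - aug y F \<in> I)"

lemma lifts_0: "lifts i (\<lambda>_. 0) (\<lambda>_. 0)"
  by (simp add: lifts_def M_0 aug_def kpiece_def)

lemma lifts_add: "lifts i y z \<Longrightarrow> lifts i y' z' \<Longrightarrow> lifts i (\<lambda>t. y t + y' t) (\<lambda>F. z F + z' F)"
  unfolding lifts_def aug_add by (auto intro!: M_add kpiece_add simp: add_diff_add add_mem)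

lemma lifts_scal: "lifts i y z \<Longrightarrow> lifts i (\<lambda>t. scal c (y t)) (\<lambda>F. scal c (z F))"
  unfolding lifts_def aug_scale by (auto intro!: scale_M kpiece_scal mult_mem simp flip: right_diff_distrib)

lemma zero_koszul_boundaries: "(\<lambda>_. 0) \<in> koszul_boundaries I i j"
proof -
  have "(\<lambda>_. 0) \<in> kpiece (degree_slice j) k" for k by (simp add: kpiece_def)
  then show ?thesis unfolding koszul_boundaries_def by (auto intro!: bexI[of _ "\<lambda>_. 0"])
qed

lemma hdim_le: "subquotient_dim scal (hcycles i) (hboundaries i) \<le> subquotient_dim scal (koszul_cycles I i j) (koszul_boundaries I i j)"
proof (rule subquotient_dim_le[where R = "lifts i"])
  show "vector_space scal" by (rule vector_space_scalar)
  show "\<exists>z'\<in>koszul_cycles I i j. lifts i y z'" if "y \<in> hcycles i" for y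
  proof (rule bexI[OF _ aug_cycle[OF that]])
    have "y \<in> M i 0" using that by (simp add: hcycles_def)
    then show "lifts i y (aug y)" using aug_kpiece by (simp add: lifts_def)
  qed
  show "y \<in> hboundaries i" if "lifts i y z" "z \<in> koszul_boundaries I i j" for y z
  proof (rule aug_boundaryD)
    show "y \<in> M i 0" using that(1) by (simp add: lifts_def)
    then show "aug y \<in> koszul_boundaries I i j"
      using that by (intro koszul_boundaries_cong[OF that(2)] aug_kpiece) (simp_all add: lifts_def)
  qed
qed (rule lifts_0 lifts_add lifts_scal zero_koszul_boundaries; assumption?)+

lemma hdim_ge: "subquotient_dim scal (koszul_cycles I i j) (koszul_boundaries I i j) \<le> subquotient_dim scal (hcycles i) (hboundaries i)"
proof (rule subquotient_dim_le[where R = "\<lambda>z y. lifts i y z"])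
  show "vector_space scal" by (rule vector_space_scalar)
  show "\<exists>y\<in>hcycles i. lifts i y z" if z: "z \<in> koszul_cycles I i j" for z
  proof -
    have zk: "z \<in> kpiece (degree_slice j) i" "\<And>F. kd z F \<in> I" using z by (auto simp: koszul_cycles_def)
    obtain y where y: "y \<in> M i 0" "\<And>F. z F - aug y F \<in> I" using aug_lift[OF zk(1)] by blast
    have "y \<in> hcycles i" unfolding hcycles_def
    proof (intro CollectI conjI impI y(1))
      assume "i > 0"
      then obtain k where k: "i = Suc k" by (cases i) auto
      have "aug (dh k y) F \<in> I" for F
        using mem_cong[OF kdiff_cong_mem[OF y(2), where y = pvar and L = UNIV and J = F]] zk(2)[of F] by (simp add: aug_kd)
      then have "dh k y \<in> dv 0 ` M k 1" using y(1) k by (intro aug_kernel dh_M) simp_all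
      then show "dh (i - 1) y \<in> dv 0 ` M (i - 1) 1" using k by simp
    qed
    then show ?thesis using y zk by (intro bexI[of _ y]) (simp_all add: lifts_def)
  qed
  show "z \<in> koszul_boundaries I i j" if "lifts i y z" "y \<in> hboundaries i" for y z
    using koszul_boundaries_cong[OF aug_boundary[OF that(2)], of z] that(1) diff_mem_sym by (simp add: lifts_def)
qed (rule lifts_0 lifts_add lifts_scal zero_hboundaries; assumption?)+

lemma tor_dim_eq: "tor_dim r e D i j = subquotient_dim scal (koszul_cycles I i j) (koszul_boundaries I i j)"
  by (rule order.antisym[OF order.trans[OF tor_dim_le hdim_le] order.trans[OF hdim_ge tor_dim_ge]])

end

text \<open>By \<open>tor_dim_eq\<close> every resolution yields the Koszul number, which gives the
  uniqueness in the definite description; \<open>res\<close> gives existence.\<close>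

lemma betti_eq_koszul:
  fixes I :: "('v::{finite,linorder}, 'k::field) mpoly set"
  assumes "cring_ideal I" "\<And>t p. p \<in> I \<Longrightarrow> hpart t p \<in> I"
    and res: "\<exists>r e \<epsilon> D. graded_free_resolution I r e \<epsilon> D"
  shows "betti I i j = subquotient_dim (\<lambda>c p. Poly_Mapping.single 0 c * p) (koszul_cycles I i j) (koszul_boundaries I i j)"
proof -
  interpret cring_ideal I by (rule assms(1))
  have *: "tor_dim r e D i j = subquotient_dim (\<lambda>c p. Poly_Mapping.single 0 c * p) (koszul_cycles I i j) (koszul_boundaries I i j)"
    if "graded_free_resolution I r e \<epsilon> D" for r e \<epsilon> D
  proof -
    interpret resolved_ideal I r e \<epsilon> D j by unfold_locales (use that assms(2) in auto)
    show ?thesis by (rule tor_dim_eq)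
  qed
  show ?thesis unfolding betti_def
  proof (rule the_equality)
    show "\<exists>r e \<epsilon> D. graded_free_resolution I r e \<epsilon> D \<and>
      subquotient_dim (\<lambda>c p. Poly_Mapping.single 0 c * p) (koszul_cycles I i j) (koszul_boundaries I i j) = tor_dim r e D i j"
      using res * by metis
  qed (use * in auto)
qed

lemma betti_eq_0_iff:
  fixes I :: "('v::{finite,linorder}, 'k::field) mpoly set"
  assumes "cring_ideal I" "\<And>t p. p \<in> I \<Longrightarrow> hpart t p \<in> I"
    and res: "\<exists>r e \<epsilon> D. graded_free_resolution I r e \<epsilon> D"
  shows "betti I i j = 0 \<longleftrightarrow> koszul_cycles I i j \<subseteq> koszul_boundaries I i j"
proof -
  have eq: "betti I i j = subquotient_dim (\<lambda>c p. Poly_Mapping.single 0 c * p) (koszul_cycles I i j) (koszul_boundaries I i j)"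
    by (rule betti_eq_koszul[OF assms(1) _ res]) (rule assms(2))
  show ?thesis unfolding eq
proof (rule subquotient_dim_eq_0_iff[OF vector_space_scalar])
  interpret cring_ideal I by (rule assms(1))
  fix c and z :: "'v set \<Rightarrow> ('v, 'k) mpoly" assume "z \<in> koszul_boundaries I i j"
  then obtain w where z: "z \<in> kpiece (degree_slice j) i" and w: "w \<in> kpiece (degree_slice j) (Suc i)" "\<And>F. z F - kd w F \<in> I"
    unfolding koszul_boundaries_def by blast
  have sc: "(\<lambda>F. Poly_Mapping.single 0 c * x F) \<in> kpiece (degree_slice t) k" if "x \<in> kpiece (degree_slice t) k" for x :: "'v set \<Rightarrow> ('v, 'k) mpoly" and t k
    using that unfolding kpiece_degree_iff by (metis homogeneous_scalar mult_zero_right)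
  have "Poly_Mapping.single 0 c * z F - kd (\<lambda>F. Poly_Mapping.single 0 c * w F) F \<in> I" for F
    using mult_mem[OF w(2)[of F], of "Poly_Mapping.single 0 c"] by (simp add: kd_scalar right_diff_distrib)
  then show "(\<lambda>F. Poly_Mapping.single 0 c * z F) \<in> koszul_boundaries I i j"
    unfolding koszul_boundaries_def using sc[OF z] sc[OF w(1)] by blast
qed
qed

section \<open>The Taylor resolution\<close>

lemma single_times_cancel:
  fixes p :: "('v \<Rightarrow>\<^sub>0 nat) \<Rightarrow>\<^sub>0 'k::comm_ring_1"
  assumes "Poly_Mapping.single m 1 * p = 0"
  shows "p = 0"
proof (rule poly_mapping_eqI)
  fix m'
  show "Poly_Mapping.lookup p m' = Poly_Mapping.lookup 0 m'"
    using lookup_single_times[of m 1 p m'] assms by simp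
qed

text \<open>All nonfaces are taken as generators, not just the minimal ones. The resulting Taylor
  resolution is far from minimal, but it has finite rank and needs no choice of minimal
  generators.\<close>

locale taylor =
  fixes \<Delta> :: "'v::{finite,linorder} set set" and s :: nat and G :: "nat \<Rightarrow> 'v set"
    and dummy :: "'k::field itself"
  assumes down: "down_closed \<Delta>" and nonfaces: "G ` {..<s} = - \<Delta>"
begin

definition U :: "nat set \<Rightarrow> 'v set" where
  "U J = (\<Union>g\<in>J. G g)"

definition tdiff :: "(nat set \<Rightarrow> ('v, 'k) mpoly) \<Rightarrow> nat set \<Rightarrow> ('v, 'k) mpoly" where
  "tdiff z J = (\<Sum>l\<in>{..<s} - J. ksign l J * (Poly_Mapping.single (mind (U (insert l J) - U J)) 1 * z (insert l J)))"

text \<open>Multiplying the coefficient at \<open>J\<close> by the least common multiple of the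
  generators in \<open>J\<close> turns the Taylor differential into the plain boundary of a simplex.
  The map is injective, so identities may be checked after twisting.\<close>

definition twist :: "(nat set \<Rightarrow> ('v, 'k) mpoly) \<Rightarrow> nat set \<Rightarrow> ('v, 'k) mpoly" where
  "twist z J = Poly_Mapping.single (mind (U J)) 1 * z J"

definition faces :: "nat \<Rightarrow> nat set set" where
  "faces i = {J. J \<subseteq> {..<s} \<and> card J = i}"

definition tchains :: "nat \<Rightarrow> (nat set \<Rightarrow> ('v, 'k) mpoly) set" where
  "tchains i = {z. \<forall>J. z J \<noteq> 0 \<longrightarrow> J \<in> faces i}"

lemma mind_Un_disjoint: "A \<inter> B = {} \<Longrightarrow> mind (A \<union> B) = mind A + mind B" for A B :: "'v set"
  unfolding mind_def by (rule sum.union_disjoint) auto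

lemma twist_tdiff: "twist (tdiff z) J = kdiff (\<lambda>_. 1) {..<s} (twist z) J"
proof -
  have eq: "Poly_Mapping.single (mind (U J)) 1 * (ksign l J * (Poly_Mapping.single (mind (U (insert l J) - U J)) 1 * z (insert l J)))
     = ksign l J * 1 * twist z (insert l J)" for l
  proof -
    have "U (insert l J) = U J \<union> (U (insert l J) - U J)" by (auto simp: U_def)
    then have "mind (U (insert l J)) = mind (U J) + mind (U (insert l J) - U J)"
      using mind_Un_disjoint[of "U J" "U (insert l J) - U J"] by auto
    then have "twist z (insert l J) = Poly_Mapping.single (mind (U J)) 1 * (Poly_Mapping.single (mind (U (insert l J) - U J)) 1 * z (insert l J))"
      by (simp add: twist_def mult_single flip: mult.assoc)
    then show ?thesis by (simp add: mult_ac)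
  qed
  show ?thesis unfolding twist_def[of "tdiff z"] tdiff_def kdiff_def sum_distrib_left
    by (rule sum.cong[OF refl]) (rule eq)
qed

lemma tchains_twist: "z \<in> tchains i \<Longrightarrow> twist z \<in> kchains {..<s} i"
proof (rule kchainsI)
  fix J assume z: "z \<in> tchains i" and "twist z J \<noteq> 0"
  then have "z J \<noteq> 0" by (auto simp: twist_def)
  then have "J \<in> faces i" using z by (simp add: tchains_def)
  then show "J \<subseteq> {..<s} \<and> i \<le> card J" by (simp add: faces_def)
qed

lemma tdiff_tdiff:
  assumes "z \<in> tchains i"
  shows "tdiff (tdiff z) J = 0"
proof -
  have "twist (tdiff z) = kdiff (\<lambda>_. 1) {..<s} (twist z)" by (simp add: fun_eq_iff twist_tdiff)
  then have "twist (tdiff (tdiff z)) J = kdiff (\<lambda>_. 1) {..<s} (kdiff (\<lambda>_. 1) {..<s} (twist z)) J"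
    by (simp add: twist_tdiff)
  also have "\<dots> = 0" using tchains_twist[OF assms] by (intro kdiff_kdiff) (auto simp: kchains_def)
  finally show ?thesis unfolding twist_def by (rule single_times_cancel)
qed

lemma lookup_twist:
  "Poly_Mapping.lookup (twist z J) m = (if U J \<subseteq> Poly_Mapping.keys m then Poly_Mapping.lookup (z J) (m - mind (U J)) else 0)"
proof (cases "U J \<subseteq> Poly_Mapping.keys m")
  case True
  then show ?thesis unfolding twist_def
    using lookup_single_times[of "mind (U J)" 1 "z J" "m - mind (U J)"] diff_mind_add[OF True] by (simp add: add.commute)
next
  case False
  then have "m \<noteq> mind (U J) + m'" for m' by (auto simp: keys_plus_nat)
  then show ?thesis using False by (simp add: twist_def lookup_single_times_0)
qed

lemma lookup_kdiff_1: "Poly_Mapping.lookup (kdiff (\<lambda>_. 1) L z J) m = kdiff (\<lambda>_. 1) L (\<lambda>J. Poly_Mapping.lookup (z J) m) J"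
  for z :: "nat set \<Rightarrow> ('v, 'k) mpoly"
  by (simp add: kdiff_def lookup_sum lookup_ksign_times)

text \<open>In the degree of a monomial \<open>m\<close> the twisted complex is the augmented chain
  complex of the full simplex on \<open>L m\<close>, the generators dividing \<open>m\<close>; it is
  acyclic as soon as \<open>L m\<close> is nonempty. For \<open>i = 0\<close> the cycle condition is
  void, and \<open>nonface\<close> provides a generator dividing each monomial of
  \<open>z {}\<close>.\<close>

lemma tdiff_exact:
  assumes z: "z \<in> tchains i" and cyc: "\<And>J. tdiff z J = 0 \<or> i = 0"
    and nonface: "i = 0 \<Longrightarrow> z {} \<in> face_ideal \<Delta>"
  shows "\<exists>w\<in>tchains (Suc i). tdiff w = z"
proof -
  define c where "c m J = Poly_Mapping.lookup (twist z J) m" for m J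
  define L where "L m = {g. g < s \<and> G g \<subseteq> Poly_Mapping.keys m}" for m :: "'v \<Rightarrow>\<^sub>0 nat"
  have finL: "finite (L m)" for m unfolding L_def by (rule finite_subset[of _ "{..<s}"]) auto
  have c: "J \<subseteq> L m \<and> card J = i" if "c m J \<noteq> 0" for m J
  proof -
    have "U J \<subseteq> Poly_Mapping.keys m" "z J \<noteq> 0"
      using that by (auto simp: c_def lookup_twist split: if_splits)
    then have "U J \<subseteq> Poly_Mapping.keys m" "J \<in> faces i" using z by (auto simp: tchains_def)
    then show ?thesis by (auto simp: L_def faces_def U_def)
  qed
  have cyc': "kdiff (\<lambda>_. 1) (L m) (c m) J = 0" for m J
  proof (cases "i = 0")
    case True
    have "c m (insert l J) = 0" if "l \<in> L m - J" for l
    proof (rule ccontr)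
      assume "c m (insert l J) \<noteq> 0"
      then have "insert l J \<subseteq> L m" "card (insert l J) = 0" using c True by blast+
      then have "insert l J = {}" using finL finite_subset by (metis card_0_eq)
      then show False by simp
    qed
    then show ?thesis by (simp add: kdiff_def)
  next
    case False
    have "kdiff (\<lambda>_. 1) (L m) (c m) J = kdiff (\<lambda>_. 1) {..<s} (c m) J"
      unfolding kdiff_def
    proof (rule sum.mono_neutral_left)
      show "\<forall>l\<in>{..<s} - J - (L m - J). ksign l J * 1 * c m (insert l J) = 0"
      proof
        fix l assume "l \<in> {..<s} - J - (L m - J)"
        then have "\<not> insert l J \<subseteq> L m" by auto
        then have "c m (insert l J) = 0" using c by blast
        then show "ksign l J * 1 * c m (insert l J) = 0" by simp
      qed
    qed (auto simp: L_def)
    also have "\<dots> = Poly_Mapping.lookup (twist (tdiff z) J) m"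
    proof -
      have "c m = (\<lambda>J. Poly_Mapping.lookup (twist z J) m)" by (simp add: c_def fun_eq_iff)
      then show ?thesis by (simp only: twist_tdiff lookup_kdiff_1)
    qed
    also have "\<dots> = 0" using cyc[of J] False by (simp add: twist_def)
    finally show ?thesis .
  qed
  \<comment> \<open>Acyclicity of the simplex is the annihilation lemma for the Koszul complex over
    the field with all \<open>y\<close> equal to 1: multiplication by 1 is then homotopic to
    zero.\<close>
  interpret K: cring_ideal "{0 :: 'k}" by unfold_locales auto
  \<comment> \<open>The last clause on the support of \<open>\<eta>\<close> confines nonzero
    solutions to the finitely many \<open>m\<close> occurring in \<open>z\<close>, so that they
    assemble to polynomials.\<close>
  have "\<exists>\<eta>. (\<forall>J. \<eta> J \<noteq> 0 \<longrightarrow> J \<subseteq> L m \<and> card J = Suc i \<and> c m \<noteq> (\<lambda>_. 0)) \<and> (\<forall>J. kdiff (\<lambda>_. 1) {..<s} \<eta> J = c m J)" for m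
  proof (cases "c m = (\<lambda>_. 0)")
    case True
    then show ?thesis by (intro exI[of _ "\<lambda>_. 0"]) simp
  next
    case False
    then obtain J0 where J0: "c m J0 \<noteq> 0" by blast
    have "L m \<noteq> {}"
    proof (cases "i = 0")
      case True
      then have "J0 = {}" using c[OF J0] finL finite_subset by (metis card_0_eq)
      then have "Poly_Mapping.lookup (z {}) m \<noteq> 0" using J0 by (simp add: c_def lookup_twist U_def)
      then have "Poly_Mapping.keys m \<in> - \<Delta>" using nonface[OF True] face_idealD by blast
      then have "Poly_Mapping.keys m \<in> G ` {..<s}" by (simp only: nonfaces)
      then obtain g where "g < s" "G g = Poly_Mapping.keys m" by auto
      then show ?thesis by (auto simp: L_def)
    qed (use c[OF J0] in auto)
    then obtain l where l: "l \<in> L m" by blast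
    have "c m \<in> kchains (L m) i" by (rule kchainsI) (use c in blast)
    moreover have "K.kcycle (\<lambda>_. 1) (L m) (c m)" by (simp add: K.kcycle_def cyc')
    ultimately have "K.kboundary (\<lambda>_. 1) (L m) i (\<lambda>J. 1 * c m J)"
      by (rule K.kboundary_annihilate[OF _ _ l finL])
    then obtain w where w: "w \<in> kchains (L m) (Suc i)" "\<And>J. c m J = kdiff (\<lambda>_. 1) (L m) w J"
      unfolding K.kboundary_def by auto
    \<comment> \<open>The bounding chain may have parts of higher degree; those do not affect the
      boundary in degree \<open>i\<close>.\<close>
    define \<eta> where "\<eta> J = (if card J = Suc i then w J else 0)" for J
    have \<eta>: "J \<subseteq> L m \<and> card J = Suc i" if "\<eta> J \<noteq> 0" for J
      using that w(1) by (auto simp: \<eta>_def kchains_def split: if_splits)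
    have "kdiff (\<lambda>_. 1) {..<s} \<eta> J = c m J" for J
    proof (cases "J \<subseteq> L m \<and> card J = i")
      case True
      then have fin: "finite J" using finL finite_subset by blast
      have "kdiff (\<lambda>_. 1) {..<s} \<eta> J = (\<Sum>l\<in>L m - J. ksign l J * 1 * \<eta> (insert l J))"
        unfolding kdiff_def
      proof (rule sum.mono_neutral_right)
        show "\<forall>l\<in>{..<s} - J - (L m - J). ksign l J * 1 * \<eta> (insert l J) = 0"
        proof
          fix l assume "l \<in> {..<s} - J - (L m - J)"
          then have "\<not> insert l J \<subseteq> L m" by auto
          then have "\<eta> (insert l J) = 0" using \<eta> by blast
          then show "ksign l J * 1 * \<eta> (insert l J) = 0" by simp
        qed
      qed (auto simp: L_def)
      also have "\<dots> = (\<Sum>l\<in>L m - J. ksign l J * 1 * w (insert l J))"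
        by (rule sum.cong) (use True fin in \<open>auto simp: \<eta>_def\<close>)
      also have "\<dots> = c m J" by (simp add: w(2) kdiff_def)
      finally show ?thesis .
    next
      case False
      then have "c m J = 0" using c by blast
      moreover have "\<eta> (insert l J) = 0" if "l \<notin> J" for l
      proof (rule ccontr)
        assume "\<eta> (insert l J) \<noteq> 0"
        then have *: "insert l J \<subseteq> L m" "card (insert l J) = Suc i" using \<eta> by blast+
        then have "finite J" using finL[of m] finite_subset[of J "L m"] by simp
        then have "card J = i" using *(2) that by simp
        then show False using *(1) False by blast
      qed
      ultimately show ?thesis by (simp add: kdiff_def)
    qed
    then show ?thesis using \<eta> False by blast
  qed
  then obtain \<eta> where \<eta>: "\<And>m J. \<eta> m J \<noteq> 0 \<Longrightarrow> J \<subseteq> L m \<and> card J = Suc i \<and> c m \<noteq> (\<lambda>_. 0)"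
    "\<And>m J. kdiff (\<lambda>_. 1) {..<s} (\<eta> m) J = c m J" by metis
  define w where "w J = Abs_poly_mapping (\<lambda>m. \<eta> (m + mind (U J)) J)" for J
  have fin0: "finite {m. c m \<noteq> (\<lambda>_. 0)}"
  proof (rule finite_subset)
    show "{m. c m \<noteq> (\<lambda>_. 0)} \<subseteq> (\<Union>J\<in>Pow {..<s}. Poly_Mapping.keys (twist z J))"
    proof
      fix m assume "m \<in> {m. c m \<noteq> (\<lambda>_. 0)}"
      then obtain J where J: "c m J \<noteq> 0" by blast
      then have "J \<in> Pow {..<s}" using c[OF J] by (auto simp: L_def)
      moreover have "m \<in> Poly_Mapping.keys (twist z J)" using J by (simp add: c_def in_keys_iff)
      ultimately show "m \<in> (\<Union>J\<in>Pow {..<s}. Poly_Mapping.keys (twist z J))" by blast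
    qed
  qed simp
  have "finite {m. \<eta> (m + mind (U J)) J \<noteq> 0}" for J
  proof (rule finite_subset[OF _ finite_vimageI[OF fin0]])
    show "{m. \<eta> (m + mind (U J)) J \<noteq> 0} \<subseteq> (\<lambda>m. m + mind (U J)) -` {m. c m \<noteq> (\<lambda>_. 0)}" using \<eta>(1) by blast
    show "inj (\<lambda>m. m + mind (U J))" by (simp add: inj_on_def)
  qed
  then have lw: "Poly_Mapping.lookup (w J) m = \<eta> (m + mind (U J)) J" for J m by (simp add: w_def)
  have ltw: "Poly_Mapping.lookup (twist w J) m = \<eta> m J" for J m
  proof (cases "U J \<subseteq> Poly_Mapping.keys m")
    case True
    then show ?thesis by (simp add: lookup_twist lw diff_mind_add)
  next
    case False
    then have "\<not> J \<subseteq> L m" by (auto simp: U_def L_def)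
    then show ?thesis using False \<eta>(1) by (auto simp: lookup_twist)
  qed
  have "w \<in> tchains (Suc i)" unfolding tchains_def
  proof (intro CollectI allI impI)
    fix J assume "w J \<noteq> 0"
    then obtain m where "Poly_Mapping.lookup (w J) m \<noteq> 0" by (metis lookup_zero poly_mapping_eqI)
    then have "J \<subseteq> L (m + mind (U J)) \<and> card J = Suc i" using \<eta>(1) by (simp add: lw)
    then show "J \<in> faces (Suc i)" by (auto simp: faces_def L_def)
  qed
  moreover have "tdiff w J = z J" for J
  proof -
    have "twist (tdiff w) J = twist z J"
      by (rule poly_mapping_eqI) (simp add: twist_tdiff lookup_kdiff_1 ltw \<eta>(2) flip: c_def)
    then have "Poly_Mapping.single (mind (U J)) 1 * (tdiff w J - z J) = 0"
      by (simp add: twist_def right_diff_distrib)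
    then show ?thesis using single_times_cancel by fastforce
  qed
  ultimately show ?thesis by (intro bexI[of _ w]) auto
qed

lemma tdiff_tchains:
  assumes w: "w \<in> tchains (Suc i)"
  shows "tdiff w \<in> tchains i"
  unfolding tchains_def
proof (intro CollectI allI impI)
  fix J assume "tdiff w J \<noteq> 0"
  then obtain l where l: "l \<in> {..<s} - J" "w (insert l J) \<noteq> 0"
    unfolding tdiff_def by (metis (lifting) mult_zero_right sum.neutral)
  then have "insert l J \<subseteq> {..<s}" "card (insert l J) = Suc i" using w by (auto simp: tchains_def faces_def)
  then show "J \<in> faces i" using l(1) finite_subset[of J "{..<s}"] by (auto simp: faces_def)
qed

lemma tdiff_mem:
  "tdiff w {} \<in> face_ideal \<Delta>"
proof -
  interpret cring_ideal "face_ideal \<Delta> :: ('v, 'k) mpoly set" by (rule cring_ideal_face_ideal[OF down])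
  have "Poly_Mapping.single (mind (U {l} - U {})) 1 \<in> (face_ideal \<Delta> :: ('v, 'k) mpoly set)" if "l < s" for l
    using that nonfaces by (auto simp: face_ideal_def U_def)
  then show ?thesis unfolding tdiff_def by (intro sum_mem mult_mem mult_mem_right) auto
qed

lemma finite_faces: "finite (faces i)"
  unfolding faces_def by simp

section \<open>The Taylor resolution in matrix form\<close>

definition rk :: "nat \<Rightarrow> nat" where "rk i = card (faces i)"

definition enum :: "nat \<Rightarrow> nat \<Rightarrow> nat set" where
  "enum i = (SOME f. bij_betw f {..<rk i} (faces i))"

lemma enum: "bij_betw (enum i) {..<rk i} (faces i)"
proof -
  have "\<exists>f. bij_betw f {..<rk i} (faces i)"
    using ex_bij_betw_nat_finite[OF finite_faces[of i]] by (simp add: rk_def lessThan_atLeast0)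
  then show ?thesis unfolding enum_def by (rule someI_ex)
qed

definition to_vec :: "nat \<Rightarrow> (nat set \<Rightarrow> ('v, 'k) mpoly) \<Rightarrow> nat \<Rightarrow> ('v, 'k) mpoly" where
  "to_vec i z a = (if a < rk i then z (enum i a) else 0)"

definition to_fun :: "nat \<Rightarrow> (nat \<Rightarrow> ('v, 'k) mpoly) \<Rightarrow> nat set \<Rightarrow> ('v, 'k) mpoly" where
  "to_fun i v J = (\<Sum>a<rk i. if enum i a = J then v a else 0)"

lemma to_fun_enum: "a < rk i \<Longrightarrow> to_fun i v (enum i a) = v a"
proof -
  assume a: "a < rk i"
  have "enum i b = enum i a \<longleftrightarrow> b = a" if "b < rk i" for b
    using enum[of i] a that unfolding bij_betw_def inj_on_def by auto
  then have "to_fun i v (enum i a) = (\<Sum>b<rk i. if b = a then v b else 0)"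
    unfolding to_fun_def by (intro sum.cong) auto
  then show ?thesis using a by (simp add: sum.delta)
qed

lemma enum_faces: "a < rk i \<Longrightarrow> enum i a \<in> faces i"
  using enum[of i] by (auto simp: bij_betw_def)

lemma faces_enum: "J \<in> faces i \<Longrightarrow> \<exists>a<rk i. J = enum i a"
proof -
  assume "J \<in> faces i"
  then have "J \<in> enum i ` {..<rk i}" using enum[of i] by (simp add: bij_betw_def)
  then show ?thesis by auto
qed

lemma to_fun_tchains: "to_fun i v \<in> tchains i"
  unfolding tchains_def
proof (intro CollectI allI impI)
  fix J assume "to_fun i v J \<noteq> 0"
  then obtain a where "a \<in> {..<rk i}" "(if enum i a = J then v a else 0) \<noteq> 0"
    unfolding to_fun_def by (rule sum.not_neutral_contains_not_neutral)
  then have "a < rk i" "enum i a = J" by (auto split: if_splits)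
  then show "J \<in> faces i" using enum_faces by blast
qed

lemma to_fun_vec: "z \<in> tchains i \<Longrightarrow> to_fun i (to_vec i z) = z"
proof
  fix J assume z: "z \<in> tchains i"
  show "to_fun i (to_vec i z) J = z J"
  proof (cases "J \<in> faces i")
    case True
    then obtain a where "a < rk i" "J = enum i a" using faces_enum by blast
    then show ?thesis by (simp add: to_fun_enum to_vec_def)
  next
    case False
    then have "z J = 0" "to_fun i (to_vec i z) J = 0"
      using z to_fun_tchains[of i "to_vec i z"] unfolding tchains_def by blast+
    then show ?thesis by simp
  qed
qed

lemma to_vec_fun: "v \<in> free_module (rk i) \<Longrightarrow> to_vec i (to_fun i v) = v"
  by (auto simp: to_vec_def to_fun_enum free_module_def fun_eq_iff)

lemma to_vec_free: "to_vec i z \<in> free_module (rk i)"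
  by (simp add: to_vec_def free_module_def)

definition TD :: "nat \<Rightarrow> nat \<Rightarrow> nat \<Rightarrow> ('v, 'k) mpoly" where
  "TD i a b = tdiff (\<lambda>J. if enum (Suc i) b = J then 1 else 0) (enum i a)"

lemma mat_apply_TD: "mat_apply (rk i) (rk (Suc i)) (TD i) v = to_vec i (tdiff (to_fun (Suc i) v))"
proof
  fix a
  have "(\<Sum>b<rk (Suc i). TD i a b * v b) = tdiff (to_fun (Suc i) v) (enum i a)"
  proof -
    let ?J = "enum i a"
    let ?c = "\<lambda>l. ksign l ?J * (Poly_Mapping.single (mind (U (insert l ?J) - U ?J)) 1 :: ('v, 'k) mpoly)"
    have "(\<Sum>b<rk (Suc i). TD i a b * v b) = (\<Sum>b<rk (Suc i). \<Sum>l\<in>{..<s} - ?J. ?c l * (if enum (Suc i) b = insert l ?J then v b else 0))"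
      unfolding TD_def tdiff_def sum_distrib_right by (intro sum.cong) (auto simp: mult.assoc)
    also have "\<dots> = (\<Sum>l\<in>{..<s} - ?J. ?c l * to_fun (Suc i) v (insert l ?J))"
      unfolding to_fun_def sum_distrib_left by (rule sum.swap)
    finally show ?thesis by (simp add: tdiff_def mult.assoc)
  qed
  then show "mat_apply (rk i) (rk (Suc i)) (TD i) v a = to_vec i (tdiff (to_fun (Suc i) v)) a"
    by (simp add: mat_apply_def to_vec_def)
qed

text \<open>The degree of the least common multiple of the generators in the chosen set.\<close>

definition te :: "nat \<Rightarrow> nat \<Rightarrow> int" where "te i a = int (card (U (enum i a)))"

lemma homogeneous_TD:
  assumes "a < rk i" "b < rk (Suc i)"
  shows "homogeneous (te (Suc i) b - te i a) (TD i a b)"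
  unfolding TD_def tdiff_def
proof (rule homogeneous_sum)
  fix l assume l: "l \<in> {..<s} - enum i a"
  let ?J = "enum i a"
  show "homogeneous (te (Suc i) b - te i a) (ksign l ?J * (Poly_Mapping.single (mind (U (insert l ?J) - U ?J)) 1 *
     (if enum (Suc i) b = insert l ?J then 1 else 0)) :: ('v, 'k) mpoly)"
  proof (cases "enum (Suc i) b = insert l ?J")
    case True
    have "U ?J \<subseteq> U (insert l ?J)" by (auto simp: U_def)
    then have "card (U (insert l ?J)) = card (U (insert l ?J) - U ?J) + card (U ?J)"
      by (metis card_Diff_subset card_mono finite le_add_diff_inverse2)
    then have eq: "te (Suc i) b - te i a = int (card (U (insert l ?J) - U ?J))"
      using True by (simp add: te_def)
    have "homogeneous (te (Suc i) b - te i a) (Poly_Mapping.single (mind (U (insert l ?J) - U ?J)) 1 :: ('v, 'k) mpoly)"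
      unfolding eq homogeneous_lookup lookup_single when_def by auto
    then have "homogeneous (te (Suc i) b - te i a) (ksign l ?J * (Poly_Mapping.single (mind (U (insert l ?J) - U ?J)) 1 :: ('v, 'k) mpoly))"
      unfolding homogeneous_lookup lookup_ksign_times by simp
    then show ?thesis using True by simp
  qed simp
qed

lemma faces_0: "faces 0 = {{}}"
  unfolding faces_def using finite_subset[OF _ finite_lessThan[of s]] by auto

lemma rk_0: "rk 0 = 1" and enum_0: "enum 0 0 = {}"
proof -
  show 1: "rk 0 = 1" by (simp add: rk_def faces_0)
  show "enum 0 0 = {}" using enum_faces[of 0 0] 1 by (simp add: faces_0)
qed

lemma resolution: "graded_free_resolution (face_ideal \<Delta> :: ('v, 'k) mpoly set) rk te (\<lambda>_. 1) TD"
  unfolding graded_free_resolution_def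
proof (intro conjI allI impI)
  fix a assume "a < rk 0"
  then show "homogeneous (te 0 a) (1 :: ('v, 'k) mpoly)"
    by (simp add: rk_0 te_def enum_0 U_def homogeneous_lookup lookup_one when_def)
next
  fix i a b assume "a < rk i" "b < rk (Suc i)"
  then show "homogeneous (te (Suc i) b - te i a) (TD i a b)" by (rule homogeneous_TD)
next
  fix p :: "('v, 'k) mpoly"
  show "\<exists>v\<in>free_module (rk 0). p - (\<Sum>a<rk 0. 1 * v a) \<in> face_ideal \<Delta>"
    by (rule bexI[of _ "\<lambda>a. if a = 0 then p else 0"]) (simp_all add: rk_0 free_module_def face_ideal_def)
next
  show "mat_apply (rk 0) (rk 1) (TD 0) ` free_module (rk 1) = {v \<in> free_module (rk 0). (\<Sum>a<rk 0. 1 * v a) \<in> (face_ideal \<Delta> :: ('v, 'k) mpoly set)}"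
  proof (intro equalityI subsetI)
    fix v assume "v \<in> mat_apply (rk 0) (rk 1) (TD 0) ` free_module (rk 1)"
    then obtain u where "v = mat_apply (rk 0) (rk 1) (TD 0) u" by blast
    then have v: "v = to_vec 0 (tdiff (to_fun 1 u))" using mat_apply_TD[of 0 u] by simp
    then show "v \<in> {v \<in> free_module (rk 0). (\<Sum>a<rk 0. 1 * v a) \<in> (face_ideal \<Delta> :: ('v, 'k) mpoly set)}"
      using to_vec_free[of 0 "tdiff (to_fun 1 u)"] tdiff_mem[of "to_fun 1 u"] by (simp add: rk_0 to_vec_def enum_0)
  next
    fix v assume v: "v \<in> {v \<in> free_module (rk 0). (\<Sum>a<rk 0. 1 * v a) \<in> (face_ideal \<Delta> :: ('v, 'k) mpoly set)}"
    have "\<exists>w\<in>tchains (Suc 0). tdiff w = to_fun 0 v"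
      by (rule tdiff_exact[OF to_fun_tchains]) (use v to_fun_enum[of 0 0 v] in \<open>simp_all add: rk_0 enum_0\<close>)
    then obtain w where w: "w \<in> tchains (Suc 0)" "tdiff w = to_fun 0 v" by blast
    have "mat_apply (rk 0) (rk 1) (TD 0) (to_vec 1 w) = to_vec 0 (tdiff (to_fun (Suc 0) (to_vec (Suc 0) w)))"
      using mat_apply_TD[of 0 "to_vec 1 w"] by simp
    also have "\<dots> = v" using v by (simp add: to_fun_vec w to_vec_fun)
    finally show "v \<in> mat_apply (rk 0) (rk 1) (TD 0) ` free_module (rk 1)" using to_vec_free[of 1 w] by blast
  qed
next
  fix i
  show "mat_apply (rk (i + 1)) (rk (i + 2)) (TD (i + 1)) ` free_module (rk (i + 2)) =
    {v \<in> free_module (rk (i + 1)). mat_apply (rk i) (rk (i + 1)) (TD i) v = (\<lambda>_. 0)}"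
  proof (intro equalityI subsetI)
    fix v assume "v \<in> mat_apply (rk (i + 1)) (rk (i + 2)) (TD (i + 1)) ` free_module (rk (i + 2))"
    then obtain u where "v = mat_apply (rk (Suc i)) (rk (Suc (Suc i))) (TD (Suc i)) u" by auto
    then have v: "v = to_vec (Suc i) (tdiff (to_fun (Suc (Suc i)) u))" by (simp add: mat_apply_TD)
    have "to_fun (Suc i) v = tdiff (to_fun (Suc (Suc i)) u)"
      unfolding v by (intro to_fun_vec tdiff_tchains to_fun_tchains)
    then have "tdiff (to_fun (Suc i) v) J = 0" for J using tdiff_tdiff[OF to_fun_tchains] by simp
    then have "mat_apply (rk i) (rk (Suc i)) (TD i) v = (\<lambda>_. 0)" by (simp add: mat_apply_TD to_vec_def fun_eq_iff)
    then show "v \<in> {v \<in> free_module (rk (i + 1)). mat_apply (rk i) (rk (i + 1)) (TD i) v = (\<lambda>_. 0)}"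
      using v to_vec_free by simp
  next
    fix v assume "v \<in> {v \<in> free_module (rk (i + 1)). mat_apply (rk i) (rk (i + 1)) (TD i) v = (\<lambda>_. 0)}"
    then have v: "v \<in> free_module (rk (Suc i))" "to_vec i (tdiff (to_fun (Suc i) v)) = (\<lambda>_. 0)" by (simp_all add: mat_apply_TD)
    have t: "tdiff (to_fun (Suc i) v) = (\<lambda>_. 0)"
      using to_fun_vec[OF tdiff_tchains[OF to_fun_tchains[of "Suc i" v]]] v(2) by (simp add: to_fun_def fun_eq_iff)
    have "\<exists>w\<in>tchains (Suc (Suc i)). tdiff w = to_fun (Suc i) v"
      by (rule tdiff_exact[OF to_fun_tchains]) (simp_all add: t)
    then obtain w where w: "w \<in> tchains (Suc (Suc i))" "tdiff w = to_fun (Suc i) v" by blast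
    have "mat_apply (rk (Suc i)) (rk (Suc (Suc i))) (TD (Suc i)) (to_vec (Suc (Suc i)) w) = v"
      using v(1) by (simp add: mat_apply_TD to_fun_vec w to_vec_fun)
    then have "v \<in> mat_apply (rk (Suc i)) (rk (Suc (Suc i))) (TD (Suc i)) ` free_module (rk (Suc (Suc i)))"
      using to_vec_free by (metis image_eqI)
    then show "v \<in> mat_apply (rk (i + 1)) (rk (i + 2)) (TD (i + 1)) ` free_module (rk (i + 2))" by simp
  qed
qed

end

lemma face_ideal_resolution:
  assumes "down_closed \<Delta>"
  shows "\<exists>r e \<epsilon> D. graded_free_resolution (face_ideal (\<Delta> :: 'v::{finite,linorder} set set) :: ('v, 'k::field) mpoly set) r e \<epsilon> D"
proof -
  obtain G where "bij_betw G {0..<card (- \<Delta>)} (- \<Delta>)" using ex_bij_betw_nat_finite[of "- \<Delta>"] by auto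
  then have "G ` {..<card (- \<Delta>)} = - \<Delta>" by (simp add: bij_betw_def lessThan_atLeast0)
  then interpret taylor \<Delta> "card (- \<Delta>)" G "TYPE('k)" by unfold_locales (use assms in auto)
  show ?thesis using resolution by blast
qed

lemma face_ideal_betti_eq_0_iff:
  fixes \<Delta> :: "'v::{finite,linorder} set set"
  assumes "down_closed \<Delta>"
  shows "betti (face_ideal \<Delta> :: ('v, 'k::field) mpoly set) i j = 0 \<longleftrightarrow>
    koszul_cycles (face_ideal \<Delta> :: ('v, 'k) mpoly set) i j \<subseteq> koszul_boundaries (face_ideal \<Delta>) i j"
  by (rule betti_eq_0_iff[OF cring_ideal_face_ideal[OF assms] hpart_face_ideal face_ideal_resolution[OF assms]])

section \<open>Regularity and initial degree\<close>

lemma koszul_cycles_subset: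
  fixes \<Delta> :: "'v::{finite,linorder} set set"
  assumes "\<And>a. int (mdeg a) = j \<Longrightarrow> multidegree_exact TYPE('k::field) \<Delta> a i"
  shows "koszul_cycles (face_ideal \<Delta> :: ('v, 'k) mpoly set) i j \<subseteq> koszul_boundaries (face_ideal \<Delta>) i j"
proof
  fix z :: "'v set \<Rightarrow> ('v, 'k) mpoly" assume z: "z \<in> koszul_cycles (face_ideal \<Delta>) i j"
  then have "\<exists>w\<in>kpiece (degree_slice j) (Suc i). \<forall>F. z F - kd w F \<in> face_ideal \<Delta>"
    by (intro koszul_exact) (use assms in \<open>auto simp: koszul_cycles_def\<close>)
  then show "z \<in> koszul_boundaries (face_ideal \<Delta>) i j" using z by (simp add: koszul_boundaries_def koszul_cycles_def)
qed

lemma mdeg_gt_card: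
  assumes "mdeg (a :: 'v::finite \<Rightarrow>\<^sub>0 nat) > CARD('v)"
  shows "\<exists>v. Poly_Mapping.lookup a v \<ge> 2"
proof (rule ccontr)
  assume "\<not> ?thesis"
  then have "Poly_Mapping.lookup a v \<le> 1" for v by (simp add: not_le numeral_2_eq_2 less_Suc_eq_le)
  then have "mdeg a \<le> (\<Sum>v\<in>(UNIV :: 'v set). 1)" unfolding mdeg_def by (intro sum_mono)
  then show False using assms by simp
qed

text \<open>Homology lives in squarefree multidegrees, whose degree is at most \<open>n\<close>.
  This upper bound is what makes the \<open>GREATEST\<close> in \<open>reg\<close> an actual
  maximum.\<close>

lemma betti_bound:
  fixes \<Delta> :: "'v::{finite,linorder} set set"
  assumes "down_closed \<Delta>" "betti (face_ideal \<Delta> :: ('v, 'k::field) mpoly set) i j \<noteq> 0"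
  shows "j - int i \<le> int (CARD('v))"
proof (rule ccontr)
  assume *: "\<not> ?thesis"
  have "multidegree_exact TYPE('k) \<Delta> a i" if "int (mdeg a) = j" for a
  proof -
    have "mdeg a > CARD('v)" using * that by linarith
    then show ?thesis using mdeg_gt_card multidegree_exact_nonsquarefree by blast
  qed
  then show False using assms koszul_cycles_subset[of j \<Delta> i, where ?'k = 'k] face_ideal_betti_eq_0_iff[OF assms(1)] by blast
qed

lemma mdeg_ge_card_keys: "card (Poly_Mapping.keys m) \<le> mdeg m" for m :: "'v::finite \<Rightarrow>\<^sub>0 nat"
proof -
  have "card (Poly_Mapping.keys m) = (\<Sum>v\<in>Poly_Mapping.keys m. 1)" by simp
  also have "\<dots> \<le> (\<Sum>v\<in>Poly_Mapping.keys m. Poly_Mapping.lookup m v)"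
    by (rule sum_mono) (simp add: in_keys_iff Suc_le_eq)
  also have "\<dots> \<le> mdeg m" unfolding mdeg_def by (rule sum_mono2) auto
  finally show ?thesis .
qed

lemma homogeneous_monomial: "homogeneous (int (mdeg m)) (Poly_Mapping.single m c)"
  by (simp add: homogeneous_lookup lookup_single when_def)

lemma indeg_le:
  fixes \<Delta> :: "'v::{finite,linorder} set set"
  assumes "F \<notin> \<Delta>"
  shows "indeg (face_ideal \<Delta> :: ('v, 'k::field) mpoly set) \<le> enat (card F)"
proof -
  have "(Poly_Mapping.single (mind F) 1 :: ('v, 'k) mpoly) \<in> face_ideal \<Delta>" using assms by (simp add: face_ideal_def)
  moreover have "(Poly_Mapping.single (mind F) 1 :: ('v, 'k) mpoly) \<noteq> 0"
    by (metis lookup_single_eq lookup_zero zero_neq_one)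
  moreover have "homogeneous (int (card F)) (Poly_Mapping.single (mind F) 1 :: ('v, 'k) mpoly)"
    using homogeneous_monomial[of "mind F" "1 :: 'k"] by simp
  ultimately show ?thesis unfolding indeg_def by (intro Inf_lower) blast
qed

lemma indeg_ge:
  fixes \<Delta> :: "'v::{finite,linorder} set set"
  assumes "\<And>F. card F < d \<Longrightarrow> F \<in> \<Delta>"
  shows "enat d \<le> indeg (face_ideal \<Delta> :: ('v, 'k::field) mpoly set)"
  unfolding indeg_def
proof (rule Inf_greatest, clarify)
  fix j and p :: "('v, 'k) mpoly" assume p: "p \<in> face_ideal \<Delta>" "p \<noteq> 0" "homogeneous (int j) p"
  then obtain m where m: "m \<in> Poly_Mapping.keys p" by (metis ex_in_conv keys_eq_empty)
  then have "Poly_Mapping.keys m \<notin> \<Delta>" using p(1) by (simp add: face_ideal_def)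
  then have "d \<le> card (Poly_Mapping.keys m)" using assms not_less by blast
  also have "\<dots> \<le> mdeg m" by (rule mdeg_ge_card_keys)
  also have "\<dots> = j" using p(3) m by (simp add: homogeneous_iff)
  finally show "enat d \<le> enat j" by simp
qed

context skeletal_complex
begin

text \<open>A nonzero Betti number in homological degree \<open>n - d\<close> and degree
  \<open>n\<close> would contribute the value \<open>d\<close> to the regularity. Its vanishing is
  exactly the hypothesis of \<open>onto_of_exact\<close>.\<close>

lemma onto_of_reg:
  assumes down: "down_closed \<Delta>" and d: "d \<le> CARD('v)"
    and reg: "reg (face_ideal \<Delta> :: ('v, 'k::field) mpoly set) = int d - 1"
  shows "cochains_onto TYPE('k) tops"
proof -
  let ?I = "face_ideal \<Delta> :: ('v, 'k) mpoly set"
  let ?n = "CARD('v)"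
  define T where "T = {t. \<exists>i j. betti ?I i j \<noteq> 0 \<and> t = j - int i}"
  have "betti ?I (?n - d) (int ?n) = 0"
  proof (rule ccontr)
    assume nz: "betti ?I (?n - d) (int ?n) \<noteq> 0"
    have "int d = int ?n - int (?n - d)" using d by simp
    then have dT: "int d \<in> T" using nz unfolding T_def by blast
    \<comment> \<open>\<open>T\<close> is a set of integers bounded above by \<open>n\<close> and
      containing \<open>d\<close>, so its maximum is that of this finite window.\<close>
    define S where "S = T \<inter> {int d..int ?n}"
    have finS: "finite S" unfolding S_def by (intro finite_Int) simp
    have bound: "t \<le> int ?n" if "t \<in> T" for t using that betti_bound[OF down, where ?'k = 'k] unfolding T_def by blast
    then have dS: "int d \<in> S" using dT d by (simp add: S_def)
    have "Max S \<in> S" using finS dS Max_in by blast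
    moreover have "t \<le> Max S" if t: "t \<in> T" for t
    proof (cases "t \<ge> int d")
      case True
      then have "t \<in> S" using t bound by (simp add: S_def)
      then show ?thesis using finS by simp
    next
      case False
      then show ?thesis using Max_ge[OF finS dS] by linarith
    qed
    ultimately have "(GREATEST t. t \<in> T) = Max S" by (intro Greatest_equality) (auto simp: S_def)
    then have "reg ?I = Max S" by (simp add: reg_def T_def)
    then show False using reg Max_ge[OF finS dS] by simp
  qed
  then have sub: "koszul_cycles ?I (?n - d) (int ?n) \<subseteq> koszul_boundaries ?I (?n - d) (int ?n)"
    using face_ideal_betti_eq_0_iff[OF down] by blast
  show ?thesis
  proof (rule onto_of_exact[OF d])
    fix z :: "'v set \<Rightarrow> ('v, 'k) mpoly"
    assume "z \<in> kpiece {a. mdeg a = ?n} (?n - d)" "\<And>F. kd z F \<in> face_ideal \<Delta>"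
    then have "z \<in> koszul_cycles ?I (?n - d) (int ?n)" by (simp add: koszul_cycles_def)
    then show "\<exists>w. \<forall>F. z F - kd w F \<in> face_ideal \<Delta>" using sub unfolding koszul_boundaries_def by blast
  qed
qed

text \<open>The nonface \<open>G\<close> is used twice: it bounds the initial degree from above, and
  its class in homological degree 1 shows that the regularity is attained. Above the linear strand
  there is nothing by \<open>exact_linear_strand\<close>.\<close>

lemma linear_resolution_of_onto:
  assumes down: "down_closed \<Delta>" and onto: "cochains_onto TYPE('k::field) tops"
    and G: "card G = d" "G \<notin> \<Delta>"
  shows "linear_resolution d (face_ideal \<Delta> :: ('v, 'k) mpoly set)"
  unfolding linear_resolution_def
proof
  let ?I = "face_ideal \<Delta> :: ('v, 'k) mpoly set"
  show "indeg ?I = enat d"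
    using indeg_le[OF G(2), where ?'k = 'k] indeg_ge[OF small_faces, where ?'k = 'k] G(1) by (simp add: order.antisym)
  obtain z :: "'v set \<Rightarrow> ('v, 'k) mpoly" where z: "z \<in> kpiece {a. mdeg a = d} 1" "\<forall>F. kd z F \<in> face_ideal \<Delta>"
    "\<not> (\<exists>w. \<forall>F. z F - kd w F \<in> face_ideal \<Delta>)"
    using nonface_not_exact[OF G, where ?'k = 'k] by blast
  have "z \<in> koszul_cycles ?I 1 (int d)" using z(1,2) by (simp add: koszul_cycles_def)
  moreover have "z \<notin> koszul_boundaries ?I 1 (int d)" using z(3) unfolding koszul_boundaries_def by blast
  ultimately have nz: "betti ?I 1 (int d) \<noteq> 0" using face_ideal_betti_eq_0_iff[OF down] by blast
  show "reg ?I = int d - 1"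
    unfolding reg_def
  proof (rule Greatest_equality)
    show "\<exists>i j. betti ?I i j \<noteq> 0 \<and> int d - 1 = j - int i"
      by (rule exI[of _ 1], rule exI[of _ "int d"]) (use nz in simp)
    fix t assume "\<exists>i j. betti ?I i j \<noteq> 0 \<and> t = j - int i"
    then obtain i j where ij: "betti ?I i j \<noteq> 0" "t = j - int i" by blast
    show "t \<le> int d - 1"
    proof (rule ccontr)
      assume t: "\<not> t \<le> int d - 1"
      have "multidegree_exact TYPE('k) \<Delta> a i" if a: "int (mdeg a) = j" for a
      proof (rule exact_linear_strand[OF onto])
        show "a \<noteq> 0" using t ij(2) a d_ge_2 by auto
        show "mdeg a + 1 \<noteq> i + d" using t ij(2) a by linarith
      qed
      then have "koszul_cycles ?I i j \<subseteq> koszul_boundaries ?I i j" by (rule koszul_cycles_subset)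
      then show False using ij(1) face_ideal_betti_eq_0_iff[OF down] by blast
    qed
  qed
qed

end

section \<open>Regular sequences from vanishing Koszul homology\<close>

lemma kd_eq_0: "(\<And>v. v \<notin> F \<Longrightarrow> z (insert v F) = 0) \<Longrightarrow> kd z F = 0"
  by (simp add: kdiff_def)

text \<open>\<open>exact_high\<close> concerns one homological degree,
  \<open>koszul_vanishing\<close> all degrees from \<open>m\<close> on. The differential lowers the
  degree by one, so the parts \<open>zi i\<close> of a cycle are cycles and can be bounded
  separately.\<close>

lemma (in skeletal_complex) koszul_vanishing_variables:
  assumes down: "down_closed \<Delta>" and onto: "cochains_onto TYPE('k::field) tops" and det: "cochains_determine TYPE('k) d tops"
    and m: "CARD('v) < m + d" "m > 0"
  shows "cring_ideal.koszul_vanishing (face_ideal \<Delta> :: ('v, 'k) mpoly set) pvar UNIV m"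
proof -
  interpret cring_ideal "face_ideal \<Delta> :: ('v, 'k) mpoly set" by (rule cring_ideal_face_ideal[OF down])
  show ?thesis unfolding koszul_vanishing_def
  proof (intro ballI impI)
    fix z :: "'v set \<Rightarrow> ('v, 'k) mpoly" assume z: "z \<in> kchains UNIV m" "kcycle pvar UNIV z"
    define zi where "zi i F = (if card F = i then z F else 0)" for i F
    have "kboundary pvar UNIV m (zi i)" if i: "i \<in> {m..CARD('v)}" for i
    proof -
      have "zi i \<in> kpiece UNIV i" by (auto simp: kpiece_def zi_def)
      moreover have "kd (zi i) F \<in> face_ideal \<Delta>" for F
      proof (cases "Suc (card F) = i")
        case True
        then have "kd (zi i) F = kd z F" by (intro kdiff_cong_sub) (simp add: zi_def)
        then show ?thesis using z(2) by (simp add: kcycle_def)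
      next
        case False
        then have "kd (zi i) F = 0" by (intro kd_eq_0) (simp add: zi_def)
        then show ?thesis by simp
      qed
      moreover have "multidegree_exact TYPE('k) \<Delta> a i" for a
        by (rule exact_high[OF onto det]) (use i m in auto)
      ultimately obtain w where w: "w \<in> kpiece UNIV (Suc i)" "\<forall>F. zi i F - kd w F \<in> face_ideal \<Delta>"
        using koszul_exact[of UNIV \<Delta> i "zi i"] by blast
      have "w \<in> kchains UNIV (Suc m)"
      proof (rule kchainsI)
        fix F assume "w F \<noteq> 0"
        then obtain a where "a \<in> Poly_Mapping.keys (w F)" by (metis ex_in_conv keys_eq_empty)
        then have "card F = Suc i" using w(1) by (auto simp: kpiece_def)
        then show "F \<subseteq> UNIV \<and> Suc m \<le> card F" using i by simp
      qed
      then show ?thesis unfolding kboundary_def using w(2) by blast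
    qed
    then have "kboundary pvar UNIV m (\<lambda>F. \<Sum>i\<in>{m..CARD('v)}. zi i F)" by (intro kboundary_sum) auto
    moreover have "(\<Sum>i\<in>{m..CARD('v)}. zi i F) = z F" for F
    proof (cases "z F = 0")
      case True then show ?thesis by (simp add: zi_def)
    next
      case False
      then have "m \<le> card F" using z(1) by (auto simp: kchains_def)
      moreover have "card F \<le> CARD('v)" by (rule card_mono) auto
      ultimately show ?thesis by (simp add: zi_def sum.delta')
    qed
    ultimately show "kboundary pvar UNIV m z" by simp
  qed
qed

section \<open>Reindexing Koszul complexes along order embeddings\<close>

lemma ksign_image:
  fixes \<iota> :: "'v::linorder \<Rightarrow> 'l::linorder"
  assumes mono: "\<And>a b. \<iota> a < \<iota> b \<longleftrightarrow> a < b"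
  shows "ksign (\<iota> l) (\<iota> ` J) = ksign l J"
proof -
  have inj: "inj \<iota>" using mono by (metis injI less_irrefl linorder_neqE)
  have "{w \<in> \<iota> ` J. w < \<iota> l} = \<iota> ` {w \<in> J. w < l}" using mono by auto
  then have "card {w \<in> \<iota> ` J. w < \<iota> l} = card {w \<in> J. w < l}"
    using inj by (simp add: card_image inj_on_subset)
  then show ?thesis by (simp add: ksign_def)
qed

lemma kdiff_image:
  fixes \<iota> :: "'v::linorder \<Rightarrow> 'l::linorder"
  assumes mono: "\<And>a b. \<iota> a < \<iota> b \<longleftrightarrow> a < b"
  shows "kdiff y (\<iota> ` L) z (\<iota> ` J) = kdiff (\<lambda>v. y (\<iota> v)) L (\<lambda>F. z (\<iota> ` F)) J"
proof -
  have inj: "inj \<iota>" using mono by (metis injI less_irrefl linorder_neqE)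
  have "\<iota> ` L - \<iota> ` J = \<iota> ` (L - J)" using inj by (simp add: image_set_diff)
  then show ?thesis unfolding kdiff_def
    using inj by (simp add: sum.reindex inj_on_subset ksign_image[OF mono])
qed

text \<open>Signs depend on the order, hence order embeddings. The purpose is to index the variables
  by natural numbers, leaving room behind them for further ring elements.\<close>

lemma (in cring_ideal) koszul_vanishing_image:
  fixes \<iota> :: "'v::linorder \<Rightarrow> 'l::linorder"
  assumes mono: "\<And>a b. \<iota> a < \<iota> b \<longleftrightarrow> a < b"
    and V: "koszul_vanishing (\<lambda>v. y (\<iota> v)) L m"
  shows "koszul_vanishing y (\<iota> ` L) m"
  unfolding koszul_vanishing_def
proof (intro ballI impI)
  fix z :: "'l set \<Rightarrow> 'a" assume z: "z \<in> kchains (\<iota> ` L) m" "kcycle y (\<iota> ` L) z"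
  have inj: "inj \<iota>" using mono by (metis injI less_irrefl linorder_neqE)
  define z' where "z' F = z (\<iota> ` F)" for F
  have "z' \<in> kchains L m"
  proof (rule kchainsI)
    fix F assume "z' F \<noteq> 0"
    then have "\<iota> ` F \<subseteq> \<iota> ` L" "m \<le> card (\<iota> ` F)" using z(1) by (auto simp: z'_def kchains_def)
    then show "F \<subseteq> L \<and> m \<le> card F" using inj by (simp add: inj_image_subset_iff card_image inj_on_subset)
  qed
  moreover have "kcycle (\<lambda>v. y (\<iota> v)) L z'"
    using z(2) kdiff_image[OF mono, of y L z] unfolding kcycle_def z'_def by metis
  ultimately obtain w' where w': "w' \<in> kchains L (Suc m)" "\<And>F. z' F - kdiff (\<lambda>v. y (\<iota> v)) L w' F \<in> I"
    using V unfolding koszul_vanishing_def kboundary_def by blast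
  define w where "w K = (if K \<subseteq> \<iota> ` L then w' (\<iota> -` K) else 0)" for K
  have wi: "w (\<iota> ` F) = w' F" for F
    using w'(1) inj by (auto simp: w_def inj_vimage_image_eq inj_image_subset_iff kchains_def)
  have im: "\<exists>F\<subseteq>L. K = \<iota> ` F" if "K \<subseteq> \<iota> ` L" for K using that by (rule subset_imageE) auto
  have "w \<in> kchains (\<iota> ` L) (Suc m)"
  proof (rule kchainsI)
    fix K assume K: "w K \<noteq> 0"
    then have sub: "K \<subseteq> \<iota> ` L" by (auto simp: w_def split: if_splits)
    then obtain F where F: "K = \<iota> ` F" using im by blast
    then have "w' F \<noteq> 0" using K wi by simp
    then have "Suc m \<le> card F" using w'(1) by (auto simp: kchains_def)
    then show "K \<subseteq> \<iota> ` L \<and> Suc m \<le> card K" using sub F inj by (simp add: card_image inj_on_subset)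
  qed
  moreover have "z K - kdiff y (\<iota> ` L) w K \<in> I" for K
  proof (cases "K \<subseteq> \<iota> ` L")
    case True
    then obtain F where F: "K = \<iota> ` F" using im by blast
    have "kdiff y (\<iota> ` L) w K = kdiff (\<lambda>v. y (\<iota> v)) L w' F"
      unfolding F kdiff_image[OF mono] wi ..
    then show ?thesis using w'(2)[of F] by (simp add: F z'_def)
  next
    case False
    then have "z K = 0" using z(1) by (auto simp: kchains_def)
    moreover have "w (insert l K) = 0" for l using False by (auto simp: w_def)
    ultimately show ?thesis by (simp add: kdiff_def)
  qed
  ultimately show "kboundary y (\<iota> ` L) m z" unfolding kboundary_def by blast
qed

section \<open>Elementary symmetric polynomials\<close>

definition esym :: "nat \<Rightarrow> ('v::finite, 'k::field) mpoly" where
  "esym k = (\<Sum>F | card F = k. \<Prod>v\<in>F. pvar v)"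

lemma homogeneous_esym: "homogeneous (int k) (esym k)"
  unfolding esym_def
proof (rule homogeneous_sum)
  fix F :: "'a set" assume "F \<in> {F. card F = k}"
  then show "homogeneous (int k) (\<Prod>v\<in>F. pvar v :: ('a, 'b) mpoly)"
    using homogeneous_monomial[of "mind F" "1 :: 'b"] by (simp add: prod_pvar)
qed

text \<open>
  Evaluating \<open>\<Prod>\<^sub>u (X - x\<^sub>u)\<close> at \<open>X = x\<^sub>v\<close> shows that every variable is nilpotent modulo the elementary
  symmetric polynomials.
\<close>

lemma pvar_power_esym:
  fixes v :: "'v::finite"
  shows "(pvar v :: ('v, 'k::field) mpoly) ^ CARD('v) =
    - (\<Sum>k = 1..CARD('v). esym k * ((- 1) ^ k * pvar v ^ (CARD('v) - k)))"
proof -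
  let ?n = "CARD('v)"
  have "0 = (\<Prod>u\<in>UNIV. pvar v - (pvar u :: ('v, 'k) mpoly))"
    by (rule sym, rule prod_zero) auto
  also have "\<dots> = (\<Sum>F\<in>Pow UNIV. (- 1) ^ card F * (\<Prod>u\<in>F. pvar u) * (\<Prod>u\<in>UNIV - F. pvar v))"
    by (rule prod_diff_conv_sum) simp
  also have "\<dots> = (\<Sum>F\<in>UNIV. (\<Prod>u\<in>F. pvar u) * ((- 1) ^ card F * pvar v ^ (?n - card F)))"
    by (rule sum.cong) (auto simp: card_Diff_subset mult_ac)
  also have "\<dots> = (\<Sum>k\<in>{0..?n}. \<Sum>F\<in>{F \<in> UNIV. card F = k}. (\<Prod>u\<in>F. pvar u) * ((- 1) ^ card F * pvar v ^ (?n - card F)))"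
    by (rule sum.group[symmetric]) (auto intro: card_mono[OF finite subset_UNIV])
  also have "\<dots> = (\<Sum>k\<in>{0..?n}. esym k * ((- 1) ^ k * pvar v ^ (?n - k)))"
    unfolding esym_def sum_distrib_right by (rule sum.cong) auto
  also have "\<dots> = esym 0 * ((- 1) ^ 0 * pvar v ^ ?n) + (\<Sum>k = 1..?n. esym k * ((- 1) ^ k * pvar v ^ (?n - k)))"
    by (simp add: sum.atLeast_Suc_atMost)
  also have "esym 0 = (1 :: ('v, 'k) mpoly)" by (simp add: esym_def)
  finally show ?thesis by (simp add: eq_neg_iff_add_eq_0)
qed

text \<open>The part of total degree \<open>t\<close> when \<open>e_l\<close> receives degree
  \<open>wt l\<close>. With \<open>y l\<close> homogeneous of degree \<open>wt l\<close> the Koszul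
  differential preserves this grading.\<close>

definition wpart :: "('l \<Rightarrow> nat) \<Rightarrow> int \<Rightarrow> ('l set \<Rightarrow> ('v::finite, 'k::field) mpoly) \<Rightarrow> 'l set \<Rightarrow> ('v, 'k) mpoly" where
  "wpart wt t z J = hpart (t - int (\<Sum>l\<in>J. wt l)) (z J)"

lemma wpart_kchains: "z \<in> kchains L m \<Longrightarrow> wpart wt t z \<in> kchains L m"
proof (rule kchainsI)
  fix J assume z: "z \<in> kchains L m" and "wpart wt t z J \<noteq> 0"
  then have "z J \<noteq> 0" by (auto simp: wpart_def)
  then show "J \<subseteq> L \<and> m \<le> card J" using z by (simp add: kchains_def)
qed

lemma wpart_negative:
  fixes z :: "'l set \<Rightarrow> ('v::finite, 'k::field) mpoly"
  assumes "t < 0"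
  shows "wpart wt t z J = 0"
proof (rule poly_mapping_eqI)
  fix a :: "'v \<Rightarrow>\<^sub>0 nat"
  have "0 \<le> int (mdeg a)" "0 \<le> int (\<Sum>l\<in>J. wt l)" by (rule of_nat_0_le_iff)+
  then have "int (mdeg a) \<noteq> t - int (\<Sum>l\<in>J. wt l)" using assms by linarith
  then show "Poly_Mapping.lookup (wpart wt t z J) a = Poly_Mapping.lookup 0 a"
    by (simp only: wpart_def lookup_hpart if_False lookup_zero)
qed

lemma hpart_ksign_times: "hpart t (ksign l J * p) = ksign l J * hpart t p"
  by (rule poly_mapping_eqI) (simp add: lookup_hpart lookup_ksign_times)

lemma kdiff_wpart:
  fixes y :: "'l::linorder \<Rightarrow> ('v::finite, 'k::field) mpoly"
  assumes z: "z \<in> kchains L m" and fin: "finite L" and hom: "\<And>l. l \<in> L \<Longrightarrow> homogeneous (int (wt l)) (y l)"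
  shows "kdiff y L (wpart wt t z) J = wpart wt t (kdiff y L z) J"
proof (cases "J \<subseteq> L")
  case True
  then have finJ: "finite J" using fin finite_subset by blast
  have "ksign l J * y l * wpart wt t z (insert l J) = hpart (t - int (\<Sum>l\<in>J. wt l)) (ksign l J * y l * z (insert l J))"
    if l: "l \<in> L - J" for l
  proof -
    define u where "u = t - int (\<Sum>l\<in>J. wt l)"
    have "t - int (\<Sum>l\<in>insert l J. wt l) = u - int (wt l)" using l finJ by (simp add: u_def)
    then have "wpart wt t z (insert l J) = hpart (u - int (wt l)) (z (insert l J))" by (simp only: wpart_def)
    moreover have "hpart u (ksign l J * y l * z (insert l J)) = ksign l J * (y l * hpart (u - int (wt l)) (z (insert l J)))"
      using hpart_mult'[OF hom, of l u "z (insert l J)"] l by (simp add: mult.assoc hpart_ksign_times)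
    ultimately show ?thesis unfolding u_def[symmetric] by (simp add: mult.assoc)
  qed
  then show ?thesis by (simp add: wpart_def[of wt t "kdiff y L z"] kdiff_def hpart_sum)
next
  case False
  then have "z (insert l J) = 0" for l using z by (auto simp: kchains_def)
  then show ?thesis by (simp add: kdiff_def wpart_def)
qed

text \<open>Graded Nakayama: by \<open>kcycle_split\<close> every class on \<open>L\<close> is
  \<open>y l\<close> times a class of smaller weighted degree, and below degree zero there are no
  chains. In contrast to \<open>koszul_vanishing_remove\<close> the level \<open>m\<close> is
  kept.\<close>

lemma koszul_vanishing_nakayama:
  fixes y :: "'l::linorder \<Rightarrow> ('v::finite, 'k::field) mpoly"
  assumes I: "cring_ideal I" and hp: "\<And>t p. p \<in> I \<Longrightarrow> hpart t p \<in> I"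
    and V: "cring_ideal.koszul_vanishing I y (insert l L) m" and l: "l \<notin> L" "finite L"
    and hom: "\<And>j. j \<in> insert l L \<Longrightarrow> homogeneous (int (wt j)) (y j)" and wt: "wt l > 0"
  shows "cring_ideal.koszul_vanishing I y L m"
proof -
  interpret cring_ideal I by (rule I)
  have homL: "\<And>j. j \<in> L \<Longrightarrow> homogeneous (int (wt j)) (y j)" using hom by simp
  have wcyc: "kcycle y L (wpart wt t z)" if "z \<in> kchains L k" "kcycle y L z" for t z k
    using that hp by (simp add: kcycle_def kdiff_wpart[OF that(1) l(2) homL] wpart_def)
  have wI: "wpart wt t z J - wpart wt t z' J \<in> I" if "z J - z' J \<in> I" for t z z' J
    using hp[OF that] by (simp add: wpart_def hpart_diff)
  \<comment> \<open>Indexing weighted degrees as \<open>int N - 1\<close> makes the base case degree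
    -1, where every part is zero.\<close>
  have hbd: "kboundary y L m (wpart wt (int N - 1) z)" if "z \<in> kchains L m" "kcycle y L z" for N z
    using that
  proof (induction N arbitrary: z rule: less_induct)
    case (less N)
    show ?case
    proof (cases "N = 0")
      case True
      have "wpart wt (int N - 1) z J = 0" for J using True by (intro wpart_negative) simp
      then show ?thesis by (intro kboundary_mem) simp
    next
      case False
      let ?t = "int N - 1"
      obtain w0 w1 where w: "w0 \<in> kchains L (Suc m)" "w1 \<in> kchains L m" "kcycle y L w1"
        "\<And>J. z J - (kdiff y L w0 J + y l * w1 J) \<in> I"
        using kcycle_split[OF V l less.prems] by blast
      define N' where "N' = N - wt l"
      have b1: "kboundary y L m (wpart wt (?t - int (wt l)) w1)"
      proof (cases "wt l \<le> N")
        case True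
        have "N' < N" using False wt by (simp add: N'_def)
        moreover have eq: "?t - int (wt l) = int N' - 1" using True by (simp add: N'_def)
        ultimately show ?thesis unfolding eq using w(2,3) by (intro less.IH)
      next
        case False
        have "wpart wt (?t - int (wt l)) w1 J = 0" for J using False by (intro wpart_negative) simp
        then show ?thesis by (intro kboundary_mem) simp
      qed
      have b0: "kboundary y L m (\<lambda>J. kdiff y L (wpart wt ?t w0) J)"
        unfolding kboundary_def using wpart_kchains[OF w(1)] by (intro bexI[of _ "wpart wt ?t w0"]) auto
      have "kboundary y L m (\<lambda>J. kdiff y L (wpart wt ?t w0) J + y l * wpart wt (?t - int (wt l)) w1 J)"
        by (intro kboundary_add b0 kboundary_mult b1)
      moreover have "wpart wt ?t z J - (kdiff y L (wpart wt ?t w0) J + y l * wpart wt (?t - int (wt l)) w1 J) \<in> I" for J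
      proof -
        have "hpart (?t - int (\<Sum>j\<in>J. wt j)) (y l * w1 J) = y l * wpart wt (?t - int (wt l)) w1 J"
          using hpart_mult'[OF hom[of l], of "?t - int (\<Sum>j\<in>J. wt j)" "w1 J"] by (simp add: wpart_def algebra_simps)
        then have "wpart wt ?t (\<lambda>J. kdiff y L w0 J + y l * w1 J) J = kdiff y L (wpart wt ?t w0) J + y l * wpart wt (?t - int (wt l)) w1 J"
          by (simp add: kdiff_wpart[OF w(1) l(2) homL]) (simp add: wpart_def hpart_add)
        then show ?thesis using wI[of z J "\<lambda>J. kdiff y L w0 J + y l * w1 J" ?t] w(4)[of J] by simp
      qed
      ultimately show ?thesis by (rule kboundary_cong)
    qed
  qed
  show ?thesis unfolding koszul_vanishing_def
  proof (intro ballI impI)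
    fix z assume z: "z \<in> kchains L m" "kcycle y L z"
    \<comment> \<open>All weighted degrees occurring in \<open>z\<close>; finitely many, so
      \<open>z\<close> is the finite sum of its parts.\<close>
    define T where "T = (\<Union>J\<in>Pow L. (\<lambda>a. mdeg a + (\<Sum>j\<in>J. wt j)) ` Poly_Mapping.keys (z J))"
    have finT: "finite T" using l by (simp add: T_def)
    have "kboundary y L m (\<lambda>J. \<Sum>t\<in>T. wpart wt (int (Suc t) - 1) z J)"
      using hbd[OF z] by (intro kboundary_sum finT) blast
    moreover have "(\<Sum>t\<in>T. wpart wt (int (Suc t) - 1) z J) = z J" for J
    proof (rule poly_mapping_eqI)
      fix a
      have "Poly_Mapping.lookup (\<Sum>t\<in>T. wpart wt (int (Suc t) - 1) z J) a =
        (\<Sum>t\<in>T. if t = mdeg a + (\<Sum>j\<in>J. wt j) then Poly_Mapping.lookup (z J) a else 0)"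
        unfolding lookup_sum
      proof (rule sum.cong)
        fix t
        have "int (mdeg a) = int (Suc t) - 1 - int (\<Sum>j\<in>J. wt j) \<longleftrightarrow> t = mdeg a + (\<Sum>j\<in>J. wt j)" by linarith
        then show "Poly_Mapping.lookup (wpart wt (int (Suc t) - 1) z J) a =
            (if t = mdeg a + (\<Sum>j\<in>J. wt j) then Poly_Mapping.lookup (z J) a else 0)"
          by (simp only: wpart_def lookup_hpart)
      qed simp
      also have "\<dots> = Poly_Mapping.lookup (z J) a"
      proof (cases "Poly_Mapping.lookup (z J) a = 0")
        case False
        then have "z J \<noteq> 0" by auto
        then have "J \<in> Pow L" using z(1) unfolding kchains_def by blast
        moreover have "a \<in> Poly_Mapping.keys (z J)" using False by (simp add: in_keys_iff)
        ultimately have "mdeg a + (\<Sum>j\<in>J. wt j) \<in> T" unfolding T_def by blast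
        then show ?thesis using finT by (simp add: sum.delta)
      qed (auto intro: sum.neutral)
      finally show "Poly_Mapping.lookup (\<Sum>t\<in>T. wpart wt (int (Suc t) - 1) z J) a = Poly_Mapping.lookup (z J) a" .
    qed
    ultimately show "kboundary y L m z" by simp
  qed
qed

text \<open>
  The Koszul complex on both the variables and the elementary symmetric polynomials: homology vanishes
  in high degrees because of the variables, and the variables can then be dropped one by one, being
  nilpotent on the homology.
\<close>

definition var_index :: "'v::{finite,linorder} \<Rightarrow> nat" where
  "var_index v = card {w. w < v}"

definition mixed_seq :: "nat \<Rightarrow> ('v::{finite,linorder}, 'k::field) mpoly" where
  "mixed_seq l = (if l < CARD('v) then pvar (inv_into UNIV var_index l) else esym (Suc (l - CARD('v))))"

lemma var_index_less_iff: "var_index a < var_index b \<longleftrightarrow> a < b" for a b :: "'v::{finite,linorder}"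
proof -
  have *: "var_index a < var_index b" if "a < b" for a b :: 'v
    unfolding var_index_def by (rule psubset_card_mono) (use that in auto)
  show ?thesis using *[of a b] *[of b a] by (metis less_asym less_irrefl linorder_neqE)
qed

lemma var_index_less: "var_index (v :: 'v::{finite,linorder}) < CARD('v)"
  unfolding var_index_def by (rule psubset_card_mono) auto

lemma mixed_seq_var: "mixed_seq (var_index v) = (pvar v :: ('v::{finite,linorder}, 'k::field) mpoly)"
proof -
  have "inj (var_index :: 'v \<Rightarrow> nat)" using var_index_less_iff by (metis injI less_irrefl linorder_neqE)
  then show ?thesis by (simp add: mixed_seq_def var_index_less inv_into_f_f)
qed

text \<open>Bookkeeping of levels: the homology on the variables vanishes from
  \<open>n - d + 1\<close> on. Adding \<open>d\<close> symmetric polynomials moves the level to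
  \<open>n + 1\<close>, and removing the \<open>n\<close> variables one at a time brings it down to
  1. From then on Nakayama keeps it at 1, and vanishing in degree 1 for each initial segment is
  regularity.\<close>

theorem (in skeletal_complex) esym_regular:
  assumes down: "down_closed \<Delta>" and onto: "cochains_onto TYPE('k::field) tops" and det: "cochains_determine TYPE('k) d tops"
    and d: "d < CARD('v)" and i: "i < d"
    and a: "esym (Suc i) * a - (\<Sum>j<i. esym (Suc j) * b j) \<in> (face_ideal \<Delta> :: ('v, 'k) mpoly set)"
  shows "\<exists>g. a - (\<Sum>j<i. esym (Suc j) * g j) \<in> (face_ideal \<Delta> :: ('v, 'k) mpoly set)"
proof -
  let ?n = "CARD('v)" and ?I = "face_ideal \<Delta> :: ('v, 'k) mpoly set"
  let ?y = "mixed_seq :: nat \<Rightarrow> ('v, 'k) mpoly"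
  let ?E = "{?n..<?n + d}"
  interpret cring_ideal ?I by (rule cring_ideal_face_ideal[OF down])
  have "koszul_vanishing pvar UNIV (Suc (?n - d))"
    by (rule koszul_vanishing_variables[OF down onto det]) (use d in auto)
  then have "koszul_vanishing (\<lambda>v :: 'v. ?y (var_index v)) UNIV (Suc (?n - d))" by (simp add: mixed_seq_var)
  then have "koszul_vanishing ?y (range (var_index :: 'v \<Rightarrow> nat)) (Suc (?n - d))"
    by (rule koszul_vanishing_image[OF var_index_less_iff])
  then have "koszul_vanishing ?y (?E \<union> range (var_index :: 'v \<Rightarrow> nat)) (card ?E + Suc (?n - d))"
  proof (rule koszul_vanishing_Un)
    show "?E \<inter> range (var_index :: 'v \<Rightarrow> nat) = {}"
    proof (rule ccontr)
      assume "?E \<inter> range (var_index :: 'v \<Rightarrow> nat) \<noteq> {}"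
      then obtain v :: 'v where "var_index v \<in> ?E" by blast
      then show False using var_index_less[of v] by simp
    qed
  qed simp_all
  moreover have "card (range (var_index :: 'v \<Rightarrow> nat)) = ?n"
    by (rule card_image) (metis injI less_irrefl linorder_neqE var_index_less_iff)
  ultimately have base: "koszul_vanishing ?y (?E \<union> range (var_index :: 'v \<Rightarrow> nat)) (Suc (card (range (var_index :: 'v \<Rightarrow> nat))))"
    using d by simp
  \<comment> \<open>By \<open>pvar_power_esym\<close> the \<open>n\<close>-th power of a variable is
    a combination of the \<open>esym k\<close>. Those with \<open>k \<le> d\<close> belong to the
    sequence and annihilate homology; those with \<open>k > d\<close> lie in the ideal because faces
    have at most \<open>d\<close> elements.\<close>
  have nil: "\<exists>t. kboundary ?y L m (\<lambda>J. ?y (var_index v) ^ t * z J)"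
    if L: "?E \<subseteq> L" "finite L" and z: "z \<in> kchains L m" "kcycle ?y L z" for L m z and v :: 'v
  proof
    have "kboundary ?y L m (\<lambda>J. \<Sum>k = 1..?n. (- ((- 1) ^ k * pvar v ^ (?n - k))) * (esym k * z J))"
    proof (rule kboundary_sum)
      fix k assume k: "k \<in> {1..?n}"
      have "kboundary ?y L m (\<lambda>J. esym k * z J)"
      proof (cases "k \<le> d")
        case True
        define l where "l = ?n + (k - 1)"
        have k1: "1 \<le> k" using k by simp
        have "?n \<le> l" "l < ?n + d" unfolding l_def using True k1 by arith+
        then have "l \<in> ?E" by simp
        then have "l \<in> L" using L(1) by blast
        moreover have "\<not> l < ?n" "Suc (l - ?n) = k" unfolding l_def using k1 by arith+
        then have "?y l = esym k" by (simp add: mixed_seq_def)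
        ultimately show ?thesis using kboundary_annihilate[OF z _ L(2), of l] by simp
      next
        case False
        have "esym k \<in> ?I" unfolding esym_def
        proof (rule sum_mem)
          fix F :: "'v set" assume "F \<in> {F. card F = k}"
          then have "F \<notin> \<Delta>" using False face_card by fastforce
          then show "(\<Prod>v\<in>F. pvar v) \<in> ?I" by (simp add: prod_pvar face_ideal_def)
        qed
        then show ?thesis by (intro kboundary_mem mult_mem_right)
      qed
      then show "kboundary ?y L m (\<lambda>J. (- ((- 1) ^ k * pvar v ^ (?n - k))) * (esym k * z J))"
        by (rule kboundary_mult)
    qed simp
    moreover have "?y (var_index v) ^ ?n * z J = (\<Sum>k = 1..?n. (- ((- 1) ^ k * pvar v ^ (?n - k))) * (esym k * z J))" for J
      unfolding mixed_seq_var pvar_power_esym by (simp add: sum_negf sum_distrib_right sum_distrib_left mult_ac)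
    ultimately show "kboundary ?y L m (\<lambda>J. ?y (var_index v) ^ ?n * z J)" by simp
  qed
  have removed: "koszul_vanishing ?y (?E \<union> (range (var_index :: 'v \<Rightarrow> nat) - W)) (Suc (card (range (var_index :: 'v \<Rightarrow> nat) - W)))"
    if "W \<subseteq> range (var_index :: 'v \<Rightarrow> nat)" "finite W" for W
    using that(2,1)
  proof (induction W rule: finite_induct)
    case empty
    then show ?case using base by simp
  next
    case (insert l W)
    let ?R = "range (var_index :: 'v \<Rightarrow> nat)"
    define L where "L = ?E \<union> (?R - insert l W)"
    have lR: "l \<in> ?R - W" using insert by auto
    then obtain v :: 'v where v: "l = var_index v" by blast
    have lL: "l \<notin> L" using var_index_less[of v] by (auto simp: L_def v)
    have ins: "?E \<union> (?R - W) = insert l L" using lR by (auto simp: L_def)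
    have Req: "?R - W = insert l (?R - insert l W)" using lR by auto
    have "card (insert l (?R - insert l W)) = Suc (card (?R - insert l W))"
      by (rule card_insert_disjoint) simp_all
    then have c: "card (?R - W) = Suc (card (?R - insert l W))" by (simp only: Req)
    have V: "koszul_vanishing ?y (insert l L) (Suc (Suc (card (?R - insert l W))))"
    proof -
      have "koszul_vanishing ?y (?E \<union> (?R - W)) (Suc (card (?R - W)))"
        by (rule insert.IH) (use insert.prems in blast)
      then show ?thesis unfolding ins c .
    qed
    show ?case unfolding L_def[symmetric]
    proof (rule koszul_vanishing_remove[OF V lL])
      show "finite L" by (simp add: L_def)
      fix z assume z: "z \<in> kchains L (Suc (card (?R - insert l W)))" "kcycle ?y L z"
      have "\<exists>t. kboundary ?y L (Suc (card (?R - insert l W))) (\<lambda>J. ?y (var_index v) ^ t * z J)"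
        by (rule nil[OF _ _ z]) (simp_all add: L_def)
      then show "\<exists>t. kboundary ?y L (Suc (card (?R - insert l W))) (\<lambda>J. ?y l ^ t * z J)" by (simp only: v)
    qed
  qed
  have E: "koszul_vanishing ?y ?E 1" using removed[OF subset_refl] by simp
  define wt where "wt l = Suc (l - ?n)" for l
  have hom: "homogeneous (int (wt l)) (?y l)" if "l \<ge> ?n" for l
    using that homogeneous_esym[of "Suc (l - ?n)"] by (simp add: mixed_seq_def wt_def)
  \<comment> \<open>The symmetric polynomials are dropped from the highest degree downwards, which
    leaves initial segments.\<close>
  have Ek: "koszul_vanishing ?y {?n..<?n + (d - k)} 1" if "k \<le> d" for k
    using that
  proof (induction k)
    case 0 then show ?case using E by simp
  next
    case (Suc k)
    have ins: "{?n..<?n + (d - k)} = insert (?n + (d - Suc k)) {?n..<?n + (d - Suc k)}" using Suc.prems by auto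
    show ?case
    proof (rule koszul_vanishing_nakayama[where wt = wt and l = "?n + (d - Suc k)"])
      show "cring_ideal ?I" by (rule cring_ideal_axioms)
      show "koszul_vanishing ?y (insert (?n + (d - Suc k)) {?n..<?n + (d - Suc k)}) 1"
        unfolding ins[symmetric] using Suc.IH Suc.prems by simp
      show "homogeneous (int (wt j)) (?y j)" if "j \<in> insert (?n + (d - Suc k)) {?n..<?n + (d - Suc k)}" for j
        by (rule hom) (use that in auto)
    qed (simp_all add: wt_def hpart_face_ideal)
  qed
  have "{?n..<?n + Suc i} = insert (?n + i) {?n..<?n + i}" by auto
  moreover have "d - (d - Suc i) = Suc i" using i by simp
  ultimately have V: "koszul_vanishing ?y (insert (?n + i) {?n..<?n + i}) 1"
    using Ek[of "d - Suc i"] by simp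
  have re: "(\<Sum>l\<in>{?n..<?n + i}. ?y l * h (l - ?n)) = (\<Sum>j<i. esym (Suc j) * h j)" for h
    by (rule sum.reindex_bij_witness[of _ "\<lambda>j. ?n + j" "\<lambda>l. l - ?n"]) (auto simp: mixed_seq_def)
  have "?y (?n + i) * a - (\<Sum>l\<in>{?n..<?n + i}. ?y l * b (l - ?n)) \<in> ?I"
    unfolding re using a by (simp add: mixed_seq_def)
  then obtain g where g: "a - (\<Sum>l\<in>{?n..<?n + i}. ?y l * g l) \<in> ?I"
    using koszul_vanishing_regular[OF V, where a = a and b = "\<lambda>l. b (l - ?n)"] by auto
  have "(\<Sum>l\<in>{?n..<?n + i}. ?y l * g l) = (\<Sum>l\<in>{?n..<?n + i}. ?y l * (\<lambda>j. g (?n + j)) (l - ?n))"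
    by (rule sum.cong) auto
  also have "\<dots> = (\<Sum>j<i. esym (Suc j) * g (?n + j))" by (rule re)
  finally show ?thesis using g by (intro exI[of _ "\<lambda>j. g (?n + j)"]) simp
qed

section \<open>Dimension bounds from algebraic dependence\<close>

text \<open>A homogeneous linear system with more unknowns than equations, by elimination: the
  unknown \<open>e0\<close> is solved for in the equation \<open>s\<close> and substituted into the
  others.\<close>

lemma linear_dependence:
  fixes f :: "'e \<Rightarrow> 's \<Rightarrow> 'k::field"
  assumes "finite S" "finite E" "card S < card E"
  shows "\<exists>c. (\<exists>e\<in>E. c e \<noteq> 0) \<and> (\<forall>s\<in>S. (\<Sum>e\<in>E. c e * f e s) = 0)"
  using assms
proof (induction S arbitrary: E f rule: finite_induct)
  case empty
  then have "E \<noteq> {}" by auto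
  then show ?case by (intro exI[of _ "\<lambda>_. 1"]) auto
next
  case (insert s S)
  show ?case
  proof (cases "\<forall>e\<in>E. f e s = 0")
    case True
    have "card S < card E" using insert by simp
    then obtain c where "\<exists>e\<in>E. c e \<noteq> 0" "\<forall>s\<in>S. (\<Sum>e\<in>E. c e * f e s) = 0"
      using insert.IH[of E f] insert.prems(1) by blast
    then show ?thesis using True by (intro exI[of _ c]) (simp add: sum.neutral)
  next
    case False
    then obtain e0 where e0: "e0 \<in> E" "f e0 s \<noteq> 0" by blast
    define E' where "E' = E - {e0}"
    have E: "E = insert e0 E'" "e0 \<notin> E'" "finite E'" using e0 insert.prems(1) by (auto simp: E'_def)
    have "card S < card E'" using insert.prems insert.hyps E by simp
    then obtain c where c: "\<exists>e\<in>E'. c e \<noteq> 0" "\<forall>t\<in>S. (\<Sum>e\<in>E'. c e * (f e t - f e s / f e0 s * f e0 t)) = 0"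
      using insert.IH[of E' "\<lambda>e t. f e t - f e s / f e0 s * f e0 t"] E(3) by blast
    define r where "r = - (\<Sum>e\<in>E'. c e * f e s) / f e0 s"
    define c' where "c' e = (if e = e0 then r else c e)" for e
    have sum: "(\<Sum>e\<in>E. c' e * f e t) = r * f e0 t + (\<Sum>e\<in>E'. c e * f e t)" for t
    proof -
      have "(\<Sum>e\<in>E'. c' e * f e t) = (\<Sum>e\<in>E'. c e * f e t)"
        by (rule sum.cong) (use E(2) in \<open>auto simp: c'_def\<close>)
      then show ?thesis using E by (simp add: c'_def)
    qed
    have "(\<Sum>e\<in>E. c' e * f e t) = 0" if "t \<in> insert s S" for t
    proof (cases "t = s")
      case True
      then show ?thesis unfolding sum r_def using e0(2) by simp
    next
      case False
      then have "(\<Sum>e\<in>E'. c e * (f e t - f e s / f e0 s * f e0 t)) = 0" using c(2) that by blast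
      moreover have "(\<Sum>e\<in>E'. c e * (f e t - f e s / f e0 s * f e0 t)) =
          (\<Sum>e\<in>E'. c e * f e t) - (\<Sum>e\<in>E'. c e * f e s) * (f e0 t / f e0 s)"
        unfolding sum_distrib_right sum_subtractf[symmetric]
        by (rule sum.cong) (simp_all add: right_diff_distrib)
      ultimately have "(\<Sum>e\<in>E'. c e * f e t) - (\<Sum>e\<in>E'. c e * f e s) * (f e0 t / f e0 s) = 0" by simp
      then show ?thesis unfolding sum r_def by (simp add: field_simps)
    qed
    moreover have "\<exists>e\<in>E. c' e \<noteq> 0"
    proof -
      obtain e where "e \<in> E'" "c e \<noteq> 0" using c(1) by blast
      then show ?thesis using E by (intro bexI[of _ e]) (auto simp: c'_def)
    qed
    ultimately show ?thesis by blast
  qed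
qed

text \<open>
  The chain \<open>J 0 \<subseteq> \<dots> \<subseteq> J m\<close> covers both a chain of prime ideals (with \<open>y i \<in> J (i + 1) - J i\<close>) and
  the ideals generated by the initial segments of a regular sequence \<open>y\<close>.  Dividing out the lowest
  power of \<open>y 0\<close>, then of \<open>y 1\<close> and so on, a relation between the \<open>y i\<close> would put a unit into \<open>J m\<close>.
\<close>

locale ideal_chain =
  fixes J :: "nat \<Rightarrow> ('v::finite, 'k::field) mpoly set" and y :: "nat \<Rightarrow> ('v, 'k) mpoly" and m :: nat
  assumes ideal: "i \<le> m \<Longrightarrow> cring_ideal (J i)"
    and mono: "i < m \<Longrightarrow> J i \<subseteq> J (Suc i)"
    and y_mem: "i < m \<Longrightarrow> y i \<in> J (Suc i)"
    and y_cancel: "i < m \<Longrightarrow> y i * a \<in> J i \<Longrightarrow> a \<in> J i"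
    and proper: "1 \<notin> J m"
begin

fun ymono :: "nat \<Rightarrow> nat list \<Rightarrow> ('v, 'k) mpoly" where
  "ymono i [] = 1"
| "ymono i (a # as) = y i ^ a * ymono (Suc i) as"

lemma y_power_cancel: "i < m \<Longrightarrow> y i ^ t * a \<in> J i \<Longrightarrow> a \<in> J i"
  by (induction t) (auto simp: mult.assoc dest: y_cancel)

lemma no_relation:
  assumes "i + n = m" "finite A" "\<And>\<alpha>. \<alpha> \<in> A \<Longrightarrow> length \<alpha> = n" "\<exists>\<alpha>\<in>A. c \<alpha> \<noteq> 0"
    "(\<Sum>\<alpha>\<in>A. Poly_Mapping.single 0 (c \<alpha>) * ymono i \<alpha>) \<in> J i"
  shows False
  using assms
proof (induction n arbitrary: i A c)
  case 0
  interpret cring_ideal "J m" by (rule ideal) simp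
  have "A = {[]}" using 0 by auto
  then have c: "c [] \<noteq> 0" "Poly_Mapping.single 0 (c []) \<in> J m" using 0 by auto
  then have "Poly_Mapping.single 0 (inverse (c [])) * Poly_Mapping.single 0 (c []) \<in> J m" by (intro mult_mem)
  then show False using proper c(1) by (simp add: mult_single)
next
  case (Suc n)
  have im: "i < m" using Suc.prems(1) by simp
  interpret K: cring_ideal "J (Suc i)" by (rule ideal) (use im in simp)
  define A' where "A' = {\<alpha> \<in> A. c \<alpha> \<noteq> 0}"
  have A': "finite A'" "A' \<noteq> {}" "\<And>\<alpha>. \<alpha> \<in> A' \<Longrightarrow> length \<alpha> = Suc n" using Suc.prems by (auto simp: A'_def)
  define t where "t = Min (hd ` A')"
  have t_le: "t \<le> hd \<alpha>" if "\<alpha> \<in> A'" for \<alpha> unfolding t_def using that A'(1) by (intro Min_le) auto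
  have t_in: "t \<in> hd ` A'" unfolding t_def using A' by (intro Min_in) auto
  have ym: "ymono i \<alpha> = y i ^ t * (y i ^ (hd \<alpha> - t) * ymono (Suc i) (tl \<alpha>))" if "\<alpha> \<in> A'" for \<alpha>
  proof (cases \<alpha>)
    case Nil
    then show ?thesis using A'(3)[OF that] by simp
  next
    case (Cons a as)
    then show ?thesis using t_le[OF that] by (simp flip: mult.assoc power_add)
  qed
  have "(\<Sum>\<alpha>\<in>A. Poly_Mapping.single 0 (c \<alpha>) * ymono i \<alpha>) = (\<Sum>\<alpha>\<in>A'. Poly_Mapping.single 0 (c \<alpha>) * ymono i \<alpha>)"
    unfolding A'_def using Suc.prems(2) by (intro sum.mono_neutral_right) auto
  also have "\<dots> = y i ^ t * (\<Sum>\<alpha>\<in>A'. Poly_Mapping.single 0 (c \<alpha>) * (y i ^ (hd \<alpha> - t) * ymono (Suc i) (tl \<alpha>)))"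
    unfolding sum_distrib_left by (rule sum.cong) (simp_all add: ym mult_ac)
  finally have "(\<Sum>\<alpha>\<in>A'. Poly_Mapping.single 0 (c \<alpha>) * (y i ^ (hd \<alpha> - t) * ymono (Suc i) (tl \<alpha>))) \<in> J i"
    using Suc.prems(5) y_power_cancel[OF im] by simp
  then have S: "(\<Sum>\<alpha>\<in>A'. Poly_Mapping.single 0 (c \<alpha>) * (y i ^ (hd \<alpha> - t) * ymono (Suc i) (tl \<alpha>))) \<in> J (Suc i)"
    using mono[OF im] by blast
  \<comment> \<open>Modulo \<open>J (Suc i)\<close> every term that keeps a positive power of
    \<open>y i\<close> disappears, so only lists starting with \<open>t\<close> survive. Stripping
    their heads gives a relation one step further up the chain.\<close>
  define L where "L = {\<alpha> \<in> A'. hd \<alpha> = t}"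
  define H where "H = {\<alpha> \<in> A'. hd \<alpha> \<noteq> t}"
  have LH: "A' = L \<union> H" "L \<inter> H = {}" "finite L" "finite H" using A'(1) by (auto simp: L_def H_def)
  have "(\<Sum>\<alpha>\<in>H. Poly_Mapping.single 0 (c \<alpha>) * (y i ^ (hd \<alpha> - t) * ymono (Suc i) (tl \<alpha>))) \<in> J (Suc i)"
  proof (rule K.sum_mem)
    fix \<alpha> assume "\<alpha> \<in> H"
    then have "hd \<alpha> - t \<noteq> 0" using t_le by (fastforce simp: H_def)
    then obtain k where "hd \<alpha> - t = Suc k" using not0_implies_Suc by blast
    then have "y i ^ (hd \<alpha> - t) * ymono (Suc i) (tl \<alpha>) = (y i ^ k * ymono (Suc i) (tl \<alpha>)) * y i" by simp
    then show "Poly_Mapping.single 0 (c \<alpha>) * (y i ^ (hd \<alpha> - t) * ymono (Suc i) (tl \<alpha>)) \<in> J (Suc i)"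
      using y_mem[OF im] by (simp only:) (intro K.mult_mem)
  qed
  then have "(\<Sum>\<alpha>\<in>A'. Poly_Mapping.single 0 (c \<alpha>) * (y i ^ (hd \<alpha> - t) * ymono (Suc i) (tl \<alpha>))) -
      (\<Sum>\<alpha>\<in>H. Poly_Mapping.single 0 (c \<alpha>) * (y i ^ (hd \<alpha> - t) * ymono (Suc i) (tl \<alpha>))) \<in> J (Suc i)"
    by (rule K.diff_mem[OF S])
  then have "(\<Sum>\<alpha>\<in>L. Poly_Mapping.single 0 (c \<alpha>) * (y i ^ (hd \<alpha> - t) * ymono (Suc i) (tl \<alpha>))) \<in> J (Suc i)"
    unfolding LH(1) sum.union_disjoint[OF LH(3,4,2)] by simp
  moreover have "(\<Sum>\<alpha>\<in>L. Poly_Mapping.single 0 (c \<alpha>) * (y i ^ (hd \<alpha> - t) * ymono (Suc i) (tl \<alpha>)))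
     = (\<Sum>\<beta>\<in>tl ` L. Poly_Mapping.single 0 (c (t # \<beta>)) * ymono (Suc i) \<beta>)"
  proof -
    have con: "t # tl \<alpha> = \<alpha>" if "\<alpha> \<in> L" for \<alpha>
      using that A'(3)[of \<alpha>] by (cases \<alpha>) (auto simp: L_def)
    have inj: "inj_on tl L" by (rule inj_onI) (metis con)
    show ?thesis unfolding sum.reindex[OF inj] by (rule sum.cong) (simp_all add: con L_def)
  qed
  ultimately have rel: "(\<Sum>\<beta>\<in>tl ` L. Poly_Mapping.single 0 (c (t # \<beta>)) * ymono (Suc i) \<beta>) \<in> J (Suc i)" by simp
  show False
  proof (rule Suc.IH[OF _ _ _ _ rel])
    show "Suc i + n = m" using Suc.prems(1) by simp
    show "finite (tl ` L)" using LH by simp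
    show "length \<beta> = n" if "\<beta> \<in> tl ` L" for \<beta> using that A'(3) by (auto simp: L_def)
    obtain \<alpha> where \<alpha>: "\<alpha> \<in> A'" "hd \<alpha> = t" using t_in by auto
    then have "t # tl \<alpha> = \<alpha>" using A'(3)[of \<alpha>] by (cases \<alpha>) auto
    then show "\<exists>\<beta>\<in>tl ` L. c (t # \<beta>) \<noteq> 0" using \<alpha> by (intro bexI[of _ "tl \<alpha>"]) (auto simp: A'_def L_def)
  qed
qed

end

section \<open>Growth of the number of monomials outside the face ideal\<close>

definition deg_le :: "nat \<Rightarrow> ('v::finite, 'k::field) mpoly \<Rightarrow> bool" where
  "deg_le b p \<longleftrightarrow> (\<forall>a\<in>Poly_Mapping.keys p. mdeg a \<le> b)"

lemma deg_le_mult: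
  assumes "deg_le b p" "deg_le c q"
  shows "deg_le (b + c) (p * q)"
  unfolding deg_le_def
proof
  fix a assume "a \<in> Poly_Mapping.keys (p * q)"
  then obtain u v where "u \<in> Poly_Mapping.keys p" "v \<in> Poly_Mapping.keys q" "a = u + v"
    using keys_mult[of p q] by blast
  then show "mdeg a \<le> b + c" using assms by (simp add: deg_le_def mdeg_add add_mono)
qed

lemma deg_le_1: "deg_le 0 1"
  by (simp add: deg_le_def)

lemma deg_le_power: "deg_le b p \<Longrightarrow> deg_le (b * n) (p ^ n)"
proof (induction n)
  case 0 then show ?case by (simp add: deg_le_1)
next
  case (Suc n) then show ?case using deg_le_mult[of b p "b * n" "p ^ n"] by simp
qed

lemma deg_le_mono: "deg_le b p \<Longrightarrow> b \<le> c \<Longrightarrow> deg_le c p"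
  unfolding deg_le_def by fastforce

text \<open>A monomial with support \<open>F\<close> and degree at most \<open>b\<close> is
  determined by \<open>card F \<le> d\<close> exponents in \<open>0..b\<close>.\<close>

lemma card_face_monomials:
  fixes \<Delta> :: "'v::finite set set"
  assumes "\<And>F. F \<in> \<Delta> \<Longrightarrow> card F \<le> d"
  shows "finite {a :: 'v \<Rightarrow>\<^sub>0 nat. Poly_Mapping.keys a \<in> \<Delta> \<and> mdeg a \<le> b}"
    and "card {a :: 'v \<Rightarrow>\<^sub>0 nat. Poly_Mapping.keys a \<in> \<Delta> \<and> mdeg a \<le> b} \<le> card \<Delta> * (b + 1) ^ d"
proof -
  define M where "M F = {a :: 'v \<Rightarrow>\<^sub>0 nat. Poly_Mapping.keys a = F \<and> mdeg a \<le> b}" for F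
  have M: "finite (M F) \<and> card (M F) \<le> (b + 1) ^ card F" for F
  proof -
    define \<phi> where "\<phi> a = restrict (Poly_Mapping.lookup a) F" for a :: "'v \<Rightarrow>\<^sub>0 nat"
    have "inj_on \<phi> (M F)"
    proof (rule inj_onI)
      fix a a' assume a: "a \<in> M F" "a' \<in> M F" "\<phi> a = \<phi> a'"
      show "a = a'"
      proof (rule poly_mapping_eqI)
        fix v
        show "Poly_Mapping.lookup a v = Poly_Mapping.lookup a' v"
        proof (cases "v \<in> F")
          case True
          then show ?thesis using fun_cong[OF a(3), of v] by (simp add: \<phi>_def)
        next
          case False
          then have "v \<notin> Poly_Mapping.keys a" "v \<notin> Poly_Mapping.keys a'" using a by (auto simp: M_def)
          then show ?thesis by (simp add: in_keys_iff)
        qed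
      qed
    qed
    moreover have "\<phi> ` M F \<subseteq> PiE F (\<lambda>_. {..b})"
    proof
      fix g assume "g \<in> \<phi> ` M F"
      then obtain a where a: "a \<in> M F" "g = \<phi> a" by blast
      have "Poly_Mapping.lookup a v \<le> mdeg a" for v
        unfolding mdeg_def by (rule member_le_sum) auto
      then have "Poly_Mapping.lookup a v \<le> b" for v using a(1) le_trans unfolding M_def by blast
      then show "g \<in> PiE F (\<lambda>_. {..b})" unfolding a(2) \<phi>_def by simp
    qed
    moreover have "finite (PiE F (\<lambda>_. {..b}))" "card (PiE F (\<lambda>_. {..b})) = (b + 1) ^ card F"
      by (simp_all add: finite_PiE card_PiE)
    ultimately show ?thesis by (metis card_inj_on_le finite_imageD finite_subset)
  qed
  have eq: "{a. Poly_Mapping.keys a \<in> \<Delta> \<and> mdeg a \<le> b} = (\<Union>F\<in>\<Delta>. M F)" by (auto simp: M_def)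
  show "finite {a :: 'v \<Rightarrow>\<^sub>0 nat. Poly_Mapping.keys a \<in> \<Delta> \<and> mdeg a \<le> b}" unfolding eq using M by simp
  have "card (\<Union>F\<in>\<Delta>. M F) \<le> (\<Sum>F\<in>\<Delta>. card (M F))" by (rule card_UN_le) simp
  also have "\<dots> \<le> (\<Sum>F\<in>\<Delta>. (b + 1) ^ d)"
  proof (rule sum_mono)
    fix F assume "F \<in> \<Delta>"
    then have "(b + 1) ^ card F \<le> (b + 1) ^ d" using assms by (intro power_increasing) auto
    then show "card (M F) \<le> (b + 1) ^ d" using M[of F] by linarith
  qed
  finally show "card {a :: 'v \<Rightarrow>\<^sub>0 nat. Poly_Mapping.keys a \<in> \<Delta> \<and> mdeg a \<le> b} \<le> card \<Delta> * (b + 1) ^ d"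
    unfolding eq by simp
qed

text \<open>There are \<open>N ^ (d + 1)\<close> monomials in \<open>y 0, ..., y d\<close> with
  exponents below \<open>N\<close>, of degree linear in \<open>N\<close>, while modulo the face
  ideal that much degree offers only of the order of \<open>N ^ d\<close> dimensions. For large
  \<open>N\<close> this forces a relation, against \<open>no_relation\<close>. Excluding the single
  length \<open>Suc d\<close> is enough, as longer chains can be cut off.\<close>

lemma ideal_chain_length:
  fixes \<Delta> :: "'v::finite set set"
  assumes chain: "ideal_chain J y m" and I: "(face_ideal \<Delta> :: ('v, 'k::field) mpoly set) \<subseteq> J 0"
    and card: "\<And>F. F \<in> \<Delta> \<Longrightarrow> card F \<le> d"
  shows "m \<noteq> Suc d"
proof
  assume m: "m = Suc d"
  interpret ideal_chain J y m by (rule chain)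
  define D0 where "D0 = Max (insert 0 (\<Union>i\<in>{..<m}. mdeg ` Poly_Mapping.keys (y i)))"
  have yd: "deg_le D0 (y i)" if "i < m" for i
    unfolding deg_le_def D0_def using that by (intro ballI Max_ge) auto
  \<comment> \<open>With \<open>b = m * (N * D0)\<close> one has
    \<open>b + 1 \<le> N * (m * D0 + 1)\<close>, so the face monomials of degree at most
    \<open>b\<close> number at most \<open>C * N ^ d\<close>; \<open>N = C + 1\<close> beats
    this.\<close>
  define C where "C = card \<Delta> * (m * D0 + 1) ^ d"
  define N where "N = Suc C"
  define E where "E = {\<alpha>. set \<alpha> \<subseteq> {..<N} \<and> length \<alpha> = m}"
  have E: "finite E" "card E = N ^ m"
    unfolding E_def using finite_lists_length_eq[of "{..<N}" m] card_lists_length_eq[of "{..<N}" m] by simp_all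
  have deg: "deg_le (n * (N * D0)) (ymono i \<alpha>)" if "i + n = m" "set \<alpha> \<subseteq> {..<N}" "length \<alpha> = n" for i n \<alpha>
    using that
  proof (induction \<alpha> arbitrary: i n)
    case Nil then show ?case by (simp add: deg_le_1)
  next
    case (Cons a \<alpha>)
    then obtain k where k: "n = Suc k" by (cases n) auto
    have "deg_le (D0 * a) (y i ^ a)" using Cons.prems k by (intro deg_le_power yd) simp
    then have "deg_le (N * D0) (y i ^ a)" using Cons.prems by (elim deg_le_mono) (simp add: mult.commute mult_le_mono)
    moreover have "deg_le (k * (N * D0)) (ymono (Suc i) \<alpha>)" using Cons.prems k by (intro Cons.IH) auto
    ultimately show ?case using deg_le_mult k by fastforce
  qed
  define b where "b = m * (N * D0)"
  define S where "S = {a :: 'v \<Rightarrow>\<^sub>0 nat. Poly_Mapping.keys a \<in> \<Delta> \<and> mdeg a \<le> b}"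
  have "card S < card E"
  proof -
    have "card S \<le> card \<Delta> * (b + 1) ^ d" unfolding S_def by (rule card_face_monomials(2)[OF card])
    also have "\<dots> \<le> card \<Delta> * (N * (m * D0 + 1)) ^ d"
      by (intro mult_le_mono2 power_mono) (simp_all add: b_def N_def algebra_simps)
    also have "\<dots> = C * N ^ d" unfolding C_def power_mult_distrib by (simp only: mult_ac)
    also have "\<dots> < N * N ^ d" by (rule mult_strict_right_mono) (simp_all add: N_def)
    also have "\<dots> = card E" by (simp add: E m)
    finally show ?thesis .
  qed
  then obtain c where c: "\<exists>\<alpha>\<in>E. c \<alpha> \<noteq> 0" "\<forall>a\<in>S. (\<Sum>\<alpha>\<in>E. c \<alpha> * Poly_Mapping.lookup (ymono 0 \<alpha>) a) = 0"
    using linear_dependence[of S E "\<lambda>\<alpha>. Poly_Mapping.lookup (ymono 0 \<alpha>)"] card_face_monomials(1)[OF card, of \<Delta> b] E(1)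
    unfolding S_def by blast
  have "(\<Sum>\<alpha>\<in>E. Poly_Mapping.single 0 (c \<alpha>) * ymono 0 \<alpha>) \<in> face_ideal \<Delta>"
  proof (rule face_idealI)
    fix a :: "'v \<Rightarrow>\<^sub>0 nat" assume a: "Poly_Mapping.keys a \<in> \<Delta>"
    have eq: "Poly_Mapping.lookup (\<Sum>\<alpha>\<in>E. Poly_Mapping.single 0 (c \<alpha>) * ymono 0 \<alpha>) a = (\<Sum>\<alpha>\<in>E. c \<alpha> * Poly_Mapping.lookup (ymono 0 \<alpha>) a)"
    proof -
      have "Poly_Mapping.lookup (Poly_Mapping.single 0 x * p) a = x * Poly_Mapping.lookup p a" for x :: 'k and p :: "('v, 'k) mpoly"
        using lookup_single_times[of 0 x p a] by simp
      then show ?thesis unfolding lookup_sum by simp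
    qed
    show "Poly_Mapping.lookup (\<Sum>\<alpha>\<in>E. Poly_Mapping.single 0 (c \<alpha>) * ymono 0 \<alpha>) a = 0"
    proof (cases "mdeg a \<le> b")
      case True
      then show ?thesis unfolding eq using c(2) a by (simp add: S_def)
    next
      case False
      have "Poly_Mapping.lookup (ymono 0 \<alpha>) a = 0" if "\<alpha> \<in> E" for \<alpha>
      proof (rule ccontr)
        assume "Poly_Mapping.lookup (ymono 0 \<alpha>) a \<noteq> 0"
        then have "a \<in> Poly_Mapping.keys (ymono 0 \<alpha>)" by (simp add: in_keys_iff)
        then show False using deg[of 0 m \<alpha>] that False by (auto simp: E_def deg_le_def b_def)
      qed
      then show ?thesis unfolding eq by (simp add: sum.neutral)
    qed
  qed
  then have rel: "(\<Sum>\<alpha>\<in>E. Poly_Mapping.single 0 (c \<alpha>) * ymono 0 \<alpha>) \<in> J 0" using I by blast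
  show False
    by (rule no_relation[OF _ E(1) _ c(1) rel, of m]) (simp_all add: E_def)
qed

section \<open>Ideals of the quotient ring\<close>

text \<open>Depth and Krull dimension are defined for the ring \<open>R Quot I\<close> of cosets.
  \<open>proj\<close> moves ideals between that ring and the plain sets of
  \<open>cring_ideal\<close>.\<close>

locale quotient_ring = cring_ideal I for I :: "('v::{finite,linorder}, 'k::field) mpoly set"
begin

abbreviation R :: "('v, 'k) mpoly ring" where "R \<equiv> ring_of_type_algebra"

abbreviation Q :: "('v, 'k) mpoly set ring" where "Q \<equiv> R Quot I"

definition proj :: "('v, 'k) mpoly \<Rightarrow> ('v, 'k) mpoly set" where "proj a = I +>\<^bsub>R\<^esub> a"

sublocale R: cring R by (rule cring_from_type_algebra)

lemma R_simps: "carrier R = UNIV" "a \<oplus>\<^bsub>R\<^esub> b = a + b" "a \<otimes>\<^bsub>R\<^esub> b = a * b" "\<zero>\<^bsub>R\<^esub> = 0" "\<one>\<^bsub>R\<^esub> = 1"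
  by (simp_all add: ring_of_type_algebra_def)

lemma R_minus: "\<ominus>\<^bsub>R\<^esub> a = - a"
  using R.minus_equality[of "- a" a] by (simp add: R_simps)

lemma ideal_R: "ideal I R"
proof (rule idealI)
  show "ring R" by (rule R.ring_axioms)
  show "subgroup I (add_monoid R)"
    by (rule R.add.subgroupI) (auto simp: R_simps R_minus intro: add_mem minus_mem)
qed (auto simp: R_simps intro: mult_mem mult_mem_right)

lemma cring_Q: "cring Q"
  by (rule ideal.quotient_is_cring[OF ideal_R R.cring_axioms])

sublocale Q: cring Q by (rule cring_Q)

lemma proj_hom: "proj \<in> ring_hom R Q"
proof -
  have "a_r_coset R I \<in> ring_hom R Q" by (rule ideal.rcos_ring_hom[OF ideal_R])
  moreover have "a_r_coset R I = proj" by (simp add: proj_def fun_eq_iff)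
  ultimately show ?thesis by simp
qed

lemma proj_closed [simp]: "proj a \<in> carrier Q"
  and proj_add: "proj (a + b) = proj a \<oplus>\<^bsub>Q\<^esub> proj b"
  and proj_mult: "proj (a * b) = proj a \<otimes>\<^bsub>Q\<^esub> proj b"
  and proj_1: "proj 1 = \<one>\<^bsub>Q\<^esub>"
  using ring_hom_closed[OF proj_hom, of a] ring_hom_add[OF proj_hom, of a b]
    ring_hom_mult[OF proj_hom, of a b] ring_hom_one[OF proj_hom] by (simp_all add: R_simps)

lemma proj_surj: "A \<in> carrier Q \<Longrightarrow> \<exists>a. A = proj a"
  by (auto simp: FactRing_def A_RCOSETS_def RCOSETS_def a_r_coset_def proj_def)

lemma proj_set: "proj a = {x. x - a \<in> I}"
proof -
  have "proj a = (\<lambda>i. i + a) ` I"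
    by (auto simp: proj_def a_r_coset_def r_coset_def R_simps[simplified] ring_of_type_algebra_def)
  also have "\<dots> = {x. x - a \<in> I}" by (force simp: image_iff)
  finally show ?thesis .
qed

lemma proj_eq_iff: "proj a = proj b \<longleftrightarrow> a - b \<in> I"
proof
  assume "proj a = proj b"
  then have "a \<in> proj b" using proj_set[of a] by auto
  then show "a - b \<in> I" by (simp add: proj_set)
next
  assume "a - b \<in> I"
  then show "proj a = proj b" unfolding proj_set using diff_mem_trans diff_mem_sym by blast
qed

lemma proj_0: "proj 0 = \<zero>\<^bsub>Q\<^esub>"
  using proj_add[of 0 0] Q.add.r_cancel_one'[of "proj 0" "proj 0"] by simp

lemma proj_uminus: "proj (- a) = \<ominus>\<^bsub>Q\<^esub> proj a"
  using proj_add[of "- a" a] proj_0 Q.minus_equality[of "proj (- a)" "proj a"] by simp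

lemma preimage_ideal:
  assumes "ideal P Q"
  shows "cring_ideal {a. proj a \<in> P}" "I \<subseteq> {a. proj a \<in> P}"
proof -
  interpret P: ideal P Q by (rule assms)
  have 0: "\<zero>\<^bsub>Q\<^esub> \<in> P" by (rule P.zero_closed)
  show "cring_ideal {a. proj a \<in> P}"
    by unfold_locales (auto simp: proj_0 proj_add proj_mult 0 intro: P.a_closed P.I_l_closed)
  show "I \<subseteq> {a. proj a \<in> P}"
  proof
    fix a assume "a \<in> I"
    then have "proj a = proj 0" by (simp add: proj_eq_iff)
    then show "a \<in> {a. proj a \<in> P}" using 0 by (simp add: proj_0)
  qed
qed

lemma image_ideal:
  assumes "cring_ideal J" "I \<subseteq> J"
  shows "ideal (proj ` J) Q" "proj a \<in> proj ` J \<longleftrightarrow> a \<in> J"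
proof -
  interpret J: cring_ideal J by (rule assms)
  show "ideal (proj ` J) Q"
  proof (rule idealI)
    show "ring Q" by (rule Q.ring_axioms)
    show "subgroup (proj ` J) (add_monoid Q)"
    proof (rule Q.add.subgroupI)
      show "proj ` J \<noteq> {}" by (metis J.zero_mem empty_iff image_is_empty)
      fix A assume "A \<in> proj ` J"
      then show "\<ominus>\<^bsub>Q\<^esub> A \<in> proj ` J" using J.minus_mem proj_uminus by (metis (no_types, lifting) imageE image_eqI)
      fix B assume "B \<in> proj ` J"
      then show "A \<oplus>\<^bsub>Q\<^esub> B \<in> proj ` J" using \<open>A \<in> proj ` J\<close> J.add_mem by (auto simp flip: proj_add)
    qed auto
  next
    fix A B assume A: "A \<in> proj ` J" and B: "B \<in> carrier Q"
    obtain a where a: "a \<in> J" "A = proj a" using A by blast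
    obtain b where b: "B = proj b" using proj_surj[OF B] by blast
    show "B \<otimes>\<^bsub>Q\<^esub> A \<in> proj ` J" using a b J.mult_mem by (simp flip: proj_mult)
    show "A \<otimes>\<^bsub>Q\<^esub> B \<in> proj ` J" using a b J.mult_mem_right by (simp flip: proj_mult)
  qed
  show "proj a \<in> proj ` J \<longleftrightarrow> a \<in> J"
  proof
    assume "proj a \<in> proj ` J"
    then obtain b where "b \<in> J" "a - b \<in> I" by (auto simp: proj_eq_iff)
    then show "a \<in> J" using assms(2) J.mem_cong by blast
  qed simp
qed

text \<open>The preimage of the ideal which the first \<open>i\<close> elements generate in the
  quotient, as \<open>genideal_span\<close> confirms.\<close>

definition span :: "nat \<Rightarrow> (nat \<Rightarrow> ('v, 'k) mpoly) \<Rightarrow> ('v, 'k) mpoly set" where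
  "span i \<theta> = {a. \<exists>g. a - (\<Sum>j<i. \<theta> j * g j) \<in> I}"

lemma span_ideal: "cring_ideal (span i \<theta>)" "I \<subseteq> span i \<theta>" "j < i \<Longrightarrow> \<theta> j \<in> span i \<theta>"
proof -
  show "I \<subseteq> span i \<theta>" unfolding span_def by (auto intro!: exI[of _ "\<lambda>_. 0"])
  show "cring_ideal (span i \<theta>)"
  proof
    show "0 \<in> span i \<theta>" unfolding span_def by (auto intro!: exI[of _ "\<lambda>_. 0"])
    fix a b assume "a \<in> span i \<theta>" "b \<in> span i \<theta>"
    then obtain g h where "a - (\<Sum>j<i. \<theta> j * g j) \<in> I" "b - (\<Sum>j<i. \<theta> j * h j) \<in> I" unfolding span_def by blast
    from add_mem[OF this] have "(a + b) - (\<Sum>j<i. \<theta> j * (g j + h j)) \<in> I"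
      by (simp add: distrib_left sum.distrib algebra_simps)
    then show "a + b \<in> span i \<theta>" unfolding span_def by (auto intro!: exI[of _ "\<lambda>j. g j + h j"])
  next
    fix r a assume "a \<in> span i \<theta>"
    then obtain g where "a - (\<Sum>j<i. \<theta> j * g j) \<in> I" unfolding span_def by blast
    from mult_mem[OF this, of r] have "r * a - (\<Sum>j<i. \<theta> j * (r * g j)) \<in> I"
      by (simp add: right_diff_distrib sum_distrib_left mult_ac)
    then show "r * a \<in> span i \<theta>" unfolding span_def by (auto intro!: exI[of _ "\<lambda>j. r * g j"])
  qed
  show "\<theta> j \<in> span i \<theta>" if "j < i"
  proof -
    have "(\<Sum>k<i. \<theta> k * (if k = j then 1 else 0)) = \<theta> j"
      using that by (simp add: if_distrib[of "\<lambda>c. _ * c"] sum.delta cong: if_cong)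
    then show ?thesis unfolding span_def by (auto intro!: exI[of _ "\<lambda>k. if k = j then 1 else 0"])
  qed
qed

lemma genideal_span: "genideal Q (proj ` \<theta> ` {..<i}) = proj ` span i \<theta>"
proof
  show "genideal Q (proj ` \<theta> ` {..<i}) \<subseteq> proj ` span i \<theta>"
    by (rule Q.genideal_minimal[OF image_ideal(1)[OF span_ideal(1,2)]]) (use span_ideal(3) in blast)
  have sub: "proj ` \<theta> ` {..<i} \<subseteq> carrier Q" by auto
  note G = Q.genideal_ideal[OF sub]
  interpret P: cring_ideal "{a. proj a \<in> genideal Q (proj ` \<theta> ` {..<i})}" by (rule preimage_ideal(1)[OF G])
  have \<theta>: "\<theta> j \<in> {a. proj a \<in> genideal Q (proj ` \<theta> ` {..<i})}" if "j < i" for j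
    using Q.genideal_self[OF sub] that by blast
  show "proj ` span i \<theta> \<subseteq> genideal Q (proj ` \<theta> ` {..<i})"
  proof clarify
    fix a assume "a \<in> span i \<theta>"
    then obtain g where g: "a - (\<Sum>j<i. \<theta> j * g j) \<in> I" unfolding span_def by blast
    have "(\<Sum>j<i. \<theta> j * g j) \<in> {a. proj a \<in> genideal Q (proj ` \<theta> ` {..<i})}"
      by (intro P.sum_mem P.mult_mem_right \<theta>) simp
    moreover have "a - (\<Sum>j<i. \<theta> j * g j) \<in> {a. proj a \<in> genideal Q (proj ` \<theta> ` {..<i})}"
      using preimage_ideal(2)[OF G] g by blast
    ultimately have "a \<in> {a. proj a \<in> genideal Q (proj ` \<theta> ` {..<i})}" using P.mem_cong by blast
    then show "proj a \<in> genideal Q (proj ` \<theta> ` {..<i})" by simp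
  qed
qed

end

section \<open>Bounds for Krull dimension and depth of the quotient\<close>

context quotient_ring
begin

lemma ideal_chain_preimage:
  assumes id: "\<And>i. i \<le> m \<Longrightarrow> ideal (P i) Q" and mono: "\<And>i. i < m \<Longrightarrow> P i \<subseteq> P (Suc i)"
    and y: "\<And>i. i < m \<Longrightarrow> proj (y i) \<in> P (Suc i)"
    and cancel: "\<And>i a. i < m \<Longrightarrow> proj (y i) \<otimes>\<^bsub>Q\<^esub> proj a \<in> P i \<Longrightarrow> proj a \<in> P i"
    and proper: "P m \<noteq> carrier Q"
  shows "ideal_chain (\<lambda>i. {a. proj a \<in> P i}) y m"
proof (rule ideal_chain.intro)
  show "cring_ideal {a. proj a \<in> P i}" if "i \<le> m" for i by (rule preimage_ideal(1)[OF id[OF that]])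
  show "{a. proj a \<in> P i} \<subseteq> {a. proj a \<in> P (Suc i)}" if "i < m" for i using mono[OF that] by blast
  show "y i \<in> {a. proj a \<in> P (Suc i)}" if "i < m" for i using y[OF that] by simp
  show "a \<in> {a. proj a \<in> P i}" if "i < m" "y i * a \<in> {a. proj a \<in> P i}" for i a
    using cancel[OF that(1), of a] that(2) by (simp add: proj_mult)
  show "1 \<notin> {a. proj a \<in> P m}" using ideal.one_imp_carrier[OF id[of m]] proper by (auto simp: proj_1)
qed

lemma prime_image:
  assumes J: "cring_ideal J" "I \<subseteq> J" "1 \<notin> J" and prime: "\<And>a b. a * b \<in> J \<Longrightarrow> a \<in> J \<or> b \<in> J"
  shows "primeideal (proj ` J) Q"
proof (rule primeidealI)
  show "ideal (proj ` J) Q" by (rule image_ideal(1)[OF J(1,2)])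
  show "cring Q" by (rule cring_Q)
  show "carrier Q \<noteq> proj ` J"
    using image_ideal(2)[OF J(1,2), of 1] J(3) proj_closed[of 1] by blast
  fix A B assume "A \<in> carrier Q" "B \<in> carrier Q" and AB: "A \<otimes>\<^bsub>Q\<^esub> B \<in> proj ` J"
  then obtain a b where "A = proj a" "B = proj b" using proj_surj by blast
  then show "A \<in> proj ` J \<or> B \<in> proj ` J"
    using AB prime image_ideal(2)[OF J(1,2)] by (simp flip: proj_mult)
qed

text \<open>The first \<open>Suc d\<close> steps of a longer prime chain form an
  \<open>ideal_chain\<close>: an element \<open>y i\<close> of \<open>P (Suc i)\<close> outside
  \<open>P i\<close> can be cancelled modulo \<open>P i\<close> because \<open>P i\<close> is
  prime.\<close>

lemma krull_dim_le:
  assumes chain: "\<And>J y m. ideal_chain J y m \<Longrightarrow> I \<subseteq> J 0 \<Longrightarrow> m \<noteq> Suc d"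
  shows "krull_dim Q \<le> enat d"
  unfolding krull_dim_def
proof (rule Sup_least, clarify)
  fix l and P :: "nat \<Rightarrow> ('v, 'k) mpoly set set"
  assume P: "\<forall>i\<le>l. primeideal (P i) Q" "\<forall>i<l. P i \<subset> P (Suc i)"
  show "enat l \<le> enat d"
  proof (rule ccontr)
    assume "\<not> enat l \<le> enat d"
    then have l: "Suc d \<le> l" by simp
    have id: "ideal (P i) Q" if "i \<le> Suc d" for i
      using P(1) that l by (auto intro: primeideal.axioms(1))
    have "\<exists>a. i < Suc d \<longrightarrow> proj a \<in> P (Suc i) \<and> proj a \<notin> P i" for i
    proof (cases "i < Suc d")
      case True
      then obtain A where A: "A \<in> P (Suc i)" "A \<notin> P i" using P(2) l by (meson less_le_trans psubset_imp_ex_mem DiffE)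
      moreover have "A \<in> carrier Q" using ideal.Icarr[OF id[of "Suc i"]] A True by simp
      ultimately show ?thesis using proj_surj by blast
    qed simp
    then obtain y where y: "\<And>i. i < Suc d \<Longrightarrow> proj (y i) \<in> P (Suc i) \<and> proj (y i) \<notin> P i" by metis
    have "ideal_chain (\<lambda>i. {a. proj a \<in> P i}) y (Suc d)"
    proof (rule ideal_chain_preimage)
      show "proj a \<in> P i" if "i < Suc d" "proj (y i) \<otimes>\<^bsub>Q\<^esub> proj a \<in> P i" for i a
        using primeideal.I_prime[of "P i" Q "proj (y i)" "proj a"] P(1) y[OF that(1)] that l by auto
      show "P (Suc d) \<noteq> carrier Q" using primeideal.I_notcarr[of "P (Suc d)" Q] P(1) l by auto
      show "P i \<subseteq> P (Suc i)" if "i < Suc d" for i using P(2) that l by (meson less_le_trans psubset_imp_subset)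
    qed (use id y in auto)
    then show False
      using chain[of "\<lambda>i. {a. proj a \<in> P i}" y "Suc d"] preimage_ideal(2)[OF id[of 0]] by simp
  qed
qed

text \<open>Here the chain consists of the ideals generated by initial segments: cancellation is the
  nonzerodivisor condition, and properness is inherited from the ideal of the whole
  sequence.\<close>

lemma depth_le:
  assumes chain: "\<And>J y m. ideal_chain J y m \<Longrightarrow> I \<subseteq> J 0 \<Longrightarrow> m \<noteq> Suc d"
  shows "depth Q A \<le> enat d"
  unfolding depth_def
proof (rule Sup_least, clarify)
  fix fs assume reg: "regular_sequence Q fs"
  show "enat (length fs) \<le> enat d"
  proof (rule ccontr)
    assume "\<not> ?thesis"
    then have l: "Suc d \<le> length fs" by simp
    have carr: "set fs \<subseteq> carrier Q" using reg by (simp add: regular_sequence_def)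
    have nonzerodivisor: "\<forall>i < length fs. \<forall>a\<in>carrier Q. fs ! i \<otimes>\<^bsub>Q\<^esub> a \<in> genideal Q (set (take i fs)) \<longrightarrow>
        a \<in> genideal Q (set (take i fs))"
      using reg unfolding regular_sequence_def by (elim conjE)
    have sub: "set (take i fs) \<subseteq> carrier Q" "set fs \<subseteq> carrier Q" for i
      using carr set_take_subset[of i fs] by simp_all
    have id: "ideal (genideal Q (set (take i fs))) Q" for i by (rule Q.genideal_ideal[OF sub(1)])
    have "\<exists>a. i < Suc d \<longrightarrow> fs ! i = proj a" for i
    proof (cases "i < Suc d")
      case True
      then have "fs ! i \<in> set fs" using l by (intro nth_mem) simp
      then show ?thesis using proj_surj sub(2) by blast
    qed simp
    then obtain y where y: "\<And>i. i < Suc d \<Longrightarrow> fs ! i = proj (y i)" by metis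
    have "ideal_chain (\<lambda>i. {a. proj a \<in> genideal Q (set (take i fs))}) y (Suc d)"
    proof (rule ideal_chain_preimage)
      fix i assume i: "i < Suc d"
      have "set (take i fs) \<subseteq> genideal Q (set (take (Suc i) fs))"
        using Q.genideal_self[OF sub(1)[of "Suc i"]] set_take_subset_set_take[of i "Suc i" fs] by auto
      then show "genideal Q (set (take i fs)) \<subseteq> genideal Q (set (take (Suc i) fs))"
        by (rule Q.genideal_minimal[OF id])
      have "proj (y i) \<in> set (take (Suc i) fs)" using y[OF i] i l by (simp add: take_Suc_conv_app_nth)
      then show "proj (y i) \<in> genideal Q (set (take (Suc i) fs))" using Q.genideal_self[OF sub(1)] by blast
      fix a assume "proj (y i) \<otimes>\<^bsub>Q\<^esub> proj a \<in> genideal Q (set (take i fs))"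
      then have a: "fs ! i \<otimes>\<^bsub>Q\<^esub> proj a \<in> genideal Q (set (take i fs))" by (simp only: y[OF i])
      have "i < length fs" using i l by simp
      then show "proj a \<in> genideal Q (set (take i fs))" by (rule nonzerodivisor[rule_format, OF _ proj_closed a])
    next
      have "genideal Q (set (take (Suc d) fs)) \<subseteq> genideal Q (set fs)"
        by (rule Q.genideal_minimal[OF Q.genideal_ideal[OF sub(2)] order.trans[OF set_take_subset Q.genideal_self[OF sub(2)]]])
      moreover have "genideal Q (set fs) \<noteq> carrier Q" using reg unfolding regular_sequence_def by blast
      moreover have "genideal Q (set fs) \<subseteq> carrier Q"
        using ideal.Icarr[OF Q.genideal_ideal[OF sub(2)]] by blast
      ultimately show "genideal Q (set (take (Suc d) fs)) \<noteq> carrier Q" by blast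
    qed (rule id)
    then show False
      using chain[of "\<lambda>i. {a. proj a \<in> genideal Q (set (take i fs))}" y "Suc d"] preimage_ideal(2)[OF id[of 0]] by simp
  qed
qed

lemma depth_ge:
  assumes reg: "\<And>i a. i < d \<Longrightarrow> \<theta> i * a \<in> span i \<theta> \<Longrightarrow> a \<in> span i \<theta>" and proper: "1 \<notin> span d \<theta>"
    and max: "\<And>i. i < d \<Longrightarrow> proj (\<theta> i) \<in> A"
  shows "enat d \<le> depth Q A"
proof -
  define fs where "fs = map (\<lambda>i. proj (\<theta> i)) [0..<d]"
  have take: "set (take i fs) = proj ` \<theta> ` {..<i}" if "i \<le> d" for i
    using that by (auto simp: fs_def take_map)
  have set: "set fs = proj ` \<theta> ` {..<d}" using take[of d] by (simp add: fs_def)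
  have span: "proj a \<in> proj ` span i \<theta> \<longleftrightarrow> a \<in> span i \<theta>" for a i
    by (rule image_ideal(2)[OF span_ideal(1,2)])
  have "regular_sequence Q fs"
    unfolding regular_sequence_def
  proof (intro conjI allI ballI impI)
    show "set fs \<subseteq> carrier Q" unfolding set by auto
    show "genideal Q (set fs) \<noteq> carrier Q"
      unfolding set genideal_span using span[of 1 d] proper proj_closed[of 1] by blast
    fix i B assume i: "i < length fs" and B: "B \<in> carrier Q" "fs ! i \<otimes>\<^bsub>Q\<^esub> B \<in> genideal Q (set (take i fs))"
    have id: "i < d" using i by (simp add: fs_def)
    then have t: "genideal Q (set (take i fs)) = proj ` span i \<theta>" using take[of i] by (simp add: genideal_span)
    obtain b where b: "B = proj b" using proj_surj[OF B(1)] by blast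
    have "\<theta> i * b \<in> span i \<theta>" using B(2) id unfolding t b by (simp add: fs_def span flip: proj_mult)
    then show "B \<in> genideal Q (set (take i fs))" unfolding t b span by (rule reg[OF id])
  qed
  moreover have "set fs \<subseteq> A" unfolding set using max by auto
  moreover have "length fs = d" by (simp add: fs_def)
  ultimately show ?thesis unfolding depth_def by (intro Sup_upper) blast
qed

end

text \<open>Sets the variables outside \<open>G\<close> to zero.\<close>

definition mrestrict :: "'v set \<Rightarrow> ('v, 'k::field) mpoly \<Rightarrow> ('v, 'k) mpoly" where
  "mrestrict G p = Abs_poly_mapping (\<lambda>a. if Poly_Mapping.keys a \<subseteq> G then Poly_Mapping.lookup p a else 0)"

lemma lookup_mrestrict: "Poly_Mapping.lookup (mrestrict G p) a = (if Poly_Mapping.keys a \<subseteq> G then Poly_Mapping.lookup p a else 0)"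
proof -
  have "finite {a. (if Poly_Mapping.keys a \<subseteq> G then Poly_Mapping.lookup p a else 0) \<noteq> 0}"
    by (rule finite_subset[OF _ finite_keys[of p]]) (auto simp: in_keys_iff)
  then show ?thesis by (simp add: mrestrict_def)
qed

text \<open>The quotient is the polynomial ring in the variables of \<open>G\<close>, a domain: the
  product of the restrictions is supported on \<open>G\<close> and lies in the ideal, so it is
  zero.\<close>

lemma face_ideal_Pow_prime:
  fixes p q :: "('v::{finite,linorder}, 'k::field) mpoly"
  assumes "p * q \<in> face_ideal (Pow G)"
  shows "p \<in> face_ideal (Pow G) \<or> q \<in> face_ideal (Pow G)"
proof -
  interpret cring_ideal "face_ideal (Pow G) :: ('v, 'k) mpoly set"
    by (rule cring_ideal_face_ideal) (auto simp: down_closed_def)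
  have rest: "r - mrestrict G r \<in> face_ideal (Pow G)" for r :: "('v, 'k) mpoly"
    by (rule face_idealI) (simp add: lookup_minus lookup_mrestrict)
  have "p * q - mrestrict G p * mrestrict G q = (p - mrestrict G p) * q + mrestrict G p * (q - mrestrict G q)"
    by (simp add: algebra_simps)
  then have "p * q - mrestrict G p * mrestrict G q \<in> face_ideal (Pow G)"
    using rest by (auto intro: add_mem mult_mem mult_mem_right)
  then have m: "mrestrict G p * mrestrict G q \<in> face_ideal (Pow G)" using assms mem_cong by blast
  have "mrestrict G p * mrestrict G q = 0"
  proof (rule poly_mapping_eqI, rule ccontr)
    fix a assume "Poly_Mapping.lookup (mrestrict G p * mrestrict G q) a \<noteq> Poly_Mapping.lookup 0 a"
    then have a: "a \<in> Poly_Mapping.keys (mrestrict G p * mrestrict G q)" by (simp add: in_keys_iff)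
    then obtain b c where bc: "a = b + c" "b \<in> Poly_Mapping.keys (mrestrict G p)" "c \<in> Poly_Mapping.keys (mrestrict G q)"
      using keys_mult[of "mrestrict G p" "mrestrict G q"] by blast
    then have "Poly_Mapping.keys b \<subseteq> G" "Poly_Mapping.keys c \<subseteq> G"
      by (auto simp: in_keys_iff lookup_mrestrict split: if_splits)
    then have "Poly_Mapping.keys a \<in> Pow G" using bc(1) by (simp add: keys_plus_nat)
    then show False using m a by (simp add: face_ideal_def)
  qed
  then have "mrestrict G p = 0 \<or> mrestrict G q = 0" by simp
  then show ?thesis using rest[of p] rest[of q] by auto
qed

context skeletal_complex
begin

text \<open>Depth and Krull dimension both equal \<open>d\<close>. The upper bounds are
  \<open>ideal_chain_length\<close>; the dimension is bounded below by a flag inside the top face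
  \<open>F\<close>, the depth by the symmetric polynomials.\<close>

lemma cohen_macaulay_of_basis:
  assumes down: "down_closed \<Delta>" and onto: "cochains_onto TYPE('k::field) tops" and det: "cochains_determine TYPE('k) d tops"
    and d: "d < CARD('v)" and F: "F \<in> \<Delta>" "card F = d"
  shows "cohen_macaulay (face_ideal \<Delta> :: ('v, 'k) mpoly set)"
proof -
  interpret quotient_ring "face_ideal \<Delta> :: ('v, 'k) mpoly set"
    unfolding quotient_ring_def by (rule cring_ideal_face_ideal[OF down])
  have chain: "m \<noteq> Suc d" if "ideal_chain J y m" "face_ideal \<Delta> \<subseteq> J 0"
    for J and y :: "nat \<Rightarrow> ('v, 'k) mpoly" and m
    by (rule ideal_chain_length[OF that face_card])
  let ?M = "quotient_max_ideal (face_ideal \<Delta> :: ('v, 'k) mpoly set)"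
  have "krull_dim Q \<le> enat d" by (rule krull_dim_le[OF chain])
  moreover have "depth Q ?M \<le> enat d" by (rule depth_le[OF chain])
  moreover have "enat d \<le> krull_dim Q"
  proof -
    obtain xs where xs: "distinct xs" "set xs = F" using finite_distinct_list[of F] by auto
    then have len: "length xs = d" using F(2) distinct_card by fastforce
    \<comment> \<open>The prime grows as the vertex set shrinks. Dropping the \<open>d\<close>
      vertices of \<open>F\<close> one by one gives \<open>d + 1\<close> primes, and the vertex
      dropped at step \<open>i\<close> lies in the next prime only.\<close>
    define P where "P i = proj ` face_ideal (Pow (set (drop i xs)))" for i
    have dc: "down_closed (Pow G)" for G :: "'v set" by (auto simp: down_closed_def)
    have sub: "(face_ideal \<Delta> :: ('v, 'k) mpoly set) \<subseteq> face_ideal (Pow (set (drop i xs)))" for i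
    proof -
      have "Pow (set (drop i xs)) \<subseteq> \<Delta>"
        using down F(1) xs(2) set_drop_subset[of i xs] unfolding down_closed_def by blast
      then show ?thesis unfolding face_ideal_def by blast
    qed
    have "primeideal (P i) Q" for i
      unfolding P_def
      by (rule prime_image[OF cring_ideal_face_ideal[OF dc] sub _ face_ideal_Pow_prime])
        (auto simp: face_ideal_def)
    moreover have "P i \<subset> P (Suc i)" if i: "i < d" for i
    proof -
      have sd: "set (drop (Suc i) xs) \<subseteq> set (drop i xs)" by (simp add: set_drop_subset_set_drop)
      define v where "v = xs ! i"
      have v: "v \<in> set (drop i xs)" "v \<notin> set (drop (Suc i) xs)"
        using i len xs(1) by (auto simp: v_def Cons_nth_drop_Suc[symmetric] dest: distinct_drop[of _ i])
      have "P i \<subseteq> P (Suc i)" unfolding P_def using sd by (intro image_mono) (auto simp: face_ideal_def)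
      moreover have "proj (Poly_Mapping.single (mind {v}) 1) \<in> P (Suc i)"
        unfolding P_def using v(2) by (intro imageI) (auto simp: face_ideal_def)
      moreover have "proj (Poly_Mapping.single (mind {v}) 1) \<notin> P i"
        unfolding P_def image_ideal(2)[OF cring_ideal_face_ideal[OF dc] sub] using v(1) by (auto simp: face_ideal_def)
      ultimately show ?thesis by blast
    qed
    ultimately show ?thesis unfolding krull_dim_def by (intro Sup_upper) blast
  qed
  moreover have "enat d \<le> depth Q ?M"
  proof (rule depth_ge[where \<theta> = "\<lambda>i. esym (Suc i)"])
    fix i and a :: "('v, 'k) mpoly"
    assume i: "i < d" and "esym (Suc i) * a \<in> span i (\<lambda>i. esym (Suc i))"
    then show "a \<in> span i (\<lambda>i. esym (Suc i))"
      using esym_regular[OF down onto det d i] unfolding span_def by blast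
  next
    have e0: "Poly_Mapping.lookup (esym (Suc j) :: ('v, 'k) mpoly) 0 = 0" for j
      using homogeneous_esym[of "Suc j", where ?'a = 'v and ?'b = 'k] unfolding homogeneous_lookup
      by (metis mdeg_zero nat.distinct(1) of_nat_eq_iff)
    have "1 - (\<Sum>j<d. esym (Suc j) * g j) \<notin> (face_ideal \<Delta> :: ('v, 'k) mpoly set)" for g
    proof
      assume "1 - (\<Sum>j<d. esym (Suc j) * g j) \<in> (face_ideal \<Delta> :: ('v, 'k) mpoly set)"
      moreover have "Poly_Mapping.keys (0 :: 'v \<Rightarrow>\<^sub>0 nat) \<in> \<Delta>" using small_faces[of "{}"] d_ge_2 by simp
      ultimately have "Poly_Mapping.lookup (1 - (\<Sum>j<d. esym (Suc j) * g j)) (0 :: 'v \<Rightarrow>\<^sub>0 nat) = (0 :: 'k)" by (rule face_idealD)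
      then show False by (simp add: lookup_minus lookup_sum lookup_times_0 e0)
    qed
    then show "1 \<notin> span d (\<lambda>i. esym (Suc i))" unfolding span_def by blast
  next
    fix i assume "i < d"
    have sub: "range (\<lambda>v. proj (pvar v)) \<subseteq> carrier Q" by auto
    have M: "?M = genideal Q (range (\<lambda>v. proj (pvar v)))"
      unfolding quotient_max_ideal_def proj_def ..
    interpret P: cring_ideal "{a. proj a \<in> ?M}"
      unfolding M by (rule preimage_ideal(1)[OF Q.genideal_ideal[OF sub]])
    have v: "pvar v \<in> {a. proj a \<in> ?M}" for v
      unfolding M using Q.genideal_self[OF sub] by blast
    have "(esym (Suc i) :: ('v, 'k) mpoly) \<in> {a. proj a \<in> ?M}"
      unfolding esym_def
    proof (rule P.sum_mem)
      fix G :: "'v set" assume "G \<in> {G. card G = Suc i}"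
      then obtain w where w: "w \<in> G" by fastforce
      have "(\<Prod>v\<in>G. pvar v) = pvar w * (\<Prod>v\<in>G - {w}. pvar v :: ('v, 'k) mpoly)"
        by (rule prod.remove[OF _ w]) simp
      then show "(\<Prod>v\<in>G. pvar v) \<in> {a. proj a \<in> ?M}" using P.mult_mem_right[OF v] by simp
    qed
    then show "proj (esym (Suc i)) \<in> ?M" by simp
  qed
  ultimately show ?thesis unfolding cohen_macaulay_def by (simp add: order.antisym)
qed

end

section \<open>Assembling the cover\<close>

lemma complex_dim_eqD:
  fixes \<Delta> :: "'v::finite set set"
  assumes "complex_dim \<Delta> = int d - 1" "\<Delta> \<noteq> {}"
  shows "F \<in> \<Delta> \<Longrightarrow> card F \<le> d" "\<exists>F\<in>\<Delta>. card F = d"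
proof -
  have fin: "finite (face_dim ` \<Delta>)" by simp
  show "card F \<le> d" if "F \<in> \<Delta>"
    using Max_ge[OF fin imageI[OF that]] assms(1) by (simp add: complex_dim_def face_dim_def)
  have "Max (face_dim ` \<Delta>) \<in> face_dim ` \<Delta>" using assms(2) by (intro Max_in fin) simp
  then show "\<exists>F\<in>\<Delta>. card F = d" using assms(1) by (auto simp: complex_dim_def face_dim_def)
qed

lemma complex_dim_eqI:
  fixes \<Delta> :: "'v::finite set set"
  assumes "\<And>F. F \<in> \<Delta> \<Longrightarrow> card F \<le> d" "F \<in> \<Delta>" "card F = d"
  shows "complex_dim \<Delta> = int d - 1"
  unfolding complex_dim_def
proof (rule Max_eqI)
  show "int d - 1 \<in> face_dim ` \<Delta>" using assms(2,3) by (intro image_eqI[of _ _ F]) (simp_all add: face_dim_def)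
  fix x assume "x \<in> face_dim ` \<Delta>"
  then obtain H where "H \<in> \<Delta>" "x = int (card H) - 1" by (auto simp: face_dim_def)
  then show "x \<le> int d - 1" using assms(1)[of H] by simp
qed simp

theorem corollary5p3:
  fixes c d :: nat and \<Delta>min :: "'v::{finite,linorder} set set"
  assumes "c \<ge> 1" and "d \<ge> 2" and "CARD('v) = c + d"
    and "simplicial_complex \<Delta>min" and "complex_dim \<Delta>min = int d - 1"
    and "buchsbaum TYPE('k::field) \<Delta>min"
    and "linear_resolution d (stanley_reisner_ideal TYPE('k) \<Delta>min)"
    and "local_cohomology_dim (stanley_reisner_ideal TYPE('k) \<Delta>min) (d - 1)
           = enat (nat \<lfloor>real (\<Prod>i = c..c + d - 2. i) / fact d\<rfloor>)"
  shows "\<exists>\<Delta>'. cohen_macaulay_cover TYPE('k) d \<Delta>min \<Delta>'"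
proof -
  have d: "d < CARD('v)" using assms(1,3) by simp
  have down: "down_closed \<Delta>min" using assms(4) by (simp add: simplicial_complex_def down_closed_def)
  have ne: "\<Delta>min \<noteq> {}" using assms(4) unfolding simplicial_complex_def by blast
  note dim = complex_dim_eqD[OF assms(5) ne]
  have lin: "indeg (face_ideal \<Delta>min :: ('v, 'k) mpoly set) = enat d" "reg (face_ideal \<Delta>min :: ('v, 'k) mpoly set) = int d - 1"
    using assms(7) unfolding stanley_reisner_ideal_eq[OF down] linear_resolution_def by auto
  \<comment> \<open>A missing set with fewer than \<open>d\<close> elements would put its monomial,
    of degree below \<open>indeg\<close>, into the ideal.\<close>
  have small: "F \<in> \<Delta>min" if "card F < d" for F
  proof (rule ccontr)
    assume "F \<notin> \<Delta>min"
    then have "enat d \<le> enat (card F)" using indeg_le[of F \<Delta>min, where ?'k = 'k] lin(1) by simp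
    then show False using that by simp
  qed
  interpret m: skeletal_complex \<Delta>min d by unfold_locales (use small dim(1) assms(2) in auto)
  have "cochains_onto TYPE('k) m.tops" by (rule m.onto_of_reg[OF down _ lin(2)]) (use d in simp)
  moreover have "card G = d" if "G \<in> m.tops" for G using that by (simp add: m.tops_def)
  ultimately have "\<exists>B. m.tops \<subseteq> B \<and> (\<forall>G\<in>B. card G = d) \<and> cochains_onto TYPE('k) B \<and> cochains_determine TYPE('k) d B"
    by (rule extend_to_basis)
  then obtain B where B: "m.tops \<subseteq> B" "\<And>G. G \<in> B \<Longrightarrow> card G = d" "cochains_onto TYPE('k) B" "cochains_determine TYPE('k) d B"
    by blast
  define \<Delta>' where "\<Delta>' = {F. card F < d} \<union> B"
  have down': "down_closed \<Delta>'"
    unfolding down_closed_def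
  proof (intro ballI allI impI)
    fix F G assume F: "F \<in> \<Delta>'" and G: "G \<subseteq> F"
    have "card F \<le> d" using F B(2) by (auto simp: \<Delta>'_def)
    show "G \<in> \<Delta>'"
    proof (cases "G = F")
      case False
      then have "card G < card F" using G by (intro psubset_card_mono) auto
      then show ?thesis using \<open>card F \<le> d\<close> by (simp add: \<Delta>'_def)
    qed (use F in simp)
  qed
  interpret s: skeletal_complex \<Delta>' d by unfold_locales (use B(2) assms(2) in \<open>auto simp: \<Delta>'_def\<close>)
  have tops: "s.tops = B" unfolding s.tops_def using B(2) by (auto simp: \<Delta>'_def)
  have sub: "\<Delta>min \<subseteq> \<Delta>'"
  proof
    fix F assume "F \<in> \<Delta>min"
    then show "F \<in> \<Delta>'" using dim(1)[of F] B(1) by (cases "card F < d") (auto simp: \<Delta>'_def m.tops_def)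
  qed
  obtain F where F: "F \<in> \<Delta>'" "card F = d" using dim(2) sub by blast
  \<comment> \<open>Since \<open>c \<ge> 1\<close> gives \<open>d < CARD('v)\<close>, an independent
    family cannot contain all \<open>d\<close>-sets. The nonface that remains keeps the initial
    degree of the enlarged complex at \<open>d\<close>.\<close>
  obtain G where G: "card G = d" "G \<notin> B" using not_cochains_onto_all[OF B(3) d] by blast
  then have GD: "G \<notin> \<Delta>'" by (simp add: \<Delta>'_def)
  have onto: "cochains_onto TYPE('k) s.tops" and det: "cochains_determine TYPE('k) d s.tops" using B(3,4) by (simp_all add: tops)
  have "cohen_macaulay_cover TYPE('k) d \<Delta>min \<Delta>'"
    unfolding cohen_macaulay_cover_def stanley_reisner_ideal_eq[OF down] stanley_reisner_ideal_eq[OF down']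
  proof (intro conjI assms(4,5) lin(1) sub)
    show "simplicial_complex \<Delta>'" using down' assms(2) by (auto simp: simplicial_complex_def down_closed_def \<Delta>'_def)
    show "complex_dim \<Delta>' = int d - 1" by (rule complex_dim_eqI[OF s.face_card F])
    show "cohen_macaulay (face_ideal \<Delta>' :: ('v, 'k) mpoly set)"
      by (rule s.cohen_macaulay_of_basis[OF down' onto det d F])
    show "linear_resolution d (face_ideal \<Delta>' :: ('v, 'k) mpoly set)"
      by (rule s.linear_resolution_of_onto[OF down' onto G(1) GD])
  qed
  then show ?thesis by blast
qed

end
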